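(* Let $k$ be a field of prime characteristic $p$, let $A=k\oplus A_+$ be a divided powers algebra in $pdCom_k$, and let $I$ be the kernel of the multiplication map $\mu:A\otimes_kA\to A$. Let $X=\mathrm{Spec}\,A$, $Y=\mathrm{Spec}\,k$, and let $\mathcal{M}$ be a $p$-$\mathcal{O}_X$-module. Then there is a bijection $$\mathrm{Hom}_{p-\mathcal{O}_X}(\widetilde{I/I^2},\mathcal{M})\simeq \mathrm{Der}_p(\mathcal{O}_X,\mathcal{M}),\qquad a\mapsto a\circ d_{X/Y},$$ where $d_{X/Y}:\mathcal{O}_X\to\widetilde{I/I^2}$ denotes the universal derivation.
   Context: Let $k$ be a field of prime characteristic $p$. The category $pdCom$ has objects $(A,\pi)$ where $A=A_0\oplus A_+$ is a pregraded commutative $k$-algebra ($A_0$ a subalgebra containing $1$, $A_+$ an ideal) and $\pi:A_+\to A_+$ is a map (the $p$-map) with: $x^p=0$; $\pi(x+y)=\pi(x)+\pi(y)+\sum_{j=1}^{p-1}\frac{(-1)^j}{j}x^jy^{p-j}$; $\pi(xy)=0$; $\pi(a_0x)=a_0^p\pi(x)$, for $x,y\in A_+$, $a_0\in A_0$. Morphisms are $k$-algebra homomorphisms $f$ with $f(A_+)\subset A'_+$ and $f\pi=\pi'f$. $pdCom_k$ is the subcategory of augmented algebras $A=k\oplus A_+$ (i.e. $A_0=k$). (Such $\pi$ is equivalent to a system of divided powers on $A_+$ with $\gamma_p=\pi$.) Let $k[P]=\{\sum_i\lambda_iP^i\}$ with $P\lambda=\lambda^pP$ for $\lambda\in k$.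 For $A\in pdCom$, $V(A)$ is the ring with underlying $k$-module $A\otimes_kk[P]$ and multiplication determined by $(a\otimes1)(a'\otimes1)=aa'\otimes1$, $(1\otimes q)(1\otimes q')=1\otimes qq'$, $(a\otimes1)(1\otimes P)=a\otimes P$, $(1\otimes P)(a\otimes1)=0$ for $a\in A_+$, $(1\otimes P)(a_0\otimes1)=a_0^p\otimes P$ for $a_0\in A_0$. A morphism $A\to B$ induces a ring homomorphism $V(A)\to V(B)$. For a $V(A)$-module $M$ write $Pm=(1\otimes P)m$, $am=(a\otimes 1)m$, and $\mathrm{Der}_p(A,M)=\{D\in\mathrm{Der}_k(A,M)\mid D(\pi(a))=PD(a)-a^{p-1}D(a)\ \forall a\in A_+\}$ (Beck derivations). A $p$-ringed space is a ringed space $(X,\mathcal{O}_X)$ with $\mathcal{O}_X$ a sheaf of divided powers algebras in $pdCom$. For $A\in pdCom_k$, $(\mathrm{Spec}\,A,\mathcal{O}_{\mathrm{Spec}A})$ is a $p$-ringed space, where each localization $A_f$ is pregraded with $p$-map $\pi(x/f^i)=\pi(x)/f^{ip}$, $x\in A_+$. A $p$-$\mathcal{O}_X$-module is a sheaf of abelian groups $\mathcal{M}$ on $X$ such that $\mathcal{M}(U)$ is a $V(\mathcal{O}_X(U))$-module for every open $U$, with restrictions compatible with the maps $V(\mathcal{O}_X(U))\to V(\mathcal{O}_X(V))$ for $V\subset U$. $\mathrm{Hom}_{p-\mathcal{O}_X}(\mathcal{M},\mathcal{N})$ is the set of morphisms of sheaves of abelian groups whose component at every open $U$ is $V(\mathcal{O}_X(U))$-linear.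 For a $V(A)$-module $M$, the sheaf $\widetilde{M}$ on $\mathrm{Spec}\,A$ is a $p$-$\mathcal{O}_{\mathrm{Spec}A}$-module, with $M_f$ carrying the action $P(m/f^i)=Pm/f^{pi}$. $\mathrm{Der}_p(\mathcal{O}_X,\mathcal{M})$ is the set of morphisms of sheaves of $k$-vector spaces $D:\mathcal{O}_X\to\mathcal{M}$ such that $D_U\in\mathrm{Der}_p(\mathcal{O}_X(U),\mathcal{M}(U))$ for every open $U\subset X$. $T=A\otimes_kA$ is in $pdCom_k$ with $T_+=(k\otimes A_+)\oplus(A_+\otimes k)\oplus(A_+\otimes A_+)$ and $p$-map determined by $\pi(a\otimes1)=\pi(a)\otimes1$, $\pi(1\otimes a)=1\otimes\pi(a)$, $a\in A_+$; it preserves $I$ and induces a map $P:I/I^2\to I/I^2$ making $I/I^2$ a $V(A)$-module. Let $d:A\to I/I^2$, $d(x)=(1\otimes x-x\otimes1)+I^2$. The universal derivation $d_{X/Y}$ is given on basic open sets $D(f)$ by $d_{A_f}:A_f\to(I/I^2)_f$, $d_{A_f}(a/f^i)=\frac{1}{f^i}d(a)-\frac{1}{f^{2i}}a\,d(f^i)$. *)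

theory Defs
  imports
    "HOL-Computational_Algebra.Primes"
    "HOL-Analysis.Abstract_Topology"
    "HOL-Algebra.Free_Abelian_Groups"
    "HOL-Algebra.Generated_Groups"
    "HOL-Algebra.QuotRing"
    "HOL-Algebra.Ideal_Product"
    "HOL-Algebra.Subrings"
    "HOL-Algebra.UnivPoly"
begin

section \<open>Divided powers algebras\<close>

definition has_characteristic :: "('k, 'e) ring_scheme \<Rightarrow> nat \<Rightarrow> bool" where
  "has_characteristic K p \<longleftrightarrow> (\<forall>n::nat. [n] \<cdot>\<^bsub>K\<^esub> \<one>\<^bsub>K\<^esub> = \<zero>\<^bsub>K\<^esub> \<longleftrightarrow> p dvd n)"

record ('k, 'a) pd_alg = "('k, 'a) module" +
  zero_part :: "'a set"
  pos_part :: "'a set"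
  pmap :: "'a \<Rightarrow> 'a"

locale pdCom = Module.algebra K A
  for K :: "('k, 'e) ring_scheme" (structure)
    and A :: "('k, 'a, 'z) pd_alg_scheme" (structure)
    and p :: nat +
  assumes zero_part_subring: "subring (zero_part A) A"
    and zero_part_smult:
      "\<lbrakk>c \<in> carrier K; a \<in> zero_part A\<rbrakk> \<Longrightarrow> c \<odot>\<^bsub>A\<^esub> a \<in> zero_part A"
    and pos_part_ideal: "ideal (pos_part A) A"
    and parts_sum: "zero_part A <+>\<^bsub>A\<^esub> pos_part A = carrier A"
    and parts_inter: "zero_part A \<inter> pos_part A = {\<zero>\<^bsub>A\<^esub>}"
    and pmap_closed: "x \<in> pos_part A \<Longrightarrow> pmap A x \<in> pos_part A"
    and pos_part_pow: "x \<in> pos_part A \<Longrightarrow> x [^]\<^bsub>A\<^esub> p = \<zero>\<^bsub>A\<^esub>"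
    and pmap_add:
      "\<lbrakk>x \<in> pos_part A; y \<in> pos_part A\<rbrakk> \<Longrightarrow>
        pmap A (x \<oplus>\<^bsub>A\<^esub> y) = pmap A x \<oplus>\<^bsub>A\<^esub> pmap A y \<oplus>\<^bsub>A\<^esub>
          (\<Oplus>\<^bsub>A\<^esub>j\<in>{1..p-1}.
            ((\<ominus>\<^bsub>K\<^esub> \<one>\<^bsub>K\<^esub>) [^]\<^bsub>K\<^esub> j \<otimes>\<^bsub>K\<^esub> inv\<^bsub>K\<^esub> ([j] \<cdot>\<^bsub>K\<^esub> \<one>\<^bsub>K\<^esub>))
              \<odot>\<^bsub>A\<^esub> (x [^]\<^bsub>A\<^esub> j \<otimes>\<^bsub>A\<^esub> y [^]\<^bsub>A\<^esub> (p - j)))"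
    and pmap_mult:
      "\<lbrakk>x \<in> pos_part A; y \<in> pos_part A\<rbrakk> \<Longrightarrow> pmap A (x \<otimes>\<^bsub>A\<^esub> y) = \<zero>\<^bsub>A\<^esub>"
    and pmap_scale:
      "\<lbrakk>a \<in> zero_part A; x \<in> pos_part A\<rbrakk> \<Longrightarrow>
        pmap A (a \<otimes>\<^bsub>A\<^esub> x) = a [^]\<^bsub>A\<^esub> p \<otimes>\<^bsub>A\<^esub> pmap A x"

text \<open>In the augmented case the copy of \<open>k\<close> in \<open>A\<close> is the image of the structure map, which is
  required to be injective (so \<open>A \<noteq> 0\<close>).\<close>

locale pdCom_k = pdCom +
  assumes zero_part_k: "zero_part A = (\<lambda>c. c \<odot>\<^bsub>A\<^esub> \<one>\<^bsub>A\<^esub>) ` carrier K"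
    and unit_inj: "inj_on (\<lambda>c. c \<odot>\<^bsub>A\<^esub> \<one>\<^bsub>A\<^esub>) (carrier K)"


section \<open>The ring \<open>V(A)\<close> and its modules\<close>

definition deg_zero :: "('k, 'a, 'z) pd_alg_scheme \<Rightarrow> 'a \<Rightarrow> 'a" where
  "deg_zero A a = (THE b. b \<in> zero_part A \<and> (\<exists>x\<in>pos_part A. a = b \<oplus>\<^bsub>A\<^esub> x))"

definition V_frob :: "nat \<Rightarrow> ('k, 'a, 'z) pd_alg_scheme \<Rightarrow> 'a \<Rightarrow> 'a" where
  "V_frob p A a = deg_zero A a [^]\<^bsub>A\<^esub> p"

text \<open>The powers of \<open>P\<close> are a basis of the left \<open>k\<close>-module \<open>k[P]\<close>, so \<open>A \<otimes>\<^sub>k k[P]\<close> is the left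
  \<open>A\<close>-module of finite sums \<open>\<Sum>\<^sub>i v\<^sub>i \<otimes> P\<^sup>i\<close>; such a sum is represented by its coefficient sequence
  \<open>v\<close>, i.e. by an element of \<^term>\<open>up A\<close>.  The rules for \<open>(1 \<otimes> P)(a \<otimes> 1)\<close> say
  \<open>P a = \<phi>(a) P\<close> with \<open>\<phi>(a\<^sub>0 + x) = a\<^sub>0\<^sup>p\<close> (\<^const>\<open>V_frob\<close>), whence
  \<open>(a P\<^sup>i)(b P\<^sup>j) = a \<phi>\<^sup>i(b) P\<^sup>i\<^sup>+\<^sup>j\<close>.\<close>

definition V_ring :: "nat \<Rightarrow> ('k, 'a, 'z) pd_alg_scheme \<Rightarrow> (nat \<Rightarrow> 'a) ring" where
  "V_ring p A =
    \<lparr>carrier = up A,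
     mult = (\<lambda>v\<in>up A. \<lambda>w\<in>up A. \<lambda>n. \<Oplus>\<^bsub>A\<^esub>i\<in>{..n}. v i \<otimes>\<^bsub>A\<^esub> (V_frob p A ^^ i) (w (n - i))),
     one = \<one>\<^bsub>UP A\<^esub>,
     zero = \<zero>\<^bsub>UP A\<^esub>,
     add = add (UP A)\<rparr>"

definition V_of :: "('k, 'a, 'z) pd_alg_scheme \<Rightarrow> 'a \<Rightarrow> (nat \<Rightarrow> 'a)" where
  "V_of A a = monom (UP A) a 0"

definition V_P :: "('k, 'a, 'z) pd_alg_scheme \<Rightarrow> (nat \<Rightarrow> 'a)" where
  "V_P A = monom (UP A) \<one>\<^bsub>A\<^esub> 1"

context pdCom
begin

lemma semiring_A: "semiring A"
  by unfold_locales

lemma ring_A: "ring A"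
  by unfold_locales

lemma deg_zero_eq:
  assumes "b \<in> zero_part A" "x \<in> pos_part A"
  shows "deg_zero A (b \<oplus>\<^bsub>A\<^esub> x) = b"
proof -
  interpret S: subring "zero_part A" A by (rule zero_part_subring)
  interpret I: ideal "pos_part A" A by (rule pos_part_ideal)
  show ?thesis
    unfolding deg_zero_def
  proof (rule the_equality)
    show "b \<in> zero_part A \<and> (\<exists>y\<in>pos_part A. b \<oplus>\<^bsub>A\<^esub> x = b \<oplus>\<^bsub>A\<^esub> y)" using assms by blast
  next
    fix c assume "c \<in> zero_part A \<and> (\<exists>y\<in>pos_part A. b \<oplus>\<^bsub>A\<^esub> x = c \<oplus>\<^bsub>A\<^esub> y)"
    then obtain y where c: "c \<in> zero_part A" and y: "y \<in> pos_part A"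
      and eq: "b \<oplus>\<^bsub>A\<^esub> x = c \<oplus>\<^bsub>A\<^esub> y" by blast
    have car: "b \<in> carrier A" "c \<in> carrier A" "x \<in> carrier A" "y \<in> carrier A"
      using assms c y S.subset I.a_subset by auto
    have *: "c \<ominus>\<^bsub>A\<^esub> b = x \<ominus>\<^bsub>A\<^esub> y"
    proof -
      have "c \<ominus>\<^bsub>A\<^esub> b = (c \<oplus>\<^bsub>A\<^esub> y) \<ominus>\<^bsub>A\<^esub> y \<ominus>\<^bsub>A\<^esub> b"
        using car by (simp add: a_minus_def M.a_assoc M.r_neg)
      also have "\<dots> = (b \<oplus>\<^bsub>A\<^esub> x) \<ominus>\<^bsub>A\<^esub> y \<ominus>\<^bsub>A\<^esub> b" using eq by simp
      also have "\<dots> = x \<ominus>\<^bsub>A\<^esub> y"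
        using car by (simp add: a_minus_def M.a_assoc M.a_comm[of _ "\<ominus>\<^bsub>A\<^esub> b"] M.r_neg1)
      finally show ?thesis .
    qed
    have "c \<ominus>\<^bsub>A\<^esub> b \<in> zero_part A" using assms c
      by (simp add: a_minus_def subringE(5,7)[OF zero_part_subring])
    moreover have "x \<ominus>\<^bsub>A\<^esub> y \<in> pos_part A" using assms y
      by (simp add: a_minus_def I.a_closed I.a_inv_closed)
    ultimately have "c \<ominus>\<^bsub>A\<^esub> b = \<zero>\<^bsub>A\<^esub>" using * parts_inter by auto
    then show "c = b" using car by (simp add: ring.r_right_minus_eq[OF ring_A])
  qed
qed

lemma V_frob_eq:
  assumes "b \<in> zero_part A" "x \<in> pos_part A"
  shows "V_frob p A (b \<oplus>\<^bsub>A\<^esub> x) = b [^]\<^bsub>A\<^esub> p"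
  using deg_zero_eq[OF assms] by (simp add: V_frob_def)

lemma V_frob_iter_closed: "b \<in> carrier A \<Longrightarrow> (V_frob p A ^^ i) b \<in> carrier A"
proof (induction i)
  case (Suc i)
  interpret S: subring "zero_part A" A by (rule zero_part_subring)
  have "(V_frob p A ^^ i) b \<in> zero_part A <+>\<^bsub>A\<^esub> pos_part A"
    using Suc parts_sum by simp
  then obtain c x where "c \<in> zero_part A" "x \<in> pos_part A" "(V_frob p A ^^ i) b = c \<oplus>\<^bsub>A\<^esub> x"
    by (auto simp: set_add_def')
  then show ?case using V_frob_eq[of c x] S.subset by auto
qed simp

lemma V_frob_iter_zero: "0 < p \<Longrightarrow> (V_frob p A ^^ i) \<zero>\<^bsub>A\<^esub> = \<zero>\<^bsub>A\<^esub>"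
proof (induction i)
  case (Suc i)
  interpret S: subring "zero_part A" A by (rule zero_part_subring)
  interpret I: ideal "pos_part A" A by (rule pos_part_ideal)
  have "V_frob p A (\<zero>\<^bsub>A\<^esub> \<oplus>\<^bsub>A\<^esub> \<zero>\<^bsub>A\<^esub>) = \<zero>\<^bsub>A\<^esub> [^]\<^bsub>A\<^esub> p"
    using parts_inter by (intro V_frob_eq) auto
  then show ?case using Suc by (simp add: semiring.nat_pow_zero[OF semiring_A])
qed simp

lemma V_mult_monom:
  assumes "0 < p" "a \<in> carrier A" "b \<in> carrier A"
  shows "monom (UP A) a i \<otimes>\<^bsub>V_ring p A\<^esub> monom (UP A) b j =
    monom (UP A) (a \<otimes>\<^bsub>A\<^esub> (V_frob p A ^^ i) b) (i + j)"
proof -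
  have fr: "(V_frob p A ^^ i) b \<in> carrier A" for i
    using V_frob_iter_closed[OF assms(3)] .
  let ?m = "\<lambda>a n k. if k = n then a else \<zero>\<^bsub>A\<^esub>"
  have up: "?m c n \<in> up A" if "c \<in> carrier A" for c n
    using that by (auto simp: up_def intro!: exI[of _ n])
  have mon: "monom (UP A) c n = ?m c n" if "c \<in> carrier A" for c n
    using that by (auto simp: UP_def)
  have "(\<Oplus>\<^bsub>A\<^esub>k\<in>{..n}. ?m a i k \<otimes>\<^bsub>A\<^esub> (V_frob p A ^^ k) (?m b j (n - k))) =
      ?m (a \<otimes>\<^bsub>A\<^esub> (V_frob p A ^^ i) b) (i + j) n" for n
  proof -
    have "(\<Oplus>\<^bsub>A\<^esub>k\<in>{..n}. ?m a i k \<otimes>\<^bsub>A\<^esub> (V_frob p A ^^ k) (?m b j (n - k))) =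
       (\<Oplus>\<^bsub>A\<^esub>k\<in>{..n}. if i = k then ?m (a \<otimes>\<^bsub>A\<^esub> (V_frob p A ^^ i) b) (i + j) n else \<zero>\<^bsub>A\<^esub>)"
      using assms fr by (intro M.finsum_cong') (auto simp: V_frob_iter_zero)
    also have "\<dots> = ?m (a \<otimes>\<^bsub>A\<^esub> (V_frob p A ^^ i) b) (i + j) n"
    proof (cases "i \<le> n")
      case True
      then show ?thesis using assms fr
        by (subst M.finsum_singleton) auto
    next
      case False
      then show ?thesis
        by (subst M.finsum_cong'[of _ _ "\<lambda>_. \<zero>\<^bsub>A\<^esub>"]) auto
    qed
    finally show ?thesis .
  qed
  then show ?thesis using assms fr up by (simp add: mon V_ring_def fun_eq_iff)
qed

lemma V_rules:
  assumes "0 < p"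
  shows "\<lbrakk>a \<in> carrier A; b \<in> carrier A\<rbrakk> \<Longrightarrow>
      V_of A a \<otimes>\<^bsub>V_ring p A\<^esub> V_of A b = V_of A (a \<otimes>\<^bsub>A\<^esub> b)"
    and "a \<in> carrier A \<Longrightarrow> V_of A a \<otimes>\<^bsub>V_ring p A\<^esub> V_P A = monom (UP A) a 1"
    and "x \<in> pos_part A \<Longrightarrow> V_P A \<otimes>\<^bsub>V_ring p A\<^esub> V_of A x = \<zero>\<^bsub>V_ring p A\<^esub>"
    and "b \<in> zero_part A \<Longrightarrow>
      V_P A \<otimes>\<^bsub>V_ring p A\<^esub> V_of A b = monom (UP A) (b [^]\<^bsub>A\<^esub> p) 1"
proof -
  interpret S: subring "zero_part A" A by (rule zero_part_subring)
  interpret I: ideal "pos_part A" A by (rule pos_part_ideal)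
  have z: "\<zero>\<^bsub>A\<^esub> \<in> zero_part A" "\<zero>\<^bsub>A\<^esub> \<in> pos_part A"
    using parts_inter by auto
  note [simp] = V_of_def V_P_def V_mult_monom[OF assms]
  show "\<lbrakk>a \<in> carrier A; b \<in> carrier A\<rbrakk> \<Longrightarrow>
      V_of A a \<otimes>\<^bsub>V_ring p A\<^esub> V_of A b = V_of A (a \<otimes>\<^bsub>A\<^esub> b)"
    by simp
  show "a \<in> carrier A \<Longrightarrow> V_of A a \<otimes>\<^bsub>V_ring p A\<^esub> V_P A = monom (UP A) a 1"
    by simp
  show "V_P A \<otimes>\<^bsub>V_ring p A\<^esub> V_of A x = \<zero>\<^bsub>V_ring p A\<^esub>" if x: "x \<in> pos_part A"
  proof -
    have xc: "x \<in> carrier A" using x I.a_subset by auto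
    then have "V_frob p A x = \<zero>\<^bsub>A\<^esub>"
      using V_frob_eq[OF z(1) x] assms by (simp add: semiring.nat_pow_zero[OF semiring_A])
    then have "V_P A \<otimes>\<^bsub>V_ring p A\<^esub> V_of A x = monom (UP A) \<zero>\<^bsub>A\<^esub> 1" using xc by simp
    also have "\<dots> = \<zero>\<^bsub>V_ring p A\<^esub>" by (simp add: V_ring_def UP_def fun_eq_iff)
    finally show ?thesis .
  qed
  show "V_P A \<otimes>\<^bsub>V_ring p A\<^esub> V_of A b = monom (UP A) (b [^]\<^bsub>A\<^esub> p) 1" if b: "b \<in> zero_part A"
  proof -
    have bc: "b \<in> carrier A" using b S.subset by auto
    then show ?thesis using V_frob_eq[OF b z(2)] by simp
  qed
qed

end

locale left_module = R?: ring R + M?: abelian_group M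
  for R :: "('r, 'e) ring_scheme" (structure)
    and M :: "('r, 'm, 'z) module_scheme" (structure) +
  assumes smult_closed:
      "\<lbrakk>a \<in> carrier R; x \<in> carrier M\<rbrakk> \<Longrightarrow> a \<odot>\<^bsub>M\<^esub> x \<in> carrier M"
    and smult_l_distr:
      "\<lbrakk>a \<in> carrier R; b \<in> carrier R; x \<in> carrier M\<rbrakk> \<Longrightarrow>
        (a \<oplus>\<^bsub>R\<^esub> b) \<odot>\<^bsub>M\<^esub> x = a \<odot>\<^bsub>M\<^esub> x \<oplus>\<^bsub>M\<^esub> b \<odot>\<^bsub>M\<^esub> x"
    and smult_r_distr:
      "\<lbrakk>a \<in> carrier R; x \<in> carrier M; y \<in> carrier M\<rbrakk> \<Longrightarrow>
        a \<odot>\<^bsub>M\<^esub> (x \<oplus>\<^bsub>M\<^esub> y) = a \<odot>\<^bsub>M\<^esub> x \<oplus>\<^bsub>M\<^esub> a \<odot>\<^bsub>M\<^esub> y"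
    and smult_assoc:
      "\<lbrakk>a \<in> carrier R; b \<in> carrier R; x \<in> carrier M\<rbrakk> \<Longrightarrow>
        (a \<otimes>\<^bsub>R\<^esub> b) \<odot>\<^bsub>M\<^esub> x = a \<odot>\<^bsub>M\<^esub> (b \<odot>\<^bsub>M\<^esub> x)"
    and smult_one: "x \<in> carrier M \<Longrightarrow> \<one>\<^bsub>R\<^esub> \<odot>\<^bsub>M\<^esub> x = x"

definition A_act ::
  "('k, 'a, 'y) pd_alg_scheme \<Rightarrow> (nat \<Rightarrow> 'a, 'm, 'z) module_scheme \<Rightarrow> 'a \<Rightarrow> 'm \<Rightarrow> 'm" where
  "A_act A M a m = V_of A a \<odot>\<^bsub>M\<^esub> m"

definition P_act ::
  "('k, 'a, 'y) pd_alg_scheme \<Rightarrow> (nat \<Rightarrow> 'a, 'm, 'z) module_scheme \<Rightarrow> 'm \<Rightarrow> 'm" where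
  "P_act A M m = V_P A \<odot>\<^bsub>M\<^esub> m"

text \<open>Conversely, actions of \<open>A\<close> and \<open>P\<close> on an additive group determine the action
  \<open>(\<Sum>\<^sub>i v\<^sub>i \<otimes> P\<^sup>i) m = \<Sum>\<^sub>i v\<^sub>i P\<^sup>i m\<close>.  The multiplicative fields are irrelevant for a module.\<close>

definition V_module ::
  "('k, 'a, 'y) pd_alg_scheme \<Rightarrow> ('m, 'z) ring_scheme \<Rightarrow> ('a \<Rightarrow> 'm \<Rightarrow> 'm) \<Rightarrow> ('m \<Rightarrow> 'm)
    \<Rightarrow> (nat \<Rightarrow> 'a, 'm) module" where
  "V_module A N act P =
    \<lparr>carrier = carrier N, mult = mult N, one = one N, zero = zero N, add = add N,
     smult = (\<lambda>v m. \<Oplus>\<^bsub>N\<^esub>i\<in>{i. v i \<noteq> \<zero>\<^bsub>A\<^esub>}. act (v i) ((P ^^ i) m))\<rparr>"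

definition Der_p ::
  "('k, 'e) ring_scheme \<Rightarrow> nat \<Rightarrow> ('k, 'a, 'y) pd_alg_scheme \<Rightarrow> (nat \<Rightarrow> 'a, 'm, 'z) module_scheme
    \<Rightarrow> ('a \<Rightarrow> 'm) set" where
  "Der_p K p A M = {D \<in> carrier A \<rightarrow>\<^sub>E carrier M.
     (\<forall>a\<in>carrier A. \<forall>b\<in>carrier A. D (a \<oplus>\<^bsub>A\<^esub> b) = D a \<oplus>\<^bsub>M\<^esub> D b) \<and>
     (\<forall>c\<in>carrier K. \<forall>a\<in>carrier A. D (c \<odot>\<^bsub>A\<^esub> a) = A_act A M (c \<odot>\<^bsub>A\<^esub> \<one>\<^bsub>A\<^esub>) (D a)) \<and>
     (\<forall>a\<in>carrier A. \<forall>b\<in>carrier A.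
        D (a \<otimes>\<^bsub>A\<^esub> b) = A_act A M a (D b) \<oplus>\<^bsub>M\<^esub> A_act A M b (D a)) \<and>
     (\<forall>a\<in>pos_part A.
        D (pmap A a) = P_act A M (D a) \<ominus>\<^bsub>M\<^esub> A_act A M (a [^]\<^bsub>A\<^esub> (p - 1)) (D a))}"


section \<open>Sheaves\<close>

record ('x, 's, 'r) presheaf =
  sections :: "'x set \<Rightarrow> 'r"
  restr :: "'x set \<Rightarrow> 'x set \<Rightarrow> 's \<Rightarrow> 's"

locale sheaf_ab =
  fixes X :: "'x topology"
    and F :: "('x, 's, ('s, 'z) ring_scheme, 'w) presheaf_scheme"
  assumes sections_group: "openin X U \<Longrightarrow> abelian_group (sections F U)"
    and restr_hom:
      "\<lbrakk>openin X U; openin X W; W \<subseteq> U\<rbrakk> \<Longrightarrow>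
        restr F U W \<in> hom (add_monoid (sections F U)) (add_monoid (sections F W))"
    and restr_id:
      "\<lbrakk>openin X U; s \<in> carrier (sections F U)\<rbrakk> \<Longrightarrow> restr F U U s = s"
    and restr_restr:
      "\<lbrakk>openin X U; openin X W; openin X W'; W' \<subseteq> W; W \<subseteq> U; s \<in> carrier (sections F U)\<rbrakk> \<Longrightarrow>
        restr F W W' (restr F U W s) = restr F U W' s"
    and locality:
      "\<lbrakk>\<And>W. W \<in> \<U> \<Longrightarrow> openin X W; U = \<Union>\<U>;
        s \<in> carrier (sections F U); t \<in> carrier (sections F U);
        \<And>W. W \<in> \<U> \<Longrightarrow> restr F U W s = restr F U W t\<rbrakk> \<Longrightarrow> s = t"
    and gluing:
      "\<lbrakk>\<And>W. W \<in> \<U> \<Longrightarrow> openin X W; U = \<Union>\<U>;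
        \<And>W. W \<in> \<U> \<Longrightarrow> f W \<in> carrier (sections F W);
        \<And>W W'. \<lbrakk>W \<in> \<U>; W' \<in> \<U>\<rbrakk> \<Longrightarrow> restr F W (W \<inter> W') (f W) = restr F W' (W \<inter> W') (f W')\<rbrakk> \<Longrightarrow>
        \<exists>s\<in>carrier (sections F U). \<forall>W\<in>\<U>. restr F U W s = f W"

text \<open>A ring homomorphism \<open>A \<rightarrow> B\<close> induces \<open>V(A) \<rightarrow> V(B)\<close> by acting on coefficients; this is used
  for the restriction maps of \<open>\<O>\<close>.\<close>

locale p_O_module = sheaf_ab X M
  for p :: nat
    and X :: "'x topology"
    and \<O> :: "('x, 's, ('k, 's, 'y) pd_alg_scheme, 'v) presheaf_scheme"
    and M :: "('x, 'm, (nat \<Rightarrow> 's, 'm, 'z) module_scheme, 'w) presheaf_scheme" +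
  assumes sections_module:
      "openin X U \<Longrightarrow> left_module (V_ring p (sections \<O> U)) (sections M U)"
    and restr_smult:
      "\<lbrakk>openin X U; openin X W; W \<subseteq> U;
        v \<in> carrier (V_ring p (sections \<O> U)); m \<in> carrier (sections M U)\<rbrakk> \<Longrightarrow>
        restr M U W (v \<odot>\<^bsub>sections M U\<^esub> m) =
          (\<lambda>i. restr \<O> U W (v i)) \<odot>\<^bsub>sections M W\<^esub> restr M U W m"

text \<open>A morphism of sheaves is a family of maps indexed by the open sets; the extensionality
  conditions make equality of families agree with equality of morphisms.\<close>

definition sheaf_hom ::
  "'x topology \<Rightarrow> ('x, 's, ('s, 'y) ring_scheme, 'v) presheaf_scheme
    \<Rightarrow> ('x, 't, ('t, 'z) ring_scheme, 'w) presheaf_scheme \<Rightarrow> ('x set \<Rightarrow> 's \<Rightarrow> 't) set" where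
  "sheaf_hom X F G = {\<phi> \<in> extensional {U. openin X U}.
     (\<forall>U. openin X U \<longrightarrow>
        \<phi> U \<in> extensional (carrier (sections F U)) \<and>
        \<phi> U \<in> hom (add_monoid (sections F U)) (add_monoid (sections G U))) \<and>
     (\<forall>U W. openin X U \<longrightarrow> openin X W \<longrightarrow> W \<subseteq> U \<longrightarrow>
        (\<forall>s\<in>carrier (sections F U). \<phi> W (restr F U W s) = restr G U W (\<phi> U s)))}"

definition sheaf_comp ::
  "'x topology \<Rightarrow> ('x, 's, ('s, 'y) ring_scheme, 'v) presheaf_scheme
    \<Rightarrow> ('x set \<Rightarrow> 't \<Rightarrow> 'u) \<Rightarrow> ('x set \<Rightarrow> 's \<Rightarrow> 't) \<Rightarrow> ('x set \<Rightarrow> 's \<Rightarrow> 'u)" where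
  "sheaf_comp X F \<psi> \<phi> = (\<lambda>U\<in>{U. openin X U}. compose (carrier (sections F U)) (\<psi> U) (\<phi> U))"

definition Hom_p_O ::
  "nat \<Rightarrow> 'x topology \<Rightarrow> ('x, 's, ('k, 's, 'y) pd_alg_scheme, 'v) presheaf_scheme
    \<Rightarrow> ('x, 'm, (nat \<Rightarrow> 's, 'm, 'z) module_scheme, 'w) presheaf_scheme
    \<Rightarrow> ('x, 'n, (nat \<Rightarrow> 's, 'n, 'z1) module_scheme, 'w1) presheaf_scheme
    \<Rightarrow> ('x set \<Rightarrow> 'm \<Rightarrow> 'n) set" where
  "Hom_p_O p X \<O> M N = {\<phi> \<in> sheaf_hom X M N.
     \<forall>U. openin X U \<longrightarrow>
       (\<forall>v\<in>carrier (V_ring p (sections \<O> U)). \<forall>m\<in>carrier (sections M U).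
          \<phi> U (v \<odot>\<^bsub>sections M U\<^esub> m) = v \<odot>\<^bsub>sections N U\<^esub> \<phi> U m)}"

definition Der_p_O ::
  "('k, 'e) ring_scheme \<Rightarrow> nat \<Rightarrow> 'x topology
    \<Rightarrow> ('x, 's, ('k, 's, 'y) pd_alg_scheme, 'v) presheaf_scheme
    \<Rightarrow> ('x, 'm, (nat \<Rightarrow> 's, 'm, 'z) module_scheme, 'w) presheaf_scheme
    \<Rightarrow> ('x set \<Rightarrow> 's \<Rightarrow> 'm) set" where
  "Der_p_O K p X \<O> M = {D \<in> sheaf_hom X \<O> M.
     \<forall>U. openin X U \<longrightarrow> D U \<in> Der_p K p (sections \<O> U) (sections M U)}"


section \<open>Localization\<close>

text \<open>Fractions \<open>m/s\<close> with \<open>m\<close> in an \<open>A\<close>-module \<open>N\<close> (with action \<open>act\<close>) and \<open>s\<close> in a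
  multiplicative set \<open>S\<close>.  Operations on fractions are unions over all representatives, which
  are all equal.\<close>

definition frac_rel ::
  "('m, 'z) ring_scheme \<Rightarrow> ('a \<Rightarrow> 'm \<Rightarrow> 'm) \<Rightarrow> 'a set \<Rightarrow> (('m \<times> 'a) \<times> ('m \<times> 'a)) set" where
  "frac_rel N act S = {((m, s), (n, t)).
     m \<in> carrier N \<and> n \<in> carrier N \<and> s \<in> S \<and> t \<in> S \<and>
     (\<exists>u\<in>S. act u (act t m) = act u (act s n))}"

definition frac ::
  "('m, 'z) ring_scheme \<Rightarrow> ('a \<Rightarrow> 'm \<Rightarrow> 'm) \<Rightarrow> 'a set \<Rightarrow> 'm \<Rightarrow> 'a \<Rightarrow> ('m \<times> 'a) set" where
  "frac N act S m s = frac_rel N act S `` {(m, s)}"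

text \<open>For \<open>a/f\<close> of positive degree the \<open>p\<close>-map is computed on representatives whose numerator lies
  in \<open>A\<^sub>+\<close>.  Since \<open>f\<^sup>p = f\<^sub>0\<^sup>p\<close>, every fraction can be written with a denominator in \<open>A\<^sub>0\<close>, and the
  degree zero part consists of the fractions with numerator and denominator in \<open>A\<^sub>0\<close>.\<close>

definition loc_alg ::
  "nat \<Rightarrow> ('k, 'a, 'z) pd_alg_scheme \<Rightarrow> 'a set \<Rightarrow> ('k, ('a \<times> 'a) set) pd_alg" where
  "loc_alg p A S = (let fr = frac A (mult A) S in
    \<lparr>carrier = {fr a s | a s. a \<in> carrier A \<and> s \<in> S},
     mult = (\<lambda>x y. \<Union>(a, s)\<in>x. \<Union>(b, t)\<in>y. fr (a \<otimes>\<^bsub>A\<^esub> b) (s \<otimes>\<^bsub>A\<^esub> t)),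
     one = fr \<one>\<^bsub>A\<^esub> \<one>\<^bsub>A\<^esub>,
     zero = fr \<zero>\<^bsub>A\<^esub> \<one>\<^bsub>A\<^esub>,
     add = (\<lambda>x y. \<Union>(a, s)\<in>x. \<Union>(b, t)\<in>y. fr (t \<otimes>\<^bsub>A\<^esub> a \<oplus>\<^bsub>A\<^esub> s \<otimes>\<^bsub>A\<^esub> b) (s \<otimes>\<^bsub>A\<^esub> t)),
     smult = (\<lambda>c x. \<Union>(a, s)\<in>x. fr (c \<odot>\<^bsub>A\<^esub> a) s),
     zero_part = {fr a s | a s. a \<in> zero_part A \<and> s \<in> S \<inter> zero_part A},
     pos_part = {fr a s | a s. a \<in> pos_part A \<and> s \<in> S},
     pmap = (\<lambda>x. \<Union>(a, s)\<in>{(a, s)\<in>x. a \<in> pos_part A}. fr (pmap A a) (s [^]\<^bsub>A\<^esub> p))\<rparr>)"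

definition loc_group ::
  "('k, 'a, 'y) pd_alg_scheme \<Rightarrow> (nat \<Rightarrow> 'a, 'm, 'z) module_scheme \<Rightarrow> 'a set
    \<Rightarrow> ('m \<times> 'a) set ring" where
  "loc_group A M S = (let fr = frac M (A_act A M) S in
    \<lparr>carrier = {fr m s | m s. m \<in> carrier M \<and> s \<in> S},
     mult = undefined,
     one = undefined,
     zero = fr \<zero>\<^bsub>M\<^esub> \<one>\<^bsub>A\<^esub>,
     add = (\<lambda>x y. \<Union>(m, s)\<in>x. \<Union>(n, t)\<in>y.
        fr (A_act A M t m \<oplus>\<^bsub>M\<^esub> A_act A M s n) (s \<otimes>\<^bsub>A\<^esub> t))\<rparr>)"

definition loc_module ::
  "nat \<Rightarrow> ('k, 'a, 'y) pd_alg_scheme \<Rightarrow> (nat \<Rightarrow> 'a, 'm, 'z) module_scheme \<Rightarrow> 'a set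
    \<Rightarrow> (nat \<Rightarrow> ('a \<times> 'a) set, ('m \<times> 'a) set) module" where
  "loc_module p A M S = (let fr = frac M (A_act A M) S in
    V_module (loc_alg p A S) (loc_group A M S)
      (\<lambda>x y. \<Union>(a, s)\<in>x. \<Union>(m, t)\<in>y. fr (A_act A M a m) (s \<otimes>\<^bsub>A\<^esub> t))
      (\<lambda>y. \<Union>(m, s)\<in>y. fr (P_act A M m) (s [^]\<^bsub>A\<^esub> p)))"


section \<open>The spectrum, its structure sheaf, and the sheaf of a module\<close>

definition basic_open :: "('a, 'z) ring_scheme \<Rightarrow> 'a \<Rightarrow> 'a set set" where
  "basic_open A f = {\<pp>. primeideal \<pp> A \<and> f \<notin> \<pp>}"

definition Spec :: "('a, 'z) ring_scheme \<Rightarrow> 'a set topology" where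
  "Spec A = topology_generated_by (basic_open A ` carrier A)"

text \<open>Sections over \<open>U\<close> are the functions on \<open>U\<close> with values in the stalks that are locally given by
  a single fraction.\<close>

definition frac_sections ::
  "('a, 'y) ring_scheme \<Rightarrow> ('m, 'z) ring_scheme \<Rightarrow> ('a \<Rightarrow> 'm \<Rightarrow> 'm) \<Rightarrow> 'a set set
    \<Rightarrow> ('a set \<Rightarrow> ('m \<times> 'a) set) set" where
  "frac_sections A N act U = {s \<in> extensional U.
     \<forall>\<pp>\<in>U. \<exists>W m f. openin (Spec A) W \<and> \<pp> \<in> W \<and> W \<subseteq> U \<and> m \<in> carrier N \<and> f \<in> carrier A \<and>
       (\<forall>\<qq>\<in>W. f \<notin> \<qq> \<and> s \<qq> = frac N act (carrier A - \<qq>) m f)}"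

definition stalk_alg ::
  "nat \<Rightarrow> ('k, 'a, 'z) pd_alg_scheme \<Rightarrow> 'a set \<Rightarrow> ('k, ('a \<times> 'a) set) pd_alg" where
  "stalk_alg p A \<pp> = loc_alg p A (carrier A - \<pp>)"

definition stalk_module ::
  "nat \<Rightarrow> ('k, 'a, 'y) pd_alg_scheme \<Rightarrow> (nat \<Rightarrow> 'a, 'm, 'z) module_scheme \<Rightarrow> 'a set
    \<Rightarrow> (nat \<Rightarrow> ('a \<times> 'a) set, ('m \<times> 'a) set) module" where
  "stalk_module p A M \<pp> = loc_module p A M (carrier A - \<pp>)"

type_synonym 'a spec_section = "'a set \<Rightarrow> ('a \<times> 'a) set"

definition O_sections ::
  "nat \<Rightarrow> ('k, 'a, 'z) pd_alg_scheme \<Rightarrow> 'a set set \<Rightarrow> ('k, 'a spec_section) pd_alg" where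
  "O_sections p A U = (let C = frac_sections A A (mult A) U in
    \<lparr>carrier = C,
     mult = (\<lambda>s t. \<lambda>\<pp>\<in>U. s \<pp> \<otimes>\<^bsub>stalk_alg p A \<pp>\<^esub> t \<pp>),
     one = (\<lambda>\<pp>\<in>U. \<one>\<^bsub>stalk_alg p A \<pp>\<^esub>),
     zero = (\<lambda>\<pp>\<in>U. \<zero>\<^bsub>stalk_alg p A \<pp>\<^esub>),
     add = (\<lambda>s t. \<lambda>\<pp>\<in>U. s \<pp> \<oplus>\<^bsub>stalk_alg p A \<pp>\<^esub> t \<pp>),
     smult = (\<lambda>c s. \<lambda>\<pp>\<in>U. c \<odot>\<^bsub>stalk_alg p A \<pp>\<^esub> s \<pp>),
     zero_part = {s \<in> C. \<forall>\<pp>\<in>U. s \<pp> \<in> zero_part (stalk_alg p A \<pp>)},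
     pos_part = {s \<in> C. \<forall>\<pp>\<in>U. s \<pp> \<in> pos_part (stalk_alg p A \<pp>)},
     pmap = (\<lambda>s. \<lambda>\<pp>\<in>U. pmap (stalk_alg p A \<pp>) (s \<pp>))\<rparr>)"

definition O_Spec ::
  "nat \<Rightarrow> ('k, 'a, 'z) pd_alg_scheme
    \<Rightarrow> ('a set, 'a spec_section, ('k, 'a spec_section) pd_alg) presheaf" where
  "O_Spec p A = \<lparr>sections = O_sections p A, restr = (\<lambda>U W s. restrict s W)\<rparr>"

definition tilde_sections ::
  "nat \<Rightarrow> ('k, 'a, 'y) pd_alg_scheme \<Rightarrow> (nat \<Rightarrow> 'a, 'm, 'z) module_scheme \<Rightarrow> 'a set set
    \<Rightarrow> (nat \<Rightarrow> 'a spec_section, 'a set \<Rightarrow> ('m \<times> 'a) set) module" where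
  "tilde_sections p A M U =
    \<lparr>carrier = frac_sections A M (A_act A M) U,
     mult = undefined,
     one = undefined,
     zero = (\<lambda>\<pp>\<in>U. \<zero>\<^bsub>stalk_module p A M \<pp>\<^esub>),
     add = (\<lambda>s t. \<lambda>\<pp>\<in>U. s \<pp> \<oplus>\<^bsub>stalk_module p A M \<pp>\<^esub> t \<pp>),
     smult = (\<lambda>v s. \<lambda>\<pp>\<in>U. (\<lambda>i. v i \<pp>) \<odot>\<^bsub>stalk_module p A M \<pp>\<^esub> s \<pp>)\<rparr>"

definition tilde ::
  "nat \<Rightarrow> ('k, 'a, 'y) pd_alg_scheme \<Rightarrow> (nat \<Rightarrow> 'a, 'm, 'z) module_scheme
    \<Rightarrow> ('a set, 'a set \<Rightarrow> ('m \<times> 'a) set,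
        (nat \<Rightarrow> 'a spec_section, 'a set \<Rightarrow> ('m \<times> 'a) set) module) presheaf" where
  "tilde p A M = \<lparr>sections = tilde_sections p A M, restr = (\<lambda>U W s. restrict s W)\<rparr>"


section \<open>The tensor square \<open>A \<otimes>\<^sub>k A\<close>\<close>

text \<open>\<open>A \<otimes>\<^sub>k A\<close> is the free abelian group on \<open>A \<times> A\<close> modulo the \<open>k\<close>-bilinearity relations.  The
  free group carries the ring structure with \<open>(a, b)(c, d) = (ac, bd)\<close>, for which the subgroup of
  relations is an ideal.\<close>

definition pair_ring :: "('a, 'z) ring_scheme \<Rightarrow> ('a \<times> 'a \<Rightarrow>\<^sub>0 int) ring" where
  "pair_ring A =
    \<lparr>carrier = {x. Poly_Mapping.keys x \<subseteq> carrier A \<times> carrier A},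
     mult = (\<lambda>x y. frag_extend (\<lambda>(a, b). frag_extend (\<lambda>(c, d).
        frag_of (a \<otimes>\<^bsub>A\<^esub> c, b \<otimes>\<^bsub>A\<^esub> d)) y) x),
     one = frag_of (\<one>\<^bsub>A\<^esub>, \<one>\<^bsub>A\<^esub>),
     zero = 0,
     add = (+)\<rparr>"

definition tensor_rels ::
  "('k, 'e) ring_scheme \<Rightarrow> ('k, 'a, 'z) module_scheme \<Rightarrow> ('a \<times> 'a \<Rightarrow>\<^sub>0 int) set" where
  "tensor_rels K A =
     {frag_of (a \<oplus>\<^bsub>A\<^esub> a', b) - frag_of (a, b) - frag_of (a', b) | a a' b.
        a \<in> carrier A \<and> a' \<in> carrier A \<and> b \<in> carrier A} \<union>
     {frag_of (a, b \<oplus>\<^bsub>A\<^esub> b') - frag_of (a, b) - frag_of (a, b') | a b b'.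
        a \<in> carrier A \<and> b \<in> carrier A \<and> b' \<in> carrier A} \<union>
     {frag_of (c \<odot>\<^bsub>A\<^esub> a, b) - frag_of (a, c \<odot>\<^bsub>A\<^esub> b) | c a b.
        c \<in> carrier K \<and> a \<in> carrier A \<and> b \<in> carrier A}"

definition tensor_ideal ::
  "('k, 'e) ring_scheme \<Rightarrow> ('k, 'a, 'z) module_scheme \<Rightarrow> ('a \<times> 'a \<Rightarrow>\<^sub>0 int) set" where
  "tensor_ideal K A = generate (add_monoid (pair_ring A)) (tensor_rels K A)"

definition tensor_ring ::
  "('k, 'e) ring_scheme \<Rightarrow> ('k, 'a, 'z) module_scheme \<Rightarrow> ('a \<times> 'a \<Rightarrow>\<^sub>0 int) set ring" where
  "tensor_ring K A = pair_ring A Quot tensor_ideal K A"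

definition pure_tensor ::
  "('k, 'e) ring_scheme \<Rightarrow> ('k, 'a, 'z) module_scheme \<Rightarrow> 'a \<Rightarrow> 'a \<Rightarrow> ('a \<times> 'a \<Rightarrow>\<^sub>0 int) set" where
  "pure_tensor K A a b = tensor_ideal K A +>\<^bsub>pair_ring A\<^esub> frag_of (a, b)"

text \<open>The pregraded algebra \<open>A \<otimes>\<^sub>k A\<close>, for \<open>A \<in> pdCom\<^sub>k\<close>, equipped with a candidate \<open>p\<close>-map \<open>q\<close>.\<close>

definition tensor_with ::
  "('k, 'e) ring_scheme \<Rightarrow> ('k, 'a, 'z) pd_alg_scheme
    \<Rightarrow> (('a \<times> 'a \<Rightarrow>\<^sub>0 int) set \<Rightarrow> ('a \<times> 'a \<Rightarrow>\<^sub>0 int) set)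
    \<Rightarrow> ('k, ('a \<times> 'a \<Rightarrow>\<^sub>0 int) set) pd_alg" where
  "tensor_with K A q = (let T = tensor_ring K A; k = (\<lambda>c. c \<odot>\<^bsub>A\<^esub> \<one>\<^bsub>A\<^esub>) ` carrier K in
    \<lparr>carrier = carrier T, mult = mult T, one = one T, zero = zero T, add = add T,
     smult = (\<lambda>c t. pure_tensor K A (c \<odot>\<^bsub>A\<^esub> \<one>\<^bsub>A\<^esub>) \<one>\<^bsub>A\<^esub> \<otimes>\<^bsub>T\<^esub> t),
     zero_part = {pure_tensor K A c c' | c c'. c \<in> k \<and> c' \<in> k},
     pos_part =
       {pure_tensor K A c x | c x. c \<in> k \<and> x \<in> pos_part A} <+>\<^bsub>T\<^esub>
       {pure_tensor K A x c | c x. c \<in> k \<and> x \<in> pos_part A} <+>\<^bsub>T\<^esub>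
       generate (add_monoid T) {pure_tensor K A x y | x y. x \<in> pos_part A \<and> y \<in> pos_part A},
     pmap = q\<rparr>)"

definition tensor_pmap ::
  "('k, 'e) ring_scheme \<Rightarrow> nat \<Rightarrow> ('k, 'a, 'z) pd_alg_scheme
    \<Rightarrow> ('a \<times> 'a \<Rightarrow>\<^sub>0 int) set \<Rightarrow> ('a \<times> 'a \<Rightarrow>\<^sub>0 int) set" where
  "tensor_pmap K p A = (THE q.
     q \<in> extensional (pos_part (tensor_with K A q)) \<and>
     pdCom K (tensor_with K A q) p \<and>
     (\<forall>a\<in>pos_part A.
        q (pure_tensor K A a \<one>\<^bsub>A\<^esub>) = pure_tensor K A (pmap A a) \<one>\<^bsub>A\<^esub> \<and>
        q (pure_tensor K A \<one>\<^bsub>A\<^esub> a) = pure_tensor K A \<one>\<^bsub>A\<^esub> (pmap A a)))"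

definition tensor_square ::
  "('k, 'e) ring_scheme \<Rightarrow> nat \<Rightarrow> ('k, 'a, 'z) pd_alg_scheme
    \<Rightarrow> ('k, ('a \<times> 'a \<Rightarrow>\<^sub>0 int) set) pd_alg" where
  "tensor_square K p A = tensor_with K A (tensor_pmap K p A)"


section \<open>The module \<open>I/I\<^sup>2\<close> and the universal derivation\<close>

text \<open>\<open>\<mu>(\<Sum> n\<^sub>i a\<^sub>i \<otimes> b\<^sub>i) = \<Sum> n\<^sub>i a\<^sub>i b\<^sub>i\<close>, which takes a single value on each class.\<close>

definition mult_map :: "('a, 'z) ring_scheme \<Rightarrow> ('a \<times> 'a \<Rightarrow>\<^sub>0 int) set \<Rightarrow> 'a" where
  "mult_map A t = the_elem
     ((\<lambda>x. \<Oplus>\<^bsub>A\<^esub>q\<in>Poly_Mapping.keys x. [Poly_Mapping.lookup x q] \<cdot>\<^bsub>A\<^esub> (fst q \<otimes>\<^bsub>A\<^esub> snd q)) ` t)"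

definition diag_ideal ::
  "('k, 'e) ring_scheme \<Rightarrow> nat \<Rightarrow> ('k, 'a, 'z) pd_alg_scheme \<Rightarrow> ('a \<times> 'a \<Rightarrow>\<^sub>0 int) set set" where
  "diag_ideal K p A = a_kernel (tensor_square K p A) A (mult_map A)"

definition diag_ideal_sq ::
  "('k, 'e) ring_scheme \<Rightarrow> nat \<Rightarrow> ('k, 'a, 'z) pd_alg_scheme \<Rightarrow> ('a \<times> 'a \<Rightarrow>\<^sub>0 int) set set" where
  "diag_ideal_sq K p A =
     diag_ideal K p A \<cdot>\<^bsub>tensor_square K p A\<^esub> diag_ideal K p A"

text \<open>\<open>I/I\<^sup>2\<close> is the image of \<open>I\<close> in \<open>T/I\<^sup>2\<close>; \<open>a \<in> A\<close> acts as \<open>a \<otimes> 1\<close> and \<open>P\<close> by the \<open>p\<close>-map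
  of \<open>T\<close>.\<close>

definition Omega ::
  "('k, 'e) ring_scheme \<Rightarrow> nat \<Rightarrow> ('k, 'a, 'z) pd_alg_scheme
    \<Rightarrow> (nat \<Rightarrow> 'a, ('a \<times> 'a \<Rightarrow>\<^sub>0 int) set set) module" where
  "Omega K p A = (let T = tensor_square K p A; J = diag_ideal_sq K p A; Q = T Quot J in
     V_module A
       (Q\<lparr>carrier := (\<lambda>t. J +>\<^bsub>T\<^esub> t) ` diag_ideal K p A\<rparr>)
       (\<lambda>a z. (J +>\<^bsub>T\<^esub> pure_tensor K A a \<one>\<^bsub>A\<^esub>) \<otimes>\<^bsub>Q\<^esub> z)
       (\<lambda>z. \<Union>t\<in>z. J +>\<^bsub>T\<^esub> pmap T t))"

definition d_A ::
  "('k, 'e) ring_scheme \<Rightarrow> nat \<Rightarrow> ('k, 'a, 'z) pd_alg_scheme \<Rightarrow> 'a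
    \<Rightarrow> ('a \<times> 'a \<Rightarrow>\<^sub>0 int) set set" where
  "d_A K p A x = (let T = tensor_square K p A in
     diag_ideal_sq K p A +>\<^bsub>T\<^esub> (pure_tensor K A \<one>\<^bsub>A\<^esub> x \<ominus>\<^bsub>T\<^esub> pure_tensor K A x \<one>\<^bsub>A\<^esub>))"

text \<open>The quotient rule \<open>d(a/g) = (1/g) d(a) - (1/g\<^sup>2) a d(g)\<close> in the localization at \<open>S\<close>.  On a
  basic open set \<open>D(f)\<close>, where a section is a single fraction \<open>a/f\<^sup>i\<close>, it gives
  \<open>d(a/f\<^sup>i) = (1/f\<^sup>i) d(a) - (1/f\<^sup>2\<^sup>i) a d(f\<^sup>i)\<close>.\<close>

definition d_loc ::
  "('k, 'e) ring_scheme \<Rightarrow> nat \<Rightarrow> ('k, 'a, 'z) pd_alg_scheme \<Rightarrow> 'a set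
    \<Rightarrow> ('a \<times> 'a) set \<Rightarrow> (('a \<times> 'a \<Rightarrow>\<^sub>0 int) set set \<times> 'a) set" where
  "d_loc K p A S x = (let M = Omega K p A; fr = frac M (A_act A M) S in
     \<Union>(a, g)\<in>x. fr (d_A K p A a) g \<ominus>\<^bsub>loc_module p A M S\<^esub>
       fr (A_act A M a (d_A K p A g)) (g \<otimes>\<^bsub>A\<^esub> g))"

definition d_univ ::
  "('k, 'e) ring_scheme \<Rightarrow> nat \<Rightarrow> ('k, 'a, 'z) pd_alg_scheme
    \<Rightarrow> 'a set set \<Rightarrow> 'a spec_section
    \<Rightarrow> ('a set \<Rightarrow> (('a \<times> 'a \<Rightarrow>\<^sub>0 int) set set \<times> 'a) set)" where
  "d_univ K p A = (\<lambda>U\<in>{U. openin (Spec A) U}. \<lambda>s\<in>carrier (sections (O_Spec p A) U).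
     \<lambda>\<pp>\<in>U. d_loc K p A (carrier A - \<pp>) (s \<pp>))"

end

theory Submission
  imports Defs
begin

text \<open>Elements of \<open>A\<^sub>+\<close> have \<open>p\<close>-th power \<open>0\<close>, so \<open>A\<^sub>+\<close> is the only prime ideal of \<open>A\<close> and every
  element outside it is a unit.  Hence \<open>Spec A\<close> is a point with stalk \<open>A\<close>, and the theorem reduces to
  the universal property of \<open>I/I\<^sup>2\<close> among \<open>V(A)\<close>-modules.

  The correction term \<open>\<Phi>(x, y) = \<Sum>\<^sub>j (-1)\<^sup>j/j x\<^sup>j y\<^sup>p\<^sup>-\<^sup>j\<close> in the sum formula of a \<open>p\<close>-map is, up to a
  constant, the coefficient of degree \<open>p\<close> in the product of the truncated exponential series of \<open>x\<close>
  and \<open>y\<close>.  It is therefore a symmetric \<open>2\<close>-cocycle, and a \<open>p\<close>-map is an additive section of the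
  extension that it defines; on \<open>A \<otimes> A\<close> such a section can be prescribed on pure tensors.  On \<open>I\<close>
  the cocycle takes values in \<open>I\<^sup>2\<close>, so that \<open>P\<close> is additive on \<open>I/I\<^sup>2\<close>, while
  \<open>\<Phi>(1 \<otimes> a, -(a \<otimes> 1)) = a\<^sup>p\<^sup>-\<^sup>1 d(a)\<close> modulo \<open>I\<^sup>2\<close> makes \<open>d\<close> a derivation in \<open>Der\<^sub>p\<close>.\<close>

section \<open>The divided power cocycle\<close>

text \<open>A p-map is not additive, so it cannot be prescribed on pure tensors through the
  universal property of \<open>A \<otimes> A\<close>. Its graph
  \<open>x \<mapsto> (x, \<pi>(x))\<close> inside the extension is additive, and this is why the
  cocycle is studied before any tensor product appears. The exponential series enters because
  \<open>\<pi>\<close> behaves like \<open>x^p/p!\<close>: modulo p the number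
  \<open>(-1)^j/j\<close> is \<open>1/(j! (p - j)!)\<close>, as in the addition formula for divided
  powers, and only factorials below p occur.

  A second obstacle is circularity: the p-map of T is a field of the very record in which its axioms
  are stated. The construction is therefore carried out over an arbitrary candidate, and its result
  is shown not to depend on it.

  The condition on \<open>D(\<pi>(a))\<close> concerns positive elements, whereas
  \<open>I/I^2\<close> is generated by \<open>a d(b)\<close> with b arbitrary. The gap closes
  because, for \<open>A_0 = k\<close>, an element differs from its positive part by a scalar, which
  every derivation kills.

  Besides the point there is the empty open set; there the sheaf condition forces M to have a single
  section.\<close>

definition pd_cocycle :: "('a, 'b) ring_scheme \<Rightarrow> nat \<Rightarrow> 'a \<Rightarrow> 'a \<Rightarrow> 'a" where
  "pd_cocycle R p x y = (\<Oplus>\<^bsub>R\<^esub>j\<in>{0<..<p}.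
     ((\<ominus>\<^bsub>R\<^esub> \<one>\<^bsub>R\<^esub>) [^]\<^bsub>R\<^esub> j \<otimes>\<^bsub>R\<^esub> inv\<^bsub>R\<^esub> ([j] \<cdot>\<^bsub>R\<^esub> \<one>\<^bsub>R\<^esub>)) \<otimes>\<^bsub>R\<^esub> (x [^]\<^bsub>R\<^esub> j \<otimes>\<^bsub>R\<^esub> y [^]\<^bsub>R\<^esub> (p - j)))"

lemma (in ideal) nat_pow_mem:
  assumes "x \<in> I" "0 < n"
  shows "x [^] (n :: nat) \<in> I"
proof -
  obtain m where "n = Suc m" using assms(2) by (metis gr0_conv_Suc)
  then show ?thesis using assms(1) Icarr by (auto intro: I_l_closed)
qed

text \<open>The vanishing of \<open>[p] \<cdot> \<one>\<close> passes along ring homomorphisms, so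
  one locale serves for K, for A, for the tensor square and for its quotient by
  \<open>I^2\<close>.\<close>

locale prime_char = cring R for R (structure) + fixes p :: nat
  assumes prime_p: "Factorial_Ring.prime p" and char_p: "[p] \<cdot> \<one> = \<zero>"
begin

definition nn :: "nat \<Rightarrow> 'a" where "nn n = [n] \<cdot> \<one>"

lemma nn_closed [simp, intro]: "nn n \<in> carrier R"
  by (simp add: nn_def)

lemma nn_0 [simp]: "nn 0 = \<zero>" and nn_1 [simp]: "nn (Suc 0) = \<one>"
  by (simp_all add: nn_def)

lemma nn_add: "nn (m + n) = nn m \<oplus> nn n"
  by (simp add: nn_def add.nat_pow_mult)

lemma nn_Suc: "nn (Suc n) = nn n \<oplus> \<one>"
  by (simp add: nn_def)

lemma nn_mult: "nn (m * n) = nn m \<otimes> nn n"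
  by (induction n) (simp_all add: nn_add nn_Suc r_distr a_comm)

lemma nn_p [simp]: "nn p = \<zero>"
  by (simp add: nn_def char_p)

lemma p_gt_1: "1 < p" and p_gt_0 [simp]: "0 < p"
  using prime_gt_1_nat[OF prime_p] by auto

lemma nn_dvd: "p dvd n \<Longrightarrow> nn n = \<zero>"
  by (auto simp: nn_mult elim!: dvdE)

text \<open>Bezout gives \<open>n * x = p * y + 1\<close>, and the multiple of p vanishes in R. This
  is the source of all denominators below, namely \<open>j\<close> and \<open>n!\<close> for numbers
  less than p.\<close>

lemma nn_unit:
  assumes "\<not> p dvd n"
  shows "nn n \<in> Units R"
proof -
  have "n \<noteq> 0" using assms by (metis dvd_0_right)
  have g: "gcd n p = 1"
    using assms prime_p by (metis coprime_iff_gcd_eq_1 coprime_commute prime_imp_coprime_nat)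
  obtain x y where "n * x = p * y + 1"
    using bezout_nat[OF \<open>n \<noteq> 0\<close>, of p] g by auto
  then have "nn n \<otimes> nn x = \<one>"
    by (metis nn_add nn_mult nn_p l_null l_zero nn_closed nn_1 One_nat_def)
  then show ?thesis
    unfolding Units_def using m_comm nn_closed by (auto intro!: bexI[of _ "nn x"])
qed

lemma nn_fact_unit: "n < p \<Longrightarrow> nn (fact n) \<in> Units R"
  using prime_dvd_fact_iff[OF prime_p] by (intro nn_unit) auto

lemma nn_small_unit: "0 < n \<Longrightarrow> n < p \<Longrightarrow> nn n \<in> Units R"
  by (intro nn_unit) (auto dest: dvd_imp_le)

lemma binomial_theorem:
  assumes x: "x \<in> carrier R" and y: "y \<in> carrier R"
  shows "(x \<oplus> y) [^] n = (\<Oplus>i\<in>{..n}. nn (n choose i) \<otimes> (x [^] i \<otimes> y [^] (n - i)))"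
proof (induction n)
  case 0
  then show ?case by simp
next
  case (Suc n)
  note [simp] = x y
  let ?S = "\<Oplus>i\<in>{..n}. nn (n choose i) \<otimes> (x [^] i \<otimes> y [^] (n - i))"
  \<comment> \<open>The case expression is \<open>n choose (i - 1)\<close> with value 0 at
    \<open>i = 0\<close>; with it both halves of the product are sums over the same range and
    Pascal's rule applies termwise.\<close>
  let ?a = "\<lambda>i. nn (case i of 0 \<Rightarrow> 0 | Suc k \<Rightarrow> n choose k) \<otimes> (x [^] i \<otimes> y [^] (Suc n - i))"
  let ?b = "\<lambda>i. nn (n choose i) \<otimes> (x [^] i \<otimes> y [^] (Suc n - i))"
  have "?S \<otimes> x = (\<Oplus>i\<in>{..n}. ?a (Suc i))"
    by (subst finsum_ldistr) (auto intro!: finsum_cong' simp: m_ac)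
  also have "\<dots> = (\<Oplus>i\<in>{..Suc n}. ?a i)"
    by (subst finsum_Suc2) auto
  finally have Sx: "?S \<otimes> x = (\<Oplus>i\<in>{..Suc n}. ?a i)" .
  have "?S \<otimes> y = (\<Oplus>i\<in>{..n}. ?b i)"
    by (subst finsum_ldistr) (auto intro!: finsum_cong' simp: m_ac Suc_diff_le)
  also have "\<dots> = (\<Oplus>i\<in>{..Suc n}. ?b i)"
    by (subst finsum_Suc) (auto simp: binomial_eq_0)
  finally have Sy: "?S \<otimes> y = (\<Oplus>i\<in>{..Suc n}. ?b i)" .
  have "(x \<oplus> y) [^] Suc n = ?S \<otimes> x \<oplus> ?S \<otimes> y"
    using Suc by (simp add: r_distr)
  also have "\<dots> = (\<Oplus>i\<in>{..Suc n}. ?a i \<oplus> ?b i)"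
    unfolding Sx Sy by (subst finsum_addf) auto
  also have "\<dots> = (\<Oplus>i\<in>{..Suc n}. nn (Suc n choose i) \<otimes> (x [^] i \<otimes> y [^] (Suc n - i)))"
  proof (intro finsum_cong')
    fix i
    have "nn (Suc n choose i) = nn (case i of 0 \<Rightarrow> 0 | Suc k \<Rightarrow> n choose k) \<oplus> nn (n choose i)"
      by (cases i) (auto simp flip: nn_add)
    then show "?a i \<oplus> ?b i = nn (Suc n choose i) \<otimes> (x [^] i \<otimes> y [^] (Suc n - i))"
      by (simp add: l_distr)
  qed auto
  finally show ?case .
qed

lemma frobenius_add:
  assumes x: "x \<in> carrier R" and y: "y \<in> carrier R"
  shows "(x \<oplus> y) [^] p = x [^] p \<oplus> y [^] p"
proof -
  note [simp] = x y
  have "(x \<oplus> y) [^] p = (\<Oplus>i\<in>{..p}. nn (p choose i) \<otimes> (x [^] i \<otimes> y [^] (p - i)))"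
    by (rule binomial_theorem) auto
  also have "\<dots> = (\<Oplus>i\<in>{0, p}. if i = 0 then y [^] p else x [^] p)"
    using prime_p
    by (intro add.finprod_mono_neutral_cong_right) (auto simp: nn_dvd dvd_choose_prime)
  also have "\<dots> = x [^] p \<oplus> y [^] p"
    using p_gt_0 by (simp add: a_comm)
  finally show ?thesis .
qed

text \<open>Frobenius applied to \<open>1 + (-1)\<close> treats p = 2 and odd p alike.\<close>

lemma neg_one_pow_p: "(\<ominus> \<one>) [^] p = \<ominus> \<one>"
proof -
  have "(\<one> \<oplus> \<ominus> \<one>) [^] p = \<one> [^] p \<oplus> (\<ominus> \<one>) [^] p"
    by (rule frobenius_add) auto
  then have "\<one> \<oplus> (\<ominus> \<one>) [^] p = \<zero>"
    using p_gt_0 by (simp add: r_neg nat_pow_zero)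
  then show ?thesis
    by (metis a_comm a_inv_closed nat_pow_closed minus_equality one_closed)
qed

section \<open>Truncated exponential series\<close>

definition eps :: "nat \<Rightarrow> 'a" where "eps n = inv (nn (fact n))"

lemma eps_closed [simp]: "n < p \<Longrightarrow> eps n \<in> carrier R"
  by (simp add: eps_def nn_fact_unit)

lemma eps_choose:
  assumes "i \<le> n" "n < p"
  shows "eps n \<otimes> nn (n choose i) = eps i \<otimes> eps (n - i)"
proof -
  let ?F = "nn (fact i)" and ?G = "nn (fact (n - i))" and ?H = "nn (fact n)" and ?B = "nn (n choose i)"
  have H: "?H = ?F \<otimes> ?G \<otimes> ?B"
    using binomial_fact_lemma[OF assms(1)] by (simp flip: nn_mult)
  have u: "?F \<in> Units R" "?G \<in> Units R" "?H \<in> Units R"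
    using assms by (auto intro!: nn_fact_unit)
  have "eps i \<otimes> eps (n - i) = inv ?F \<otimes> inv ?G \<otimes> (inv ?H \<otimes> ?H)"
    using u Units_l_inv[OF u(3)] by (simp add: eps_def)
  also have "\<dots> = inv ?H \<otimes> ?B \<otimes> (inv ?F \<otimes> ?F) \<otimes> (inv ?G \<otimes> ?G)"
  proof -
    have "inv ?F \<otimes> inv ?G \<otimes> (inv ?H \<otimes> (?F \<otimes> ?G \<otimes> ?B)) =
        inv ?H \<otimes> ?B \<otimes> (inv ?F \<otimes> ?F) \<otimes> (inv ?G \<otimes> ?G)"
      using u(1,2) Units_inv_closed[OF u(3)]
      by (simp add: m_ac del: Units_l_inv Units_r_inv)
    then show ?thesis by (simp only: H[symmetric])
  qed
  also have "\<dots> = eps n \<otimes> ?B"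
    using u Units_l_inv[OF u(1)] Units_l_inv[OF u(2)] by (simp add: eps_def)
  finally show ?thesis by simp
qed

text \<open>The exponential series of \<open>x t\<close> as a polynomial in t. It stops below degree
  p because \<open>p!\<close> vanishes in R; the value 0 in degree p is what lets
  \<open>top_coeff\<close> measure the failure of multiplicativity.\<close>

definition trunc_exp :: "'a \<Rightarrow> nat \<Rightarrow> 'a" where
  "trunc_exp x = (\<lambda>n. if n < p then eps n \<otimes> x [^] n else \<zero>)"

lemma trunc_exp_closed [simp]: "x \<in> carrier R \<Longrightarrow> trunc_exp x n \<in> carrier R"
  by (simp add: trunc_exp_def)

lemma trunc_exp_up: "x \<in> carrier R \<Longrightarrow> trunc_exp x \<in> carrier (UP R)"
  by (auto simp: UP_def up_def trunc_exp_def bound_def intro!: exI[of _ p])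

lemma trunc_exp_0 [simp]: "trunc_exp x 0 = \<one>"
  by (simp add: trunc_exp_def eps_def)

lemma trunc_exp_p [simp]: "trunc_exp x p = \<zero>"
  by (simp add: trunc_exp_def)

text \<open>In degrees below p all factorials involved are units, so the functional equation of the
  exponential survives the truncation.\<close>

lemma trunc_exp_add:
  assumes x: "x \<in> carrier R" and y: "y \<in> carrier R" and n: "n < p"
  shows "trunc_exp (x \<oplus> y) n = (\<Oplus>i\<in>{..n}. trunc_exp x i \<otimes> trunc_exp y (n - i))"
proof -
  note [simp] = x y n
  have "trunc_exp (x \<oplus> y) n = eps n \<otimes> (\<Oplus>i\<in>{..n}. nn (n choose i) \<otimes> (x [^] i \<otimes> y [^] (n - i)))"
    by (simp add: trunc_exp_def binomial_theorem)
  also have "\<dots> = (\<Oplus>i\<in>{..n}. eps n \<otimes> (nn (n choose i) \<otimes> (x [^] i \<otimes> y [^] (n - i))))"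
    by (rule finsum_rdistr) auto
  also have "\<dots> = (\<Oplus>i\<in>{..n}. trunc_exp x i \<otimes> trunc_exp y (n - i))"
  proof (intro finsum_cong')
    fix i assume i: "i \<in> {..n}"
    then have lt: "i < p" "n - i < p" using n by (auto simp del: n)
    have "eps n \<otimes> (nn (n choose i) \<otimes> (x [^] i \<otimes> y [^] (n - i))) =
        (eps n \<otimes> nn (n choose i)) \<otimes> (x [^] i \<otimes> y [^] (n - i))"
      by (simp add: m_assoc)
    also have "\<dots> = (eps i \<otimes> eps (n - i)) \<otimes> (x [^] i \<otimes> y [^] (n - i))"
      using i n by (simp add: eps_choose)
    also have "\<dots> = trunc_exp x i \<otimes> trunc_exp y (n - i)"
      using lt by (simp add: trunc_exp_def m_ac)
    finally show "eps n \<otimes> (nn (n choose i) \<otimes> (x [^] i \<otimes> y [^] (n - i))) =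
        trunc_exp x i \<otimes> trunc_exp y (n - i)" .
  qed auto
  finally show ?thesis .
qed

text \<open>Degree p is the first in which the functional equation can fail: there the product of
  the series of x and y has this coefficient, whereas the series of \<open>x \<oplus> y\<close> has
  0.\<close>

definition top_coeff :: "'a \<Rightarrow> 'a \<Rightarrow> 'a" where
  "top_coeff x y = (\<Oplus>i\<in>{..p}. trunc_exp x i \<otimes> trunc_exp y (p - i))"

lemma top_coeff_closed [simp]:
  "x \<in> carrier R \<Longrightarrow> y \<in> carrier R \<Longrightarrow> top_coeff x y \<in> carrier R"
  by (auto simp: top_coeff_def intro!: finsum_closed)

lemma UP_mult: "f \<in> carrier (UP R) \<Longrightarrow> g \<in> carrier (UP R) \<Longrightarrow>
    (f \<otimes>\<^bsub>UP R\<^esub> g) n = (\<Oplus>i\<in>{..n}. f i \<otimes> g (n - i))"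
  by (simp add: UP_def)

text \<open>The coefficient of degree p of the first product meets the constant coefficient 1 of
  \<open>trunc_exp z\<close>. The lower coefficients agree with those of
  \<open>trunc_exp (x \<oplus> y)\<close>, whose own term of degree p is 0 and can be added to
  complete the second top coefficient.\<close>

lemma top_coeff_triple:
  assumes "x \<in> carrier R" "y \<in> carrier R" "z \<in> carrier R"
  shows "((trunc_exp x \<otimes>\<^bsub>UP R\<^esub> trunc_exp y) \<otimes>\<^bsub>UP R\<^esub> trunc_exp z) p =
    top_coeff (x \<oplus> y) z \<oplus> top_coeff x y"
proof -
  interpret U: UP_cring R "UP R" by unfold_locales simp
  note [simp] = assms trunc_exp_up
  define q where "q = p - 1"
  have q: "Suc q = p" using p_gt_0 by (simp add: q_def)
  let ?F = "trunc_exp x \<otimes>\<^bsub>UP R\<^esub> trunc_exp y"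
  have "?F \<in> carrier (UP R)" by simp
  then have Fc: "?F i \<in> carrier R" for i by (auto simp: UP_def dest: mem_upD)
  have F1: "?F i = trunc_exp (x \<oplus> y) i" if "i < p" for i
    using that by (simp add: UP_mult trunc_exp_add)
  have F2: "?F p = top_coeff x y"
    by (simp add: UP_mult top_coeff_def)
  have "(?F \<otimes>\<^bsub>UP R\<^esub> trunc_exp z) p = (\<Oplus>i\<in>{..Suc q}. ?F i \<otimes> trunc_exp z (p - i))"
    by (simp add: UP_mult q)
  also have "\<dots> = ?F p \<otimes> trunc_exp z 0 \<oplus> (\<Oplus>i\<in>{..q}. ?F i \<otimes> trunc_exp z (p - i))"
    by (subst finsum_Suc) (auto simp: Fc q)
  also have "(\<Oplus>i\<in>{..q}. ?F i \<otimes> trunc_exp z (p - i)) = (\<Oplus>i\<in>{..q}. trunc_exp (x \<oplus> y) i \<otimes> trunc_exp z (p - i))"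
    using p_gt_1 by (intro finsum_cong') (auto intro!: F1[THEN arg_cong[where f = "\<lambda>u. u \<otimes> _"]] simp: q_def)
  also have "\<dots> = (\<Oplus>i\<in>{..Suc q}. trunc_exp (x \<oplus> y) i \<otimes> trunc_exp z (p - i))"
    by (subst finsum_Suc) (auto simp: q)
  also have "\<dots> = top_coeff (x \<oplus> y) z"
    by (simp add: top_coeff_def q)
  finally show ?thesis by (simp add: F2 a_comm)
qed

lemma top_coeff_comm:
  assumes "x \<in> carrier R" "y \<in> carrier R"
  shows "top_coeff x y = top_coeff y x"
proof -
  interpret U: UP_cring R "UP R" by unfold_locales simp
  have "(trunc_exp x \<otimes>\<^bsub>UP R\<^esub> trunc_exp y) p = (trunc_exp y \<otimes>\<^bsub>UP R\<^esub> trunc_exp x) p"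
    using assms trunc_exp_up U.P.m_comm by metis
  then show ?thesis
    using assms by (simp add: UP_mult trunc_exp_up top_coeff_def)
qed

text \<open>Both sides are the coefficient of degree p of one triple product, bracketed as
  \<open>(x y) z\<close> and, after a rotation of the factors, as \<open>(y z) x\<close>.\<close>

lemma top_coeff_assoc:
  assumes "x \<in> carrier R" "y \<in> carrier R" "z \<in> carrier R"
  shows "top_coeff (x \<oplus> y) z \<oplus> top_coeff x y = top_coeff x (y \<oplus> z) \<oplus> top_coeff y z"
proof -
  interpret U: UP_cring R "UP R" by unfold_locales simp
  have "(trunc_exp x \<otimes>\<^bsub>UP R\<^esub> trunc_exp y) \<otimes>\<^bsub>UP R\<^esub> trunc_exp z =
      (trunc_exp y \<otimes>\<^bsub>UP R\<^esub> trunc_exp z) \<otimes>\<^bsub>UP R\<^esub> trunc_exp x"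
    using assms trunc_exp_up by (simp add: U.P.m_ac)
  then show ?thesis
    using assms top_coeff_triple[of x y z] top_coeff_triple[of y z x] top_coeff_comm[of "y \<oplus> z" x]
    by simp
qed

section \<open>The coefficients of the cocycle\<close>

lemma coeff_const:
  "1 \<le> j \<Longrightarrow> j < p \<Longrightarrow> (\<ominus> \<one>) [^] j \<otimes> (nn (fact (j - 1)) \<otimes> nn (fact (p - j))) = \<ominus> nn (fact (p - 1))"
proof (induction j rule: nat_induct_at_least)
  case base
  then show ?case by (simp add: l_minus)
next
  case (Suc j)
  have f1: "fact j = j * (fact (j - 1) :: nat)" using Suc by (metis One_nat_def fact_reduce of_nat_id le_simps(3) )
  have f2: "fact (p - j) = (p - j) * (fact (p - Suc j) :: nat)"
    using Suc by (subst fact_reduce) auto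
  \<comment> \<open>Passing from \<open>j\<close> to \<open>Suc j\<close> takes \<open>p - j\<close>
    out of the second factorial and puts \<open>j\<close> into the first. As
    \<open>j = -(p - j)\<close> in R, the additional sign cancels and the value remains the one at
    \<open>j = 1\<close>. By Wilson's theorem that value is 1.\<close>
  have m: "nn j = \<ominus> nn (p - j)"
  proof -
    have "nn j \<oplus> nn (p - j) = \<zero>" using Suc by (simp flip: nn_add)
    then show ?thesis by (metis minus_equality nn_closed)
  qed
  have "(\<ominus> \<one>) [^] Suc j \<otimes> (nn (fact (Suc j - 1)) \<otimes> nn (fact (p - Suc j))) =
     (\<ominus> \<one>) [^] j \<otimes> \<ominus> \<one> \<otimes> (\<ominus> nn (p - j) \<otimes> nn (fact (j - 1)) \<otimes> nn (fact (p - Suc j)))"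
    by (simp add: f1 nn_mult m)
  also have "\<dots> = (\<ominus> \<one>) [^] j \<otimes> (nn (fact (j - 1)) \<otimes> (nn (p - j) \<otimes> nn (fact (p - Suc j))))"
    by (simp add: l_minus r_minus m_ac)
  also have "\<dots> = \<ominus> nn (fact (p - 1))"
    using Suc by (simp add: f2 nn_mult)
  finally show ?case .
qed

definition kap :: "nat \<Rightarrow> 'a" where "kap j = (\<ominus> \<one>) [^] j \<otimes> inv (nn j)"

lemma kap_closed [simp]: "0 < j \<Longrightarrow> j < p \<Longrightarrow> kap j \<in> carrier R"
  by (simp add: kap_def nn_small_unit)

text \<open>Multiply \<open>coeff_const\<close> by \<open>eps j \<otimes> eps (p - j)\<close>: the
  factor \<open>(p - j)!\<close> cancels, and \<open>(j - 1)!\<close> against \<open>j!\<close>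
  leaves \<open>1/j\<close>.\<close>

lemma kap_eq:
  assumes "0 < j" "j < p"
  shows "kap j = \<ominus> nn (fact (p - 1)) \<otimes> (eps j \<otimes> eps (p - j))"
proof -
  have u: "nn (fact (j - 1)) \<in> Units R" "nn (fact (p - j)) \<in> Units R" "nn j \<in> Units R"
    "nn (fact j) \<in> Units R"
    using assms by (auto intro!: nn_fact_unit nn_small_unit)
  have f1: "nn (fact j) = nn j \<otimes> nn (fact (j - 1))"
    using assms by (simp flip: nn_mult add: fact_reduce)
  have e_aux: "nn j \<otimes> (nn (fact (j - 1)) \<otimes> (inv (nn j) \<otimes> inv (nn (fact (j - 1))))) = \<one>"
  proof -
    have "nn j \<otimes> (nn (fact (j - 1)) \<otimes> (inv (nn j) \<otimes> inv (nn (fact (j - 1))))) =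
        (nn j \<otimes> inv (nn j)) \<otimes> (nn (fact (j - 1)) \<otimes> inv (nn (fact (j - 1))))"
      using u by (simp add: m_ac del: Units_l_inv Units_r_inv)
    then show ?thesis using u by simp
  qed
  have e: "eps j = inv (nn j) \<otimes> inv (nn (fact (j - 1)))"
    unfolding eps_def f1 using u by (intro comm_inv_char) (use e_aux in \<open>auto simp: m_assoc\<close>)
  have "\<ominus> nn (fact (p - 1)) \<otimes> (eps j \<otimes> eps (p - j)) =
    (\<ominus> \<one>) [^] j \<otimes> (nn (fact (j - 1)) \<otimes> nn (fact (p - j))) \<otimes> (eps j \<otimes> eps (p - j))"
    using coeff_const[of j] assms by simp
  also have "\<dots> = (\<ominus> \<one>) [^] j \<otimes> inv (nn j) \<otimes> (nn (fact (j - 1)) \<otimes> inv (nn (fact (j - 1))))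
       \<otimes> (nn (fact (p - j)) \<otimes> inv (nn (fact (p - j))))"
    unfolding e unfolding eps_def using u by (simp add: m_ac del: Units_l_inv Units_r_inv)
  also have "\<dots> = kap j" using u by (simp add: kap_def)
  finally show ?thesis by simp
qed

abbreviation Phi :: "'a \<Rightarrow> 'a \<Rightarrow> 'a" where "Phi \<equiv> pd_cocycle R p"

lemma Phi_kap: "Phi x y = (\<Oplus>j\<in>{0<..<p}. kap j \<otimes> (x [^] j \<otimes> y [^] (p - j)))"
  by (simp add: pd_cocycle_def kap_def nn_def)

lemma Phi_term_closed [simp]: "\<lbrakk>x \<in> carrier R; y \<in> carrier R; j \<in> {0<..<p}\<rbrakk> \<Longrightarrow>
    kap j \<otimes> (x [^] j \<otimes> y [^] (p - j)) \<in> carrier R"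
  by simp

lemma Phi_closed [simp]: "x \<in> carrier R \<Longrightarrow> y \<in> carrier R \<Longrightarrow> Phi x y \<in> carrier R"
  unfolding Phi_kap by (rule finsum_closed) (simp)

text \<open>The end terms of \<open>top_coeff\<close> contain \<open>trunc_exp\<close> in degree p
  and vanish; the others match by \<open>kap_eq\<close>. Symmetry and the cocycle identity of \<Phi>
  are thereby inherited from polynomial multiplication.\<close>

lemma Phi_eq:
  assumes "x \<in> carrier R" "y \<in> carrier R"
  shows "Phi x y = \<ominus> nn (fact (p - 1)) \<otimes> top_coeff x y"
proof -
  note [simp] = assms
  have "top_coeff x y = (\<Oplus>i\<in>{0<..<p}. trunc_exp x i \<otimes> trunc_exp y (p - i))"
    unfolding top_coeff_def
  proof (rule add.finprod_mono_neutral_cong_right)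
    show "trunc_exp x i \<otimes> trunc_exp y (p - i) = \<zero>" if "i \<in> {..p} - {0<..<p}" for i
    proof -
      have "i = 0 \<or> i = p" using that by auto
      then show ?thesis by auto
    qed
  qed auto
  then have "\<ominus> nn (fact (p - 1)) \<otimes> top_coeff x y =
      (\<Oplus>i\<in>{0<..<p}. \<ominus> nn (fact (p - 1)) \<otimes> (trunc_exp x i \<otimes> trunc_exp y (p - i)))"
    by (simp add: finsum_rdistr Pi_def)
  also have "\<dots> = Phi x y"
    unfolding Phi_kap
  proof (intro finsum_cong')
    fix i assume "i \<in> {0<..<p}"
    then have i: "0 < i" "i < p" "p - i < p" by (auto)
    show "\<ominus> nn (fact (p - 1)) \<otimes> (trunc_exp x i \<otimes> trunc_exp y (p - i)) =
        kap i \<otimes> (x [^] i \<otimes> y [^] (p - i))"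
      using i by (simp add: kap_eq trunc_exp_def m_ac)
  qed (auto)
  finally show ?thesis by simp
qed

lemma Phi_comm: "x \<in> carrier R \<Longrightarrow> y \<in> carrier R \<Longrightarrow> Phi x y = Phi y x"
  using top_coeff_comm by (simp add: Phi_eq)

lemma Phi_assoc:
  assumes "x \<in> carrier R" "y \<in> carrier R" "z \<in> carrier R"
  shows "Phi (x \<oplus> y) z \<oplus> Phi x y = Phi x (y \<oplus> z) \<oplus> Phi y z"
  using assms top_coeff_assoc[OF assms] by (simp add: Phi_eq flip: r_distr)

lemma Phi_cong_0:
  assumes "\<And>j. j \<in> {0<..<p} \<Longrightarrow> x [^] j \<otimes> y [^] (p - j) = \<zero>"
  shows "Phi x y = \<zero>"
proof -
  have "Phi x y = (\<Oplus>j\<in>{0<..<p}. \<zero>)"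
    unfolding Phi_kap
    by (intro finsum_cong') (auto simp: assms)
  then show ?thesis by simp
qed

lemma Phi_zero [simp]: "x \<in> carrier R \<Longrightarrow> Phi x \<zero> = \<zero>" "x \<in> carrier R \<Longrightarrow> Phi \<zero> x = \<zero>"
  by (rule Phi_cong_0, simp add: nat_pow_zero)+

lemma Phi_scale:
  assumes "c \<in> carrier R" "x \<in> carrier R" "y \<in> carrier R"
  shows "Phi (c \<otimes> x) (c \<otimes> y) = c [^] p \<otimes> Phi x y"
proof -
  note [simp] = assms
  have "c [^] p \<otimes> Phi x y = (\<Oplus>j\<in>{0<..<p}. c [^] p \<otimes> (kap j \<otimes> (x [^] j \<otimes> y [^] (p - j))))"
    unfolding Phi_kap by (rule finsum_rdistr) (auto simp: Pi_def)
  also have "\<dots> = Phi (c \<otimes> x) (c \<otimes> y)"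
    unfolding Phi_kap
  proof (intro finsum_cong')
    fix j assume "j \<in> {0<..<p}"
    then have j: "0 < j" "j < p" by (auto)
    then have "c [^] p = c [^] j \<otimes> c [^] (p - j)" by (simp add: nat_pow_mult)
    then show "c [^] p \<otimes> (kap j \<otimes> (x [^] j \<otimes> y [^] (p - j))) =
        kap j \<otimes> ((c \<otimes> x) [^] j \<otimes> (c \<otimes> y) [^] (p - j))"
      using j by (simp add: nat_pow_distrib m_ac)
  qed (auto)
  finally show ?thesis by simp
qed

text \<open>Homogeneity pulls out \<open>x [^] p\<close>. Consequently a p-map is additive on the
  multiples of a fixed positive element.\<close>

lemma Phi_proportional:
  assumes "c \<in> carrier R" "d \<in> carrier R" "x \<in> carrier R" "x [^] p = \<zero>"
  shows "Phi (c \<otimes> x) (d \<otimes> x) = \<zero>"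
proof -
  note [simp] = assms
  have "Phi (x \<otimes> c) (x \<otimes> d) = \<zero>"
    by (subst Phi_scale) auto
  then show ?thesis by (simp add: m_comm)
qed

lemma Phi_mem:
  assumes I: "ideal I R" and x: "x \<in> carrier R" and y: "y \<in> carrier R"
    and m: "\<And>j. 0 < j \<Longrightarrow> j < p \<Longrightarrow> x [^] j \<otimes> y [^] (p - j) \<in> I"
  shows "Phi x y \<in> I"
proof -
  interpret I: ideal I R by fact
  have t: "kap j \<otimes> (x [^] j \<otimes> y [^] (p - j)) \<in> I" if "j \<in> {0<..<p}" for j
    using that m[of j] by (intro I.I_l_closed[OF _ kap_closed]) auto
  have "(\<Oplus>j\<in>F. kap j \<otimes> (x [^] j \<otimes> y [^] (p - j))) \<in> I" if "F \<subseteq> {0<..<p}" for F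
  proof -
    have "finite F" using that finite_subset by blast
    then show ?thesis using that
    proof (induction F)
      case (insert j F)
      then have "(\<Oplus>j\<in>insert j F. kap j \<otimes> (x [^] j \<otimes> y [^] (p - j))) =
         kap j \<otimes> (x [^] j \<otimes> y [^] (p - j)) \<oplus> (\<Oplus>j\<in>F. kap j \<otimes> (x [^] j \<otimes> y [^] (p - j)))"
        using t I.Icarr by (subst finsum_insert) (auto simp: Pi_def subset_iff)
      then show ?case using insert t by auto
    qed auto
  qed
  then show ?thesis unfolding Phi_kap by blast
qed

lemma Phi_in_ideal:
  assumes I: "ideal I R" and x: "x \<in> I" and y: "y \<in> carrier R"
  shows "Phi x y \<in> I"
proof -
  interpret I: ideal I R by fact
  show ?thesis
    using x y by (intro Phi_mem[OF I]) (auto intro: I.I_r_closed I.nat_pow_mem)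
qed

text \<open>First-order Taylor expansion. At \<open>n = 0\<close> the truncated exponent
  \<open>n - 1\<close> does no harm, since \<open>nn 0\<close> is zero.\<close>

lemma pow_add_sq_zero:
  assumes "v \<in> carrier R" "d \<in> carrier R" "d \<otimes> d = \<zero>"
  shows "(v \<oplus> d) [^] n = v [^] n \<oplus> nn n \<otimes> (v [^] (n - 1) \<otimes> d)"
proof (induction n)
  case (Suc n)
  note [simp] = assms(1,2)
  have *: "nn n \<otimes> (v [^] (n - 1) \<otimes> d) \<otimes> v = nn n \<otimes> (v [^] n \<otimes> d)"
    by (cases n) (simp_all add: m_ac)
  have **: "nn n \<otimes> (v [^] (n - 1) \<otimes> d) \<otimes> d = \<zero>"
    by (simp add: m_assoc assms(3))
  have "(v \<oplus> d) [^] Suc n = v [^] n \<otimes> v \<oplus> v [^] n \<otimes> d \<oplus>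
     (nn n \<otimes> (v [^] (n - 1) \<otimes> d) \<otimes> v \<oplus> nn n \<otimes> (v [^] (n - 1) \<otimes> d) \<otimes> d)"
    using Suc by (simp add: r_distr l_distr a_ac)
  also have "\<dots> = v [^] n \<otimes> v \<oplus> (nn n \<oplus> \<one>) \<otimes> (v [^] n \<otimes> d)"
    unfolding * ** by (simp add: l_distr a_ac)
  finally show ?case by (simp add: nn_Suc)
qed (use assms in simp)

text \<open>Modulo \<open>\<delta>\<^sup>2\<close> the cocycle \<open>\<Phi>(v + \<delta>, -v)\<close> is its linear term in \<open>\<delta>\<close>, to which each of the
  \<open>p - 1\<close> summands contributes \<open>(-1)\<^sup>p v\<^sup>p\<^sup>-\<^sup>1\<delta>\<close>.\<close>

lemma Phi_deriv:
  assumes v: "v \<in> carrier R" and d: "d \<in> carrier R" and dd: "d \<otimes> d = \<zero>" and vp: "v [^] p = \<zero>"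
  shows "Phi (v \<oplus> d) (\<ominus> v) = v [^] (p - 1) \<otimes> d"
proof -
  note [simp] = v d
  let ?z = "v [^] (p - 1) \<otimes> d"
  have neg: "(\<ominus> v) [^] n = (\<ominus> \<one>) [^] n \<otimes> v [^] n" for n :: nat
  proof -
    have "\<ominus> v = \<ominus> \<one> \<otimes> v" by (simp add: l_minus)
    then show ?thesis by (simp add: nat_pow_distrib)
  qed
  have "Phi (v \<oplus> d) (\<ominus> v) = (\<Oplus>j\<in>{0<..<p}. \<ominus> ?z)"
    unfolding Phi_kap
  proof (intro finsum_cong')
    fix j assume "j \<in> {0<..<p}"
    then have j: "0 < j" "j < p" by (auto)
    have u: "nn j \<in> Units R" using j by (rule nn_small_unit)
    have v1: "v [^] j \<otimes> v [^] (p - j) = \<zero>" using j vp by (simp add: nat_pow_mult)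
    have v2: "v [^] (j - 1) \<otimes> v [^] (p - j) = v [^] (p - 1)" using j by (simp add: nat_pow_mult)
    have s: "(\<ominus> \<one>) [^] j \<otimes> (\<ominus> \<one>) [^] (p - j) = \<ominus> \<one>"
      using j by (simp add: nat_pow_mult neg_one_pow_p)
    have "kap j \<otimes> ((v \<oplus> d) [^] j \<otimes> (\<ominus> v) [^] (p - j)) =
      kap j \<otimes> (\<ominus> \<one>) [^] (p - j) \<otimes> (v [^] j \<otimes> v [^] (p - j)) \<oplus>
      (inv (nn j) \<otimes> nn j) \<otimes> ((\<ominus> \<one>) [^] j \<otimes> (\<ominus> \<one>) [^] (p - j)) \<otimes> (v [^] (j - 1) \<otimes> v [^] (p - j)) \<otimes> d"
      using j u unfolding neg pow_add_sq_zero[OF v d dd]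
      by (simp add: l_distr r_distr kap_def m_ac del: Units_l_inv Units_r_inv)
    also have "\<dots> = \<ominus> ?z"
      unfolding v1 v2 s using u j by (simp add: l_minus)
    finally show "kap j \<otimes> ((v \<oplus> d) [^] j \<otimes> (\<ominus> v) [^] (p - j)) = \<ominus> ?z" .
  qed auto
  \<comment> \<open>There are \<open>p - 1\<close> equal summands, and \<open>p - 1\<close> is -1 in
    R, which cancels the sign that each of them carries.\<close>
  also have "\<dots> = [card {0<..<p}] \<cdot> (\<ominus> ?z)"
    by (rule add.finprod_const) simp
  also have "\<dots> = nn (p - 1) \<otimes> \<ominus> ?z"
    by (simp add: nn_def add_pow_ldistr)
  also have "nn (p - 1) = \<ominus> \<one>"
  proof -
    have "nn (p - 1) \<oplus> \<one> = \<zero>" using p_gt_0 nn_Suc[of "p - 1"] by simp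
    then show ?thesis by (metis minus_equality nn_closed one_closed)
  qed
  finally show ?thesis by (simp add: l_minus r_minus)
qed

text \<open>The case of zero increment in \<open>Phi_deriv\<close>. Through it a p-map commutes with
  negation, also for p = 2.\<close>

lemma Phi_neg:
  assumes v: "v \<in> carrier R" and vp: "v [^] p = \<zero>"
  shows "Phi v (\<ominus> v) = \<zero>"
  using Phi_deriv[OF v zero_closed _ vp] v by simp

end

text \<open>The coefficients of \<Phi> are quotients of integers, so a homomorphism carries them to
  those of the target, which inherits \<open>p = 0\<close>. This is used for both embeddings of A
  into \<open>A \<otimes> A\<close>, for multiplication and for reduction modulo
  \<open>I^2\<close>.\<close>

lemma (in ring_hom_cring) hom_pd_cocycle:
  assumes "prime_char R p" and xy: "x \<in> carrier R" "y \<in> carrier R"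
  shows "h (pd_cocycle R p x y) = pd_cocycle S p (h x) (h y)"
proof -
  interpret A: prime_char R p by fact
  have hn: "h (A.nn n) = [n] \<cdot>\<^bsub>S\<^esub> \<one>\<^bsub>S\<^esub>" for n
    by (induction n) (auto simp: A.nn_Suc)
  interpret B: prime_char S p
    using hn[of p] by unfold_locales (auto simp: A.prime_p)
  have hn': "h (A.nn n) = B.nn n" for n
    by (simp add: hn B.nn_def)
  have hp: "h (u [^] n) = h u [^]\<^bsub>S\<^esub> n" if "u \<in> carrier R" for u and n :: nat
    using that by (induction n) auto
  have hinv: "h (inv (A.nn j)) = inv\<^bsub>S\<^esub> (B.nn j)" if "0 < j" "j < p" for j
  proof -
    have u: "A.nn j \<in> Units R" using that by (rule A.nn_small_unit)
    then have "h (A.nn j) \<otimes>\<^bsub>S\<^esub> h (inv (A.nn j)) = \<one>\<^bsub>S\<^esub>"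
      by (simp flip: hom_mult)
    then show ?thesis
      using u B.nn_small_unit[OF that] hn' by (metis R.Units_inv_closed R.Units_closed S.comm_inv_char hom_closed)
  qed
  have hk: "h (A.kap j) = B.kap j" if "0 < j" "j < p" for j
    using that A.nn_small_unit[OF that] by (simp add: A.kap_def B.kap_def hp hinv)
  show ?thesis
    unfolding A.Phi_kap B.Phi_kap
    using xy
    by (subst hom_finsum)
       (auto simp: Pi_def hk hp intro!: S.finsum_cong')
qed

section \<open>Divided powers algebras\<close>

text \<open>The part of the structure that mentions neither grading nor p-map. It applies to
  \<open>A \<otimes> A\<close> before that algebra is known to satisfy the axioms of
  \<open>pdCom\<close>.\<close>

locale char_algebra =
  fixes K :: "('k, 'e) ring_scheme" (structure)
    and A :: "('k, 'a, 'z) module_scheme" (structure)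
    and p :: nat
  assumes algebra_KA: "Module.algebra K A" and field_K: "field K"
    and prime_p: "Factorial_Ring.prime p" and char_K: "has_characteristic K p"
begin

sublocale K: field K
  by (rule field_K)

sublocale K: prime_char K p
  using char_K prime_p by unfold_locales (auto simp: has_characteristic_def)

sublocale A: cring A
  using algebra_KA by (simp add: Module.algebra_def)

lemma module_KA: "module K A"
  using algebra_KA by (simp add: Module.algebra_def)

lemmas smult_closed [simp, intro] = module.smult_closed[OF module_KA]
  and smult_l_distr = module.smult_l_distr[OF module_KA]
  and smult_r_distr = module.smult_r_distr[OF module_KA]
  and smult_assoc1 = module.smult_assoc1[OF module_KA]
  and smult_one [simp] = module.smult_one[OF module_KA]
  and smult_assoc2 = Module.algebra.smult_assoc2[OF algebra_KA]

definition sc :: "'k \<Rightarrow> 'a" where "sc c = c \<odot>\<^bsub>A\<^esub> \<one>\<^bsub>A\<^esub>"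

lemma sc_closed [simp, intro]: "c \<in> carrier K \<Longrightarrow> sc c \<in> carrier A"
  by (simp add: sc_def)

lemma smult_eq_sc: "c \<in> carrier K \<Longrightarrow> a \<in> carrier A \<Longrightarrow> c \<odot>\<^bsub>A\<^esub> a = sc c \<otimes>\<^bsub>A\<^esub> a"
  by (simp add: sc_def smult_assoc2)

lemma sc_hom: "ring_hom_cring K A sc"
  by (rule ring_hom_cringI[OF K.cring_axioms A.cring_axioms])
     (auto intro!: ring_hom_memI simp: sc_def smult_l_distr smult_assoc1 smult_assoc2)

sublocale sc: ring_hom_cring K A sc
  by (rule sc_hom)

lemma sc_nat: "sc (add_pow K n \<one>\<^bsub>K\<^esub>) = add_pow A n \<one>\<^bsub>A\<^esub>" for n :: nat
  by (induction n) simp_all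

sublocale A: prime_char A p
  using sc_nat[of p] K.char_p prime_p by unfold_locales simp_all

lemma sc_pow: "c \<in> carrier K \<Longrightarrow> sc (c [^]\<^bsub>K\<^esub> n) = sc c [^]\<^bsub>A\<^esub> n" for n :: nat
  by (induction n) simp_all

lemma sc_kap:
  assumes "0 < j" "j < p"
  shows "sc ((\<ominus>\<^bsub>K\<^esub> \<one>\<^bsub>K\<^esub>) [^]\<^bsub>K\<^esub> j \<otimes>\<^bsub>K\<^esub> inv\<^bsub>K\<^esub> (add_pow K j \<one>\<^bsub>K\<^esub>)) = A.kap j"
proof -
  have uK: "K.nn j \<in> Units K" and uA: "A.nn j \<in> Units A"
    using assms by (auto intro: K.nn_small_unit A.nn_small_unit)
  have "A.nn j \<otimes>\<^bsub>A\<^esub> sc (inv\<^bsub>K\<^esub> K.nn j) = sc (K.nn j \<otimes>\<^bsub>K\<^esub> inv\<^bsub>K\<^esub> K.nn j)"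
    using uK by (simp add: K.nn_def A.nn_def sc_nat del: K.Units_r_inv)
  also have "\<dots> = \<one>\<^bsub>A\<^esub>" using uK by simp
  finally have "inv\<^bsub>A\<^esub> (A.nn j) = sc (inv\<^bsub>K\<^esub> K.nn j)"
    using uK by (intro A.comm_inv_char) auto
  moreover have "inv\<^bsub>K\<^esub> K.nn j \<in> carrier K" using uK by simp
  ultimately show ?thesis
    by (simp add: A.kap_def sc_pow flip: K.nn_def)
qed

text \<open>The sum in the axioms of \<open>pdCom\<close> has its coefficients in K, whereas those
  of \<Phi> lie in A; the structure map \<open>sc\<close> preserves integers and their inverses and
  so identifies the two.\<close>

lemma Phi_scalars:
  assumes "x \<in> carrier A" "y \<in> carrier A"
  shows "(\<Oplus>\<^bsub>A\<^esub>j\<in>{1..p-1}.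
            ((\<ominus>\<^bsub>K\<^esub> \<one>\<^bsub>K\<^esub>) [^]\<^bsub>K\<^esub> j \<otimes>\<^bsub>K\<^esub> inv\<^bsub>K\<^esub> (add_pow K j \<one>\<^bsub>K\<^esub>))
              \<odot>\<^bsub>A\<^esub> (x [^]\<^bsub>A\<^esub> j \<otimes>\<^bsub>A\<^esub> y [^]\<^bsub>A\<^esub> (p - j))) = A.Phi x y"
proof -
  have r: "{1..p-1} = {0<..<p}" using A.p_gt_0 by auto
  have c: "inv\<^bsub>K\<^esub> (add_pow K j \<one>\<^bsub>K\<^esub>) \<in> carrier K" if "0 < j" "j < p" for j
    using K.nn_small_unit[OF that] by (simp add: K.nn_def)
  show ?thesis
    unfolding r A.Phi_kap using assms c
    by (intro A.finsum_cong') (auto simp: smult_eq_sc sc_kap simp del: sc.hom_mult)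
qed

end

locale pd_char =
  fixes K :: "('k, 'e) ring_scheme" (structure)
    and A :: "('k, 'a, 'z) pd_alg_scheme" (structure)
    and p :: nat
  assumes pd: "pdCom K A p" and field_K: "field K"
    and prime_p: "Factorial_Ring.prime p" and char_K: "has_characteristic K p"
begin

sublocale char_algebra K A p
  using pd field_K prime_p char_K by (intro char_algebra.intro) (auto simp: pdCom_def)

lemmas zero_part_subring = pdCom.zero_part_subring[OF pd]
  and zero_part_smult = pdCom.zero_part_smult[OF pd]
  and pos_part_ideal = pdCom.pos_part_ideal[OF pd]
  and parts_sum = pdCom.parts_sum[OF pd]
  and parts_inter = pdCom.parts_inter[OF pd]
  and pmap_closed = pdCom.pmap_closed[OF pd]
  and pos_part_pow = pdCom.pos_part_pow[OF pd]
  and pmap_add = pdCom.pmap_add[OF pd]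
  and pmap_mult = pdCom.pmap_mult[OF pd]
  and pmap_scale = pdCom.pmap_scale[OF pd]
  and deg_zero_eq = pdCom.deg_zero_eq[OF pd]

sublocale pos: ideal "pos_part A" A
  by (rule pos_part_ideal)


lemma pos_carrier [simp]: "x \<in> pos_part A \<Longrightarrow> x \<in> carrier A"
  by (rule pos.Icarr)

lemma zero_carrier [simp]: "x \<in> zero_part A \<Longrightarrow> x \<in> carrier A"
  using subringE(1)[OF zero_part_subring] by auto

lemma pmap_carrier [simp]: "x \<in> pos_part A \<Longrightarrow> pmap A x \<in> carrier A"
  by (simp add: pmap_closed)

lemma pmap_plus:
  "x \<in> pos_part A \<Longrightarrow> y \<in> pos_part A \<Longrightarrow>
    pmap A (x \<oplus>\<^bsub>A\<^esub> y) = pmap A x \<oplus>\<^bsub>A\<^esub> pmap A y \<oplus>\<^bsub>A\<^esub> A.Phi x y"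
  using pmap_add[of x y] Phi_scalars[of x y] by simp

lemma pmap_zero: "pmap A \<zero>\<^bsub>A\<^esub> = \<zero>\<^bsub>A\<^esub>"
  using pmap_mult[of "\<zero>\<^bsub>A\<^esub>" "\<zero>\<^bsub>A\<^esub>"] by simp

lemma pmap_neg:
  assumes x: "x \<in> pos_part A"
  shows "pmap A (\<ominus>\<^bsub>A\<^esub> x) = \<ominus>\<^bsub>A\<^esub> pmap A x"
proof -
  have "pmap A (x \<oplus>\<^bsub>A\<^esub> \<ominus>\<^bsub>A\<^esub> x) = pmap A x \<oplus>\<^bsub>A\<^esub> pmap A (\<ominus>\<^bsub>A\<^esub> x) \<oplus>\<^bsub>A\<^esub> A.Phi x (\<ominus>\<^bsub>A\<^esub> x)"
    using x by (simp add: pmap_plus)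
  then have "pmap A (\<ominus>\<^bsub>A\<^esub> x) \<oplus>\<^bsub>A\<^esub> pmap A x = \<zero>\<^bsub>A\<^esub>"
    using x by (simp add: A.r_neg pmap_zero A.Phi_neg pos_part_pow A.a_comm)
  then show ?thesis
    using x by (intro A.minus_equality[symmetric]) auto
qed

lemma decomposition:
  assumes "a \<in> carrier A"
  obtains b x where "b \<in> zero_part A" "x \<in> pos_part A" "a = b \<oplus>\<^bsub>A\<^esub> x"
  using assms parts_sum by (force simp: set_add_def')

lemma deg_zero_mem [simp]: "a \<in> carrier A \<Longrightarrow> deg_zero A a \<in> zero_part A"
  by (metis decomposition deg_zero_eq)

definition pos_of :: "'a \<Rightarrow> 'a" where "pos_of a = a \<ominus>\<^bsub>A\<^esub> deg_zero A a"

lemma pos_of_eq: "b \<in> zero_part A \<Longrightarrow> x \<in> pos_part A \<Longrightarrow> pos_of (b \<oplus>\<^bsub>A\<^esub> x) = x"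
  by (simp add: pos_of_def deg_zero_eq) (simp add: A.minus_eq A.a_comm[of b x] A.a_assoc A.r_neg)

lemma pos_of_mem [simp]: "a \<in> carrier A \<Longrightarrow> pos_of a \<in> pos_part A"
  by (metis decomposition pos_of_eq)

lemma deg_pos_sum: "a \<in> carrier A \<Longrightarrow> deg_zero A a \<oplus>\<^bsub>A\<^esub> pos_of a = a"
  by (simp add: pos_of_def A.minus_eq A.a_ac A.r_neg A.r_neg1)

lemma zero_zero [simp]: "\<zero>\<^bsub>A\<^esub> \<in> zero_part A"
  using parts_inter by auto

lemma deg_zero_pos [simp]: "x \<in> pos_part A \<Longrightarrow> deg_zero A x = \<zero>\<^bsub>A\<^esub>"
  using deg_zero_eq[of "\<zero>\<^bsub>A\<^esub>" x] by simp

lemma deg_zero_zero [simp]: "b \<in> zero_part A \<Longrightarrow> deg_zero A b = b"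
  using deg_zero_eq[of b "\<zero>\<^bsub>A\<^esub>"] by simp

lemma deg_zero_add:
  assumes "a \<in> carrier A" "b \<in> carrier A"
  shows "deg_zero A (a \<oplus>\<^bsub>A\<^esub> b) = deg_zero A a \<oplus>\<^bsub>A\<^esub> deg_zero A b"
proof -
  have "a \<oplus>\<^bsub>A\<^esub> b = (deg_zero A a \<oplus>\<^bsub>A\<^esub> deg_zero A b) \<oplus>\<^bsub>A\<^esub> (pos_of a \<oplus>\<^bsub>A\<^esub> pos_of b)"
    using assms deg_pos_sum[OF assms(1)] deg_pos_sum[OF assms(2)]
    by (metis A.a_assoc A.a_lcomm A.a_closed deg_zero_mem pos_of_mem pos_carrier zero_carrier)
  then show ?thesis
    using assms deg_zero_eq[of "deg_zero A a \<oplus>\<^bsub>A\<^esub> deg_zero A b" "pos_of a \<oplus>\<^bsub>A\<^esub> pos_of b"]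
    by (simp add: subringE(7)[OF zero_part_subring])
qed

lemma deg_zero_mult:
  assumes "a \<in> carrier A" "b \<in> carrier A"
  shows "deg_zero A (a \<otimes>\<^bsub>A\<^esub> b) = deg_zero A a \<otimes>\<^bsub>A\<^esub> deg_zero A b"
proof -
  have "a \<otimes>\<^bsub>A\<^esub> b = (deg_zero A a \<oplus>\<^bsub>A\<^esub> pos_of a) \<otimes>\<^bsub>A\<^esub> (deg_zero A b \<oplus>\<^bsub>A\<^esub> pos_of b)"
    using assms by (simp add: deg_pos_sum)
  also have "\<dots> = (deg_zero A a \<otimes>\<^bsub>A\<^esub> deg_zero A b) \<oplus>\<^bsub>A\<^esub>
      (deg_zero A a \<otimes>\<^bsub>A\<^esub> pos_of b \<oplus>\<^bsub>A\<^esub> pos_of a \<otimes>\<^bsub>A\<^esub> (deg_zero A b \<oplus>\<^bsub>A\<^esub> pos_of b))"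
    using assms by (simp add: A.l_distr A.r_distr A.a_ac)
  finally show ?thesis
    using assms
      deg_zero_eq[of "deg_zero A a \<otimes>\<^bsub>A\<^esub> deg_zero A b"
       "deg_zero A a \<otimes>\<^bsub>A\<^esub> pos_of b \<oplus>\<^bsub>A\<^esub> pos_of a \<otimes>\<^bsub>A\<^esub> (deg_zero A b \<oplus>\<^bsub>A\<^esub> pos_of b)"]
    by (simp add: subringE(6)[OF zero_part_subring] pos.I_l_closed pos.I_r_closed)
qed

lemma deg_zero_one [simp]: "deg_zero A \<one>\<^bsub>A\<^esub> = \<one>\<^bsub>A\<^esub>"
  by (simp add: subringE(3)[OF zero_part_subring])

lemma sc_zero_part [simp]: "c \<in> carrier K \<Longrightarrow> sc c \<in> zero_part A"
  by (simp add: sc_def zero_part_smult subringE(3)[OF zero_part_subring])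

lemma deg_zero_scalar:
  "c \<in> carrier K \<Longrightarrow> a \<in> carrier A \<Longrightarrow> deg_zero A (c \<odot>\<^bsub>A\<^esub> a) = c \<odot>\<^bsub>A\<^esub> deg_zero A a"
  by (simp add: smult_eq_sc deg_zero_mult)

lemma deg_zero_ker: "a \<in> carrier A \<Longrightarrow> deg_zero A a = \<zero>\<^bsub>A\<^esub> \<longleftrightarrow> a \<in> pos_part A"
  using deg_pos_sum[of a] pos_of_mem[of a] by (metis A.l_zero deg_zero_pos pos_carrier)

text \<open>The p-th power is additive and kills \<open>pos_part A\<close>. Hence
  \<open>V_frob\<close>, although defined through the degree zero part, is the ordinary p-th
  power.\<close>

lemma pow_p_deg_zero: "a \<in> carrier A \<Longrightarrow> a [^]\<^bsub>A\<^esub> p = deg_zero A a [^]\<^bsub>A\<^esub> p"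
  using A.frobenius_add[of "deg_zero A a" "pos_of a"]
  by (simp add: deg_pos_sum pos_part_pow)

lemma V_frob_pow: "a \<in> carrier A \<Longrightarrow> V_frob p A a = a [^]\<^bsub>A\<^esub> p"
  by (simp add: V_frob_def flip: pow_p_deg_zero)

text \<open>The positive part of \<open>a\<close> contributes 0 by the product axiom, and no cocycle
  term arises because both summands are multiples of \<open>x\<close>. Scaling by arbitrary elements
  of A is what localization, with its arbitrary denominators, and the A-action on
  \<open>I/I^2\<close> call for.\<close>

lemma pmap_scale':
  assumes a: "a \<in> carrier A" and x: "x \<in> pos_part A"
  shows "pmap A (a \<otimes>\<^bsub>A\<^esub> x) = a [^]\<^bsub>A\<^esub> p \<otimes>\<^bsub>A\<^esub> pmap A x"
proof -
  have "a \<otimes>\<^bsub>A\<^esub> x = deg_zero A a \<otimes>\<^bsub>A\<^esub> x \<oplus>\<^bsub>A\<^esub> pos_of a \<otimes>\<^bsub>A\<^esub> x"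
    using a x by (simp add: deg_pos_sum flip: A.l_distr)
  also have "pmap A \<dots> = pmap A (deg_zero A a \<otimes>\<^bsub>A\<^esub> x)"
    using a x
    by (simp add: pmap_plus pos.I_l_closed pmap_mult A.Phi_proportional pos_part_pow)
  also have "\<dots> = a [^]\<^bsub>A\<^esub> p \<otimes>\<^bsub>A\<^esub> pmap A x"
    using a x by (simp add: pmap_scale pow_p_deg_zero[OF a])
  finally show ?thesis .
qed

end

section \<open>The tensor square as a ring\<close>

text \<open>The universal property of the tensor product as one formula. The target is an arbitrary
  abelian group because one of the targets below is the extension group, which has no K-linear
  structure. The value is meaningful when \<open>h\<close> is biadditive and balanced, since then
  the sum is constant on each class.\<close>

definition tensor_lift ::
  "('g, 'h) ring_scheme \<Rightarrow> ('a \<Rightarrow> 'a \<Rightarrow> 'g) \<Rightarrow> ('a \<times> 'a \<Rightarrow>\<^sub>0 int) set \<Rightarrow> 'g" where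
  "tensor_lift G h t = the_elem ((\<lambda>x. \<Oplus>\<^bsub>G\<^esub>u\<in>Poly_Mapping.keys x.
     add_pow G (Poly_Mapping.lookup x u) (h (fst u) (snd u))) ` t)"

lemma mult_map_lift: "mult_map A = tensor_lift A (\<lambda>a b. a \<otimes>\<^bsub>A\<^esub> b)"
  by (simp add: mult_map_def tensor_lift_def fun_eq_iff)

section \<open>Evaluation of formal integer combinations\<close>

context abelian_group
begin

definition frag_sum :: "('u \<Rightarrow> 'a) \<Rightarrow> ('u \<Rightarrow>\<^sub>0 int) \<Rightarrow> 'a" where
  "frag_sum h x = (\<Oplus>u\<in>Poly_Mapping.keys x. add_pow G (Poly_Mapping.lookup x u) (h u))"

lemma add_pow_zero_int: "add_pow G (0::int) x = \<zero>"
  by (simp add: add_pow_def int_pow_def nat_pow_def)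

lemma add_pow_add_int:
  "x \<in> carrier G \<Longrightarrow> add_pow G (i + j :: int) x = add_pow G i x \<oplus> add_pow G j x"
  using group.int_pow_mult[OF a_group, of x i j] by (simp add: add_pow_def)

lemma add_pow_closed_int: "x \<in> carrier G \<Longrightarrow> add_pow G (i :: int) x \<in> carrier G"
  using group.int_pow_closed[OF a_group, of x i] by (simp add: add_pow_def)

lemma frag_sum_superset:
  assumes "finite F" "Poly_Mapping.keys x \<subseteq> F" "h \<in> F \<rightarrow> carrier G"
  shows "frag_sum h x = (\<Oplus>u\<in>F. add_pow G (Poly_Mapping.lookup x u) (h u))"
  unfolding frag_sum_def using assms
  by (intro add.finprod_mono_neutral_cong_left) (auto simp: in_keys_iff add_pow_zero_int)

lemma frag_sum_closed [simp]:
  "Poly_Mapping.keys x \<subseteq> S \<Longrightarrow> h \<in> S \<rightarrow> carrier G \<Longrightarrow> frag_sum h x \<in> carrier G"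
  unfolding frag_sum_def by (rule finsum_closed) auto

lemma frag_sum_add:
  assumes "Poly_Mapping.keys x \<subseteq> S" "Poly_Mapping.keys y \<subseteq> S" "h \<in> S \<rightarrow> carrier G"
  shows "frag_sum h (x + y) = frag_sum h x \<oplus> frag_sum h y"
proof -
  let ?F = "Poly_Mapping.keys x \<union> Poly_Mapping.keys y"
  have h: "h \<in> ?F \<rightarrow> carrier G" using assms by auto
  have "frag_sum h (x + y) = (\<Oplus>u\<in>?F. add_pow G (Poly_Mapping.lookup (x + y) u) (h u))"
    using keys_add[of x y] h by (intro frag_sum_superset) auto
  also have "\<dots> = (\<Oplus>u\<in>?F. add_pow G (Poly_Mapping.lookup x u) (h u) \<oplus> add_pow G (Poly_Mapping.lookup y u) (h u))"
    using h by (intro finsum_cong') (auto simp: lookup_add Pi_iff intro!: add_pow_add_int add_pow_closed_int a_closed)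
  also have "\<dots> = frag_sum h x \<oplus> frag_sum h y"
    using h by (subst finsum_addf) (auto simp: frag_sum_superset[of ?F])
  finally show ?thesis .
qed

lemma frag_sum_of: "h u \<in> carrier G \<Longrightarrow> frag_sum h (frag_of u) = h u"
  by (simp add: frag_sum_def)

lemma frag_sum_zero [simp]: "frag_sum h 0 = \<zero>"
  by (simp add: frag_sum_def)

lemma frag_sum_diff:
  assumes "Poly_Mapping.keys x \<subseteq> S" "Poly_Mapping.keys y \<subseteq> S" "h \<in> S \<rightarrow> carrier G"
  shows "frag_sum h (x - y) = frag_sum h x \<ominus> frag_sum h y"
proof -
  have k: "Poly_Mapping.keys (x - y) \<subseteq> S" using assms keys_diff[of x y] by blast
  have "frag_sum h x = frag_sum h (x - y) \<oplus> frag_sum h y"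
    using frag_sum_add[OF k assms(2,3)] by simp
  moreover have "frag_sum h (x - y) \<in> carrier G" "frag_sum h y \<in> carrier G"
    using assms k by auto
  ultimately show ?thesis
    by (simp add: a_minus_def a_assoc r_neg)
qed

end

section \<open>The ring of formal sums of pairs\<close>

context cring
begin

abbreviation Z where "Z \<equiv> pair_ring R"

definition pm :: "'a \<times> 'a \<Rightarrow> 'a \<times> 'a \<Rightarrow> 'a \<times> 'a \<Rightarrow>\<^sub>0 int" where
  "pm u v = frag_of (fst u \<otimes> fst v, snd u \<otimes> snd v)"

lemma Z_carrier: "x \<in> carrier Z \<longleftrightarrow> Poly_Mapping.keys x \<subseteq> carrier R \<times> carrier R"
  and Z_add [simp]: "x \<oplus>\<^bsub>Z\<^esub> y = x + y"
  and Z_zero [simp]: "\<zero>\<^bsub>Z\<^esub> = 0"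
  and Z_one: "\<one>\<^bsub>Z\<^esub> = frag_of (\<one>, \<one>)"
  and Z_mult: "x \<otimes>\<^bsub>Z\<^esub> y = frag_extend (\<lambda>u. frag_extend (pm u) y) x"
  by (simp_all add: pair_ring_def pm_def[abs_def] split_def)

lemma Z_of [simp]: "a \<in> carrier R \<Longrightarrow> b \<in> carrier R \<Longrightarrow> frag_of (a, b) \<in> carrier Z"
  by (simp add: Z_carrier)

lemma Z_diff_closed [simp]: "x \<in> carrier Z \<Longrightarrow> y \<in> carrier Z \<Longrightarrow> x - y \<in> carrier Z"
  using keys_diff[of x y] by (auto simp: Z_carrier)

lemma Z_add_closed: "x \<in> carrier Z \<Longrightarrow> y \<in> carrier Z \<Longrightarrow> x + y \<in> carrier Z"
  using keys_add[of x y] by (auto simp: Z_carrier)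

lemma Z_0_closed [simp]: "0 \<in> carrier Z"
  by (simp add: Z_carrier)

text \<open>Differences instead of sums in the inductive step provide negatives and integer
  multiples at the same time.\<close>

lemma Z_induct [consumes 1, case_names zero of diff]:
  assumes "x \<in> carrier Z" "P 0" "\<And>a b. a \<in> carrier R \<Longrightarrow> b \<in> carrier R \<Longrightarrow> P (frag_of (a, b))"
    and "\<And>x y. x \<in> carrier Z \<Longrightarrow> y \<in> carrier Z \<Longrightarrow> P x \<Longrightarrow> P y \<Longrightarrow> P (x - y)"
  shows "P x"
proof -
  have "Poly_Mapping.keys x \<subseteq> carrier R \<times> carrier R" using assms(1) by (simp add: Z_carrier)
  then have "x \<in> carrier Z \<and> P x"
    by (induction x rule: frag_induction) (use assms(2-4) in auto)
  then show ?thesis ..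
qed

lemma Z_mult_of [simp]:
  "frag_of (a, b) \<otimes>\<^bsub>Z\<^esub> frag_of (c, d) = frag_of (a \<otimes> c, b \<otimes> d)"
  by (simp add: Z_mult pm_def)

lemma Z_mult_diff_l: "(x - x') \<otimes>\<^bsub>Z\<^esub> y = x \<otimes>\<^bsub>Z\<^esub> y - x' \<otimes>\<^bsub>Z\<^esub> y"
  by (simp add: Z_mult frag_extend_diff)

lemma Z_mult_add_l: "(x + x') \<otimes>\<^bsub>Z\<^esub> y = x \<otimes>\<^bsub>Z\<^esub> y + x' \<otimes>\<^bsub>Z\<^esub> y"
  by (simp add: Z_mult frag_extend_add)

lemma Z_mult_zero [simp]: "0 \<otimes>\<^bsub>Z\<^esub> y = 0" "x \<otimes>\<^bsub>Z\<^esub> 0 = 0"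
  by (simp_all add: Z_mult frag_extend_eq_0)

lemma Z_mult_diff_r:
  assumes "x \<in> carrier Z"
  shows "x \<otimes>\<^bsub>Z\<^esub> (y - y') = x \<otimes>\<^bsub>Z\<^esub> y - x \<otimes>\<^bsub>Z\<^esub> y'"
  using assms
proof (induction x rule: Z_induct)
  case (of a b)
  show ?case by (simp add: Z_mult frag_extend_diff)
next
  case (diff x x')
  then show ?case by (simp add: Z_mult_diff_l)
qed simp

lemma Z_mult_closed: 
  assumes "x \<in> carrier Z" "y \<in> carrier Z"
  shows "x \<otimes>\<^bsub>Z\<^esub> y \<in> carrier Z"
  using assms(1)
proof (induction x rule: Z_induct)
  case (of a b)
  show ?case using assms(2)
    by (induction y rule: Z_induct) (use of in \<open>auto simp: Z_mult_diff_r\<close>)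
qed (auto simp: Z_mult_diff_l)

lemma Z_mult_comm:
  assumes "x \<in> carrier Z" "y \<in> carrier Z"
  shows "x \<otimes>\<^bsub>Z\<^esub> y = y \<otimes>\<^bsub>Z\<^esub> x"
  using assms(1)
proof (induction x rule: Z_induct)
  case (of a b)
  show ?case using assms(2)
    by (induction y rule: Z_induct) (use of in \<open>auto simp: Z_mult_diff_r Z_mult_diff_l m_comm\<close>)
qed (use assms(2) in \<open>auto simp: Z_mult_diff_l Z_mult_diff_r\<close>)

lemma Z_mult_assoc:
  assumes "x \<in> carrier Z" "y \<in> carrier Z" "z \<in> carrier Z"
  shows "(x \<otimes>\<^bsub>Z\<^esub> y) \<otimes>\<^bsub>Z\<^esub> z = x \<otimes>\<^bsub>Z\<^esub> (y \<otimes>\<^bsub>Z\<^esub> z)"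
  using assms(1)
proof (induction x rule: Z_induct)
  case (of a b)
  note ab = of
  show ?case using assms(2)
  proof (induction y rule: Z_induct)
    case (of c d)
    show ?case using assms(3)
      by (induction z rule: Z_induct) (use ab of in \<open>auto simp: Z_mult_diff_r m_assoc\<close>)
  qed (use ab in \<open>auto simp: Z_mult_diff_l Z_mult_diff_r\<close>)
qed (auto simp: Z_mult_diff_l)

lemma Z_one_l:
  assumes "x \<in> carrier Z"
  shows "\<one>\<^bsub>Z\<^esub> \<otimes>\<^bsub>Z\<^esub> x = x"
  using assms by (induction x rule: Z_induct) (auto simp: Z_one Z_mult_diff_r)

lemma Z_cring: "cring Z"
proof (rule cringI)
  show "abelian_group Z"
  proof (rule abelian_groupI)
    fix x assume "x \<in> carrier Z"
    then show "\<exists>y\<in>carrier Z. y \<oplus>\<^bsub>Z\<^esub> x = \<zero>\<^bsub>Z\<^esub>"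
      by (intro bexI[of _ "0 - x"]) (simp, rule Z_diff_closed, auto)
  qed (auto simp: Z_add_closed)
  show "comm_monoid Z"
    by (rule comm_monoidI)
       (auto simp: Z_mult_closed Z_mult_assoc Z_one_l intro: Z_mult_comm, simp add: Z_one)
qed (simp add: Z_mult_add_l)

lemma Z_minus [simp]:
  assumes "x \<in> carrier Z" "y \<in> carrier Z"
  shows "x \<ominus>\<^bsub>Z\<^esub> y = x - y"
proof -
  interpret Z: cring Z by (rule Z_cring)
  have "x = (x - y) \<oplus>\<^bsub>Z\<^esub> y" by simp
  then show ?thesis
    using assms Z.add.inv_solve_right[of "x - y" x y]
    unfolding a_minus_def by (metis Z_diff_closed)
qed

end

section \<open>The ideal of bilinearity relations\<close>

context char_algebra
begin

sublocale AZ: cring "pair_ring A"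
  by (rule A.Z_cring)

abbreviation J where "J \<equiv> tensor_ideal K A"

lemma rels_carrier: "tensor_rels K A \<subseteq> carrier (pair_ring A)"
  by (auto simp: tensor_rels_def)

lemma J_subgroup: "subgroup J (add_monoid (pair_ring A))"
  unfolding tensor_ideal_def
  using AZ.a_group rels_carrier by (intro group.generate_is_subgroup) auto

lemma J_carrier: "x \<in> J \<Longrightarrow> x \<in> carrier (pair_ring A)"
  using subgroup.subset[OF J_subgroup] by auto

lemma J_diff: 
  assumes "x \<in> J" "y \<in> J" shows "x - y \<in> J"
proof -
  interpret subgroup J "add_monoid (pair_ring A)" by (rule J_subgroup)
  have "x \<ominus>\<^bsub>pair_ring A\<^esub> y \<in> J"
    unfolding a_minus_def using assms m_closed m_inv_closed by (simp add: a_inv_def)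
  then show ?thesis using assms J_carrier by simp
qed

lemma J_zero: "0 \<in> J"
  using subgroup.one_closed[OF J_subgroup] by simp

lemma J_induct [consumes 1, case_names zero rel diff]:
  assumes "x \<in> J" "P 0" "\<And>r. r \<in> tensor_rels K A \<Longrightarrow> P r"
    and diff: "\<And>x y. x \<in> J \<Longrightarrow> y \<in> J \<Longrightarrow> P x \<Longrightarrow> P y \<Longrightarrow> P (x - y)"
  shows "P x"
proof -
  let ?H = "{x \<in> J. P x}"
  have r: "tensor_rels K A \<subseteq> J"
    unfolding tensor_ideal_def by (auto intro: generate.incl)
  have neg: "\<ominus>\<^bsub>pair_ring A\<^esub> y = 0 - y" if "y \<in> J" for y
    using A.Z_minus[of 0 y] that J_carrier AZ.minus_eq[of 0 y] by simp
  have add: "x + y \<in> ?H" if "x \<in> ?H" "y \<in> ?H" for x y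
    using diff[of x "0 - y"] diff[of 0 y] J_diff[of 0 y] J_diff[of x "0 - y"] that J_zero assms(2) by auto
  have "subgroup ?H (add_monoid (pair_ring A))"
  proof (rule group.subgroupI[OF AZ.a_group])
    fix y assume "y \<in> ?H"
    then show "inv\<^bsub>add_monoid (pair_ring A)\<^esub> y \<in> ?H"
      using diff[of 0 y] J_diff[of 0 y] J_zero assms(2) neg by (auto simp: a_inv_def)
  qed (use J_carrier J_zero assms(2) add in auto)
  then have "generate (add_monoid (pair_ring A)) (tensor_rels K A) \<subseteq> ?H"
    using assms(3) r by (intro group.generate_subgroup_incl[OF AZ.a_group]) auto
  then show ?thesis using assms(1) unfolding tensor_ideal_def by auto
qed

lemma rels_in_J: "r \<in> tensor_rels K A \<Longrightarrow> r \<in> J"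
  unfolding tensor_ideal_def by (auto intro: generate.incl)

lemma tensor_rels_mem:
  "a \<in> carrier A \<Longrightarrow> a' \<in> carrier A \<Longrightarrow> b \<in> carrier A \<Longrightarrow>
    frag_of (a \<oplus>\<^bsub>A\<^esub> a', b) - frag_of (a, b) - frag_of (a', b) \<in> tensor_rels K A"
  "a \<in> carrier A \<Longrightarrow> b \<in> carrier A \<Longrightarrow> b' \<in> carrier A \<Longrightarrow>
    frag_of (a, b \<oplus>\<^bsub>A\<^esub> b') - frag_of (a, b) - frag_of (a, b') \<in> tensor_rels K A"
  "c \<in> carrier K \<Longrightarrow> a \<in> carrier A \<Longrightarrow> b \<in> carrier A \<Longrightarrow>
    frag_of (c \<odot>\<^bsub>A\<^esub> a, b) - frag_of (a, c \<odot>\<^bsub>A\<^esub> b) \<in> tensor_rels K A"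
  unfolding tensor_rels_def by blast+

text \<open>A pair acts on each slot separately, so every type of relation goes to one of the same
  type. Therefore the additive subgroup generated by the relations is an ideal.\<close>

lemma rel_mult:
  assumes "a \<in> carrier A" "b \<in> carrier A" "r \<in> tensor_rels K A"
  shows "frag_of (a, b) \<otimes>\<^bsub>pair_ring A\<^esub> r \<in> tensor_rels K A"
  using assms(3) unfolding tensor_rels_def
proof (elim UnE CollectE exE conjE, goal_cases)
  case (1 c c' d)
  then show ?case
    using assms(1,2)
    by (intro UnI1 CollectI exI[of _ "a \<otimes>\<^bsub>A\<^esub> c"] exI[of _ "a \<otimes>\<^bsub>A\<^esub> c'"] exI[of _ "b \<otimes>\<^bsub>A\<^esub> d"])
       (simp add: A.Z_mult_diff_r A.r_distr)
next
  case (2 c d d')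
  then show ?case
    using assms(1,2)
    by (intro UnI1 UnI2 CollectI exI[of _ "a \<otimes>\<^bsub>A\<^esub> c"] exI[of _ "b \<otimes>\<^bsub>A\<^esub> d"] exI[of _ "b \<otimes>\<^bsub>A\<^esub> d'"])
       (simp add: A.Z_mult_diff_r A.r_distr)
next
  case (3 c x y)
  then show ?case
    using assms(1,2)
    by (intro UnI2 CollectI exI[of _ c] exI[of _ "a \<otimes>\<^bsub>A\<^esub> x"] exI[of _ "b \<otimes>\<^bsub>A\<^esub> y"])
       (simp add: A.Z_mult_diff_r smult_eq_sc A.m_lcomm)
qed

lemma J_mult:
  assumes "z \<in> carrier (pair_ring A)" "x \<in> J"
  shows "z \<otimes>\<^bsub>pair_ring A\<^esub> x \<in> J"
  using assms(1)
proof (induction z rule: A.Z_induct)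
  case (of a b)
  show ?case using assms(2)
    by (induction x rule: J_induct)
       (use of in \<open>auto simp: A.Z_mult_diff_r J_zero intro: J_diff rels_in_J rel_mult\<close>)
qed (auto simp: A.Z_mult_diff_l J_zero intro: J_diff)

lemma J_ideal: "ideal J (pair_ring A)"
proof (intro idealI[OF AZ.ring_axioms J_subgroup])
  fix x z assume xz: "x \<in> J" "z \<in> carrier (pair_ring A)"
  then show "z \<otimes>\<^bsub>pair_ring A\<^esub> x \<in> J" by (simp add: J_mult)
  then show "x \<otimes>\<^bsub>pair_ring A\<^esub> z \<in> J" using xz A.Z_mult_comm[of x z] J_carrier by simp
qed

sublocale J: ideal J "pair_ring A"
  by (rule J_ideal)

lemma tensor_ring_cring: "cring (tensor_ring K A)"
  unfolding tensor_ring_def by (rule J.quotient_is_cring[OF A.Z_cring])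

abbreviation pt where "pt \<equiv> pure_tensor K A"

lemma J_coset_eq:
  "x \<in> carrier (pair_ring A) \<Longrightarrow> y \<in> carrier (pair_ring A) \<Longrightarrow> x - y \<in> J \<Longrightarrow>
    J +>\<^bsub>pair_ring A\<^esub> x = J +>\<^bsub>pair_ring A\<^esub> y"
  using AZ.quotient_eq_iff_same_a_r_cos[OF J_ideal, of x y] by simp

end

lemma cring_cong:
  assumes "cring R" "carrier S = carrier R" "add S = add R" "mult S = mult R"
    "one S = one R" "zero S = zero R"
  shows "cring S"
proof -
  interpret R: cring R by fact
  show ?thesis
  proof (rule cringI)
    show "abelian_group S"
      by (rule abelian_groupI) (auto simp: assms(2-) R.a_ac intro: R.l_neg)
    show "comm_monoid S"
      by (rule comm_monoidI) (auto simp: assms(2-) R.m_ac)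
  qed (auto simp: assms(2-) R.l_distr)
qed

text \<open>The candidate \<open>q\<close> enters only the field \<open>pmap\<close>. It is
  arbitrary because \<open>tensor_pmap\<close> is defined by a description over all candidates, each
  with its own record \<open>tensor_with K A q\<close>.\<close>

locale alg_tensor = char_algebra K A p
  for K :: "('k, 'e) ring_scheme" (structure)
    and A :: "('k, 'a, 'z) pd_alg_scheme" (structure)
    and p :: nat +
  fixes q :: "('a \<times> 'a \<Rightarrow>\<^sub>0 int) set \<Rightarrow> ('a \<times> 'a \<Rightarrow>\<^sub>0 int) set"
begin

abbreviation T where "T \<equiv> tensor_with K A q"

lemma T_simps: "carrier T = carrier (tensor_ring K A)" "add T = add (tensor_ring K A)"
  "mult T = mult (tensor_ring K A)" "one T = one (tensor_ring K A)" "zero T = zero (tensor_ring K A)"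
  by (simp_all add: tensor_with_def Let_def)

lemma T_cring: "cring T"
  by (rule cring_cong[OF tensor_ring_cring]) (simp_all add: T_simps)

sublocale T: cring "tensor_with K A q"
  by (rule T_cring)

lemma rcos_hom: "ring_hom_cring (pair_ring A) T ((+>\<^bsub>pair_ring A\<^esub>) J)"
proof (rule ring_hom_cringI[OF A.Z_cring T_cring])
  show "(+>\<^bsub>pair_ring A\<^esub>) J \<in> ring_hom (pair_ring A) T"
    using J.rcos_ring_hom unfolding ring_hom_def T_simps tensor_ring_def by simp
qed

sublocale rc: ring_hom_cring "pair_ring A" "tensor_with K A q" "(+>\<^bsub>pair_ring A\<^esub>) (tensor_ideal K A)"
  by (rule rcos_hom)

lemma pt_closed [simp, intro]: "a \<in> carrier A \<Longrightarrow> b \<in> carrier A \<Longrightarrow> pt a b \<in> carrier T"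
  using rc.hom_closed[of "frag_of (a, b)"] by (simp add: pure_tensor_def)

lemma pt_mult: 
  assumes "a \<in> carrier A" "b \<in> carrier A" "c \<in> carrier A" "d \<in> carrier A"
  shows "pt a b \<otimes>\<^bsub>T\<^esub> pt c d = pt (a \<otimes>\<^bsub>A\<^esub> c) (b \<otimes>\<^bsub>A\<^esub> d)"
  using rc.hom_mult[of "frag_of (a, b)" "frag_of (c, d)"] assms by (simp add: pure_tensor_def del: rc.hom_mult)

lemma pt_one: "\<one>\<^bsub>T\<^esub> = pt \<one>\<^bsub>A\<^esub> \<one>\<^bsub>A\<^esub>"
  using rc.hom_one by (simp add: pure_tensor_def A.Z_one del: rc.hom_one)

lemma pt_add_l:
  assumes "a \<in> carrier A" "a' \<in> carrier A" "b \<in> carrier A"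
  shows "pt (a \<oplus>\<^bsub>A\<^esub> a') b = pt a b \<oplus>\<^bsub>T\<^esub> pt a' b"
proof -
  have "pt (a \<oplus>\<^bsub>A\<^esub> a') b = J +>\<^bsub>pair_ring A\<^esub> (frag_of (a, b) + frag_of (a', b))"
    unfolding pure_tensor_def using assms
    using rels_in_J[OF tensor_rels_mem(1)[OF assms]]
    by (intro J_coset_eq) (auto simp: A.Z_add_closed diff_diff_eq)
  then show ?thesis
    using rc.hom_add[of "frag_of (a, b)" "frag_of (a', b)"] assms by (simp add: pure_tensor_def del: rc.hom_add)
qed

lemma pt_add_r:
  assumes "a \<in> carrier A" "b \<in> carrier A" "b' \<in> carrier A"
  shows "pt a (b \<oplus>\<^bsub>A\<^esub> b') = pt a b \<oplus>\<^bsub>T\<^esub> pt a b'"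
proof -
  have "pt a (b \<oplus>\<^bsub>A\<^esub> b') = J +>\<^bsub>pair_ring A\<^esub> (frag_of (a, b) + frag_of (a, b'))"
    unfolding pure_tensor_def using assms
    using rels_in_J[OF tensor_rels_mem(2)[OF assms]]
    by (intro J_coset_eq) (auto simp: A.Z_add_closed diff_diff_eq)
  then show ?thesis
    using rc.hom_add[of "frag_of (a, b)" "frag_of (a, b')"] assms by (simp add: pure_tensor_def del: rc.hom_add)
qed

lemma pt_smult:
  assumes "c \<in> carrier K" "a \<in> carrier A" "b \<in> carrier A"
  shows "pt (c \<odot>\<^bsub>A\<^esub> a) b = pt a (c \<odot>\<^bsub>A\<^esub> b)"
  unfolding pure_tensor_def using assms
  by (intro J_coset_eq rels_in_J tensor_rels_mem) auto

lemma pt_zero [simp]: "a \<in> carrier A \<Longrightarrow> pt a \<zero>\<^bsub>A\<^esub> = \<zero>\<^bsub>T\<^esub>" "a \<in> carrier A \<Longrightarrow> pt \<zero>\<^bsub>A\<^esub> a = \<zero>\<^bsub>T\<^esub>"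
proof -
  assume a: "a \<in> carrier A"
  have *: "t = \<zero>\<^bsub>T\<^esub>" if "t \<in> carrier T" "t = t \<oplus>\<^bsub>T\<^esub> t" for t
    using T.add.l_cancel_one[OF that(1,1)] that(2)[symmetric] by simp
  show "pt a \<zero>\<^bsub>A\<^esub> = \<zero>\<^bsub>T\<^esub>" "pt \<zero>\<^bsub>A\<^esub> a = \<zero>\<^bsub>T\<^esub>"
    using a pt_add_r[of a "\<zero>\<^bsub>A\<^esub>" "\<zero>\<^bsub>A\<^esub>"] pt_add_l[of "\<zero>\<^bsub>A\<^esub>" "\<zero>\<^bsub>A\<^esub>" a]
    by (auto intro!: *)
qed

lemma pt_neg: "a \<in> carrier A \<Longrightarrow> b \<in> carrier A \<Longrightarrow> \<ominus>\<^bsub>T\<^esub> pt a b = pt (\<ominus>\<^bsub>A\<^esub> a) b"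
  using pt_add_l[of "\<ominus>\<^bsub>A\<^esub> a" a b] by (intro T.minus_equality) (auto simp: A.l_neg)

lemma T_carrier: "carrier T = (\<lambda>x. J +>\<^bsub>pair_ring A\<^esub> x) ` carrier (pair_ring A)"
  unfolding T_simps tensor_ring_def FactRing_def A_RCOSETS_def' by auto

lemma T_induct [consumes 1, case_names zero pure add]:
  assumes "t \<in> carrier T" "P \<zero>\<^bsub>T\<^esub>" "\<And>a b. a \<in> carrier A \<Longrightarrow> b \<in> carrier A \<Longrightarrow> P (pt a b)"
    and add: "\<And>s t. s \<in> carrier T \<Longrightarrow> t \<in> carrier T \<Longrightarrow> P s \<Longrightarrow> P t \<Longrightarrow> P (s \<oplus>\<^bsub>T\<^esub> t)"
  shows "P t"
proof -
  obtain x where x: "x \<in> carrier (pair_ring A)" "t = J +>\<^bsub>pair_ring A\<^esub> x"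
    using assms(1) T_carrier by auto
  \<comment> \<open>The negative is carried along because the induction on formal sums steps through
    differences; in the base case it is available since the negative of a pure tensor is
    pure.\<close>
  have "P (J +>\<^bsub>pair_ring A\<^esub> x) \<and> P (\<ominus>\<^bsub>T\<^esub> (J +>\<^bsub>pair_ring A\<^esub> x))"
    using x(1)
  proof (induction x rule: A.Z_induct)
    case zero
    then show ?case using assms(2) rc.hom_zero by simp
  next
    case (of a b)
    then show ?case
      using assms(3)[of a b] assms(3)[of "\<ominus>\<^bsub>A\<^esub> a" b] pt_neg[of a b] by (simp add: pure_tensor_def)
  next
    case (diff x y)
    have e: "J +>\<^bsub>pair_ring A\<^esub> (x - y) = (J +>\<^bsub>pair_ring A\<^esub> x) \<oplus>\<^bsub>T\<^esub> \<ominus>\<^bsub>T\<^esub> (J +>\<^bsub>pair_ring A\<^esub> y)"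
      using diff(1,2) rc.hom_add[of x "\<ominus>\<^bsub>pair_ring A\<^esub> y"] AZ.minus_eq[of x y] 
      by (simp del: A.Z_add)
    show ?case
      using diff unfolding e
      by (auto simp: T.minus_add intro!: add)
  qed
  then show ?thesis using x by simp
qed

text \<open>Evaluation of formal sums is additive and kills each relation, hence the whole ideal. It
  is thus constant on every class, and \<open>the_elem\<close> returns the common value.\<close>

lemma lift_properties:
  assumes "abelian_group G"
    and h: "\<And>a b. a \<in> carrier A \<Longrightarrow> b \<in> carrier A \<Longrightarrow> h a b \<in> carrier G"
    and hl: "\<And>a a' b. a \<in> carrier A \<Longrightarrow> a' \<in> carrier A \<Longrightarrow> b \<in> carrier A \<Longrightarrow>
        h (a \<oplus>\<^bsub>A\<^esub> a') b = h a b \<oplus>\<^bsub>G\<^esub> h a' b"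
    and hr: "\<And>a b b'. a \<in> carrier A \<Longrightarrow> b \<in> carrier A \<Longrightarrow> b' \<in> carrier A \<Longrightarrow>
        h a (b \<oplus>\<^bsub>A\<^esub> b') = h a b \<oplus>\<^bsub>G\<^esub> h a b'"
    and hs: "\<And>c a b. c \<in> carrier K \<Longrightarrow> a \<in> carrier A \<Longrightarrow> b \<in> carrier A \<Longrightarrow>
        h (c \<odot>\<^bsub>A\<^esub> a) b = h a (c \<odot>\<^bsub>A\<^esub> b)"
  shows lift_closed: "t \<in> carrier T \<Longrightarrow> tensor_lift G h t \<in> carrier G"
    and lift_add: "s \<in> carrier T \<Longrightarrow> t \<in> carrier T \<Longrightarrow>
        tensor_lift G h (s \<oplus>\<^bsub>T\<^esub> t) = tensor_lift G h s \<oplus>\<^bsub>G\<^esub> tensor_lift G h t"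
    and lift_pure: "a \<in> carrier A \<Longrightarrow> b \<in> carrier A \<Longrightarrow> tensor_lift G h (pt a b) = h a b"
proof -
  interpret G: abelian_group G by fact
  let ?h = "\<lambda>u. h (fst u) (snd u)"
  let ?S = "carrier A \<times> carrier A"
  have hS: "?h \<in> ?S \<rightarrow> carrier G" using h by auto
  note add = G.frag_sum_add[OF _ _ hS, folded A.Z_carrier]
    and diff = G.frag_sum_diff[OF _ _ hS, folded A.Z_carrier]
    and cl [simp] = G.frag_sum_closed[OF _ hS, folded A.Z_carrier]
    and of = G.frag_sum_of[of ?h]
  have J0: "G.frag_sum ?h x = \<zero>\<^bsub>G\<^esub>" if "x \<in> J" for x
    using that
  proof (induction x rule: J_induct)
    case (rel r)
    have ar: "u \<ominus>\<^bsub>G\<^esub> v \<ominus>\<^bsub>G\<^esub> w = \<zero>\<^bsub>G\<^esub>" if "u = v \<oplus>\<^bsub>G\<^esub> w" "v \<in> carrier G" "w \<in> carrier G" for u v w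
      using that G.r_neg[of "v \<oplus>\<^bsub>G\<^esub> w"] by (simp add: a_minus_def G.minus_add G.a_assoc)
    from rel show ?case unfolding tensor_rels_def
    proof (elim UnE CollectE exE conjE, goal_cases)
      case (1 a a' b)
      then show ?case using hl h by (auto simp: diff of intro!: ar)
    next
      case (2 a b b')
      then show ?case using hr h by (auto simp: diff of intro!: ar)
    next
      case (3 c a b)
      then show ?case using hs h by (auto simp: diff of a_minus_def G.r_neg)
    qed
  qed (auto simp: diff J_carrier a_minus_def)
  have coset: "tensor_lift G h (J +>\<^bsub>pair_ring A\<^esub> x) = G.frag_sum ?h x" if x: "x \<in> carrier (pair_ring A)" for x
  proof -
    have "G.frag_sum ?h y = G.frag_sum ?h x" if y: "y \<in> J +>\<^bsub>pair_ring A\<^esub> x" for y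
    proof -
      obtain j where "j \<in> J" "y = j + x" using y by (auto simp: a_r_coset_def')
      then show ?thesis using x J0 J_carrier by (simp add: add)
    qed
    moreover have "x \<in> J +>\<^bsub>pair_ring A\<^esub> x"
      using J.a_rcos_self[OF x] .
    ultimately have "G.frag_sum ?h ` (J +>\<^bsub>pair_ring A\<^esub> x) = {G.frag_sum ?h x}" by blast
    then show ?thesis
      unfolding tensor_lift_def G.frag_sum_def by simp
  qed
  show "t \<in> carrier T \<Longrightarrow> tensor_lift G h t \<in> carrier G"
    by (auto simp: T_carrier coset)
  show "tensor_lift G h (s \<oplus>\<^bsub>T\<^esub> t) = tensor_lift G h s \<oplus>\<^bsub>G\<^esub> tensor_lift G h t"
    if st: "s \<in> carrier T" "t \<in> carrier T"
  proof -
    obtain x y where xy: "x \<in> carrier (pair_ring A)" "y \<in> carrier (pair_ring A)"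
      "s = J +>\<^bsub>pair_ring A\<^esub> x" "t = J +>\<^bsub>pair_ring A\<^esub> y"
      using st T_carrier by auto
    then have "s \<oplus>\<^bsub>T\<^esub> t = J +>\<^bsub>pair_ring A\<^esub> (x + y)"
      using rc.hom_add[of x y] by simp
    then show ?thesis using xy by (simp add: coset add A.Z_add_closed)
  qed
  show "a \<in> carrier A \<Longrightarrow> b \<in> carrier A \<Longrightarrow> tensor_lift G h (pt a b) = h a b"
    by (simp add: pure_tensor_def coset of h)
qed

end

section \<open>The divided powers of the tensor square\<close>

lemma set_add_three:
  "t \<in> B <+>\<^bsub>G\<^esub> C <+>\<^bsub>G\<^esub> D \<longleftrightarrow> (\<exists>x\<in>B. \<exists>y\<in>C. \<exists>z\<in>D. t = x \<oplus>\<^bsub>G\<^esub> y \<oplus>\<^bsub>G\<^esub> z)"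
  unfolding set_add_def' by blast

lemma (in abelian_monoid) add_three_three:
  assumes "x \<in> carrier G" "y \<in> carrier G" "z \<in> carrier G" "x' \<in> carrier G" "y' \<in> carrier G" "z' \<in> carrier G"
  shows "(x \<oplus> y \<oplus> z) \<oplus> (x' \<oplus> y' \<oplus> z') = (x \<oplus> x') \<oplus> (y \<oplus> y') \<oplus> (z \<oplus> z')"
  using assms by (simp add: a_ac)

lemma (in abelian_group) add_minus_cancel:
  "e \<in> carrier G \<Longrightarrow> r \<in> carrier G \<Longrightarrow> e \<oplus> r \<ominus> e = r"
  by (simp add: minus_eq a_comm[of e r] a_assoc r_neg)

text \<open>In a commutative ring with \<open>p = 0\<close> this is the additive group of Witt
  vectors of length two: \<Phi> is the carry \<open>(x^p + y^p - (x + y)^p) / p\<close>, read as a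
  polynomial with integer coefficients.\<close>

definition ext_group :: "('a, 'b) ring_scheme \<Rightarrow> nat \<Rightarrow> ('a \<times> 'a) ring" where
  "ext_group R p = \<lparr>carrier = carrier R \<times> carrier R, mult = undefined, one = undefined,
     zero = (\<zero>\<^bsub>R\<^esub>, \<zero>\<^bsub>R\<^esub>),
     add = (\<lambda>u v. (fst u \<oplus>\<^bsub>R\<^esub> fst v, snd u \<oplus>\<^bsub>R\<^esub> snd v \<oplus>\<^bsub>R\<^esub> pd_cocycle R p (fst u) (fst v)))\<rparr>"

context prime_char
begin

abbreviation E where "E \<equiv> ext_group R p"

lemma E_simps [simp]: "u \<in> carrier E \<longleftrightarrow> fst u \<in> carrier R \<and> snd u \<in> carrier R"
  "\<zero>\<^bsub>E\<^esub> = (\<zero>, \<zero>)" "fst (u \<oplus>\<^bsub>E\<^esub> v) = fst u \<oplus> fst v"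
  "snd (u \<oplus>\<^bsub>E\<^esub> v) = snd u \<oplus> snd v \<oplus> Phi (fst u) (fst v)"
  by (auto simp: ext_group_def mem_Times_iff)

lemma ext_group_abelian: "abelian_group E"
proof (rule abelian_groupI)
  fix u v w assume c: "u \<in> carrier E" "v \<in> carrier E" "w \<in> carrier E"
  have "snd (u \<oplus>\<^bsub>E\<^esub> v \<oplus>\<^bsub>E\<^esub> w) = snd u \<oplus> snd v \<oplus> snd w \<oplus> (Phi (fst u \<oplus> fst v) (fst w) \<oplus> Phi (fst u) (fst v))"
    using c by (simp add: a_ac)
  also have "\<dots> = snd u \<oplus> snd v \<oplus> snd w \<oplus> (Phi (fst u) (fst v \<oplus> fst w) \<oplus> Phi (fst v) (fst w))"
    using c by (simp add: Phi_assoc)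
  also have "\<dots> = snd (u \<oplus>\<^bsub>E\<^esub> (v \<oplus>\<^bsub>E\<^esub> w))"
    using c by (simp add: a_ac)
  finally show "u \<oplus>\<^bsub>E\<^esub> v \<oplus>\<^bsub>E\<^esub> w = u \<oplus>\<^bsub>E\<^esub> (v \<oplus>\<^bsub>E\<^esub> w)"
    using c by (simp add: prod_eq_iff a_assoc)
next
  fix u v assume c: "u \<in> carrier E" "v \<in> carrier E"
  then show "u \<oplus>\<^bsub>E\<^esub> v = v \<oplus>\<^bsub>E\<^esub> u"
    by (simp add: prod_eq_iff a_comm Phi_comm)
next
  fix u assume c: "u \<in> carrier E"
  \<comment> \<open>Here \<open>fst u\<close> is arbitrary and need not have p-th power 0, so
    \<open>Phi_neg\<close> does not apply and the second component has to cancel the cocycle term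
    explicitly.\<close>
  let ?v = "(\<ominus> fst u, \<ominus> snd u \<oplus> \<ominus> Phi (\<ominus> fst u) (fst u))"
  have "?v \<oplus>\<^bsub>E\<^esub> u = \<zero>\<^bsub>E\<^esub>"
    using c by (simp add: prod_eq_iff l_neg a_assoc) (simp add: a_ac l_neg r_neg r_neg1)
  then show "\<exists>v\<in>carrier E. v \<oplus>\<^bsub>E\<^esub> u = \<zero>\<^bsub>E\<^esub>"
    using c by (intro bexI[of _ ?v]) auto
qed (auto simp: prod_eq_iff)

end

section \<open>The grading of \<open>A \<otimes> A\<close>\<close>

locale pd_tensor = pd_char K A p + alg_tensor K A p q
  for K :: "('k, 'e) ring_scheme" (structure)
    and A :: "('k, 'a, 'z) pd_alg_scheme" (structure)
    and p :: nat and q +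
  assumes zero_part_sc: "zero_part A = sc ` carrier K"
begin

definition j1 where "j1 a = pt a \<one>\<^bsub>A\<^esub>"
definition j2 where "j2 a = pt \<one>\<^bsub>A\<^esub> a"

lemma j1_hom: "ring_hom_cring A T j1"
  by (rule ring_hom_cringI[OF A.cring_axioms T_cring])
     (auto intro!: ring_hom_memI simp: j1_def pt_mult pt_add_l pt_one)

lemma j2_hom: "ring_hom_cring A T j2"
  by (rule ring_hom_cringI[OF A.cring_axioms T_cring])
     (auto intro!: ring_hom_memI simp: j2_def pt_mult pt_add_r pt_one)

sublocale j1: ring_hom_cring A "tensor_with K A q" j1
  by (rule j1_hom)

sublocale j2: ring_hom_cring A "tensor_with K A q" j2
  by (rule j2_hom)

lemma pt_eq: "a \<in> carrier A \<Longrightarrow> b \<in> carrier A \<Longrightarrow> pt a b = j1 a \<otimes>\<^bsub>T\<^esub> j2 b"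
  by (simp add: j1_def j2_def pt_mult)

lemma hom_nat:
  fixes n :: nat
  assumes "ring_hom_cring A T h"
  shows "h (add_pow A n \<one>\<^bsub>A\<^esub>) = add_pow T n \<one>\<^bsub>T\<^esub>"
proof -
  interpret ring_hom_cring A T h by fact
  show ?thesis by (induction n) simp_all
qed

sublocale T: prime_char "tensor_with K A q" p
  using hom_nat[OF j1_hom, of p] A.char_p prime_p by unfold_locales simp_all

lemma j_pow: "a \<in> carrier A \<Longrightarrow> j1 (a [^]\<^bsub>A\<^esub> n) = j1 a [^]\<^bsub>T\<^esub> n"
  "a \<in> carrier A \<Longrightarrow> j2 (a [^]\<^bsub>A\<^esub> n) = j2 a [^]\<^bsub>T\<^esub> n" for n :: nat
  by (induction n) simp_all

lemma j_Phi:
  assumes "x \<in> carrier A" "y \<in> carrier A"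
  shows "j1 (A.Phi x y) = T.Phi (j1 x) (j1 y)" "j2 (A.Phi x y) = T.Phi (j2 x) (j2 y)"
  using j1.hom_pd_cocycle[OF A.prime_char_axioms assms] j2.hom_pd_cocycle[OF A.prime_char_axioms assms]
  by auto

lemma T_smult: "c \<in> carrier K \<Longrightarrow> c \<odot>\<^bsub>T\<^esub> t = j1 (sc c) \<otimes>\<^bsub>T\<^esub> t"
  by (simp add: tensor_with_def Let_def j1_def sc_def)

lemma T_algebra: "Module.algebra K T"
  by (rule algebraI[OF K.cring_axioms T_cring]) (auto simp: T_smult T.l_distr T.r_distr T.m_assoc)

sublocale TK: char_algebra K "tensor_with K A q" p
  using T_algebra field_K prime_p char_K by (intro char_algebra.intro)

lemma j_scalar: "c \<in> carrier K \<Longrightarrow> j2 (sc c) = j1 (sc c)"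
  using pt_smult[of c "\<one>\<^bsub>A\<^esub>" "\<one>\<^bsub>A\<^esub>"] by (simp add: j1_def j2_def sc_def)

lemma j_zero_part: "c \<in> zero_part A \<Longrightarrow> j2 c = j1 c"
  by (auto simp: zero_part_sc j_scalar)

lemma pt_zero_part: "c \<in> zero_part A \<Longrightarrow> a \<in> carrier A \<Longrightarrow> pt a c = j1 (c \<otimes>\<^bsub>A\<^esub> a)"
  "c \<in> zero_part A \<Longrightarrow> a \<in> carrier A \<Longrightarrow> pt c a = j2 (c \<otimes>\<^bsub>A\<^esub> a)"
  by (simp_all add: pt_eq j_zero_part T.m_comm)

lemma deg_zero_lift:
  defines "e \<equiv> tensor_lift A (\<lambda>a b. deg_zero A a \<otimes>\<^bsub>A\<^esub> deg_zero A b)"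
  shows "t \<in> carrier T \<Longrightarrow> e t \<in> carrier A"
    and "s \<in> carrier T \<Longrightarrow> t \<in> carrier T \<Longrightarrow> e (s \<oplus>\<^bsub>T\<^esub> t) = e s \<oplus>\<^bsub>A\<^esub> e t"
    and "a \<in> carrier A \<Longrightarrow> b \<in> carrier A \<Longrightarrow> e (pt a b) = deg_zero A a \<otimes>\<^bsub>A\<^esub> deg_zero A b"
proof -
  note L = lift_properties[OF A.abelian_group_axioms, of "\<lambda>a b. deg_zero A a \<otimes>\<^bsub>A\<^esub> deg_zero A b", folded e_def]
  note [simp] = deg_zero_add deg_zero_scalar A.l_distr A.r_distr
  have s: "(c \<odot>\<^bsub>A\<^esub> x) \<otimes>\<^bsub>A\<^esub> y = x \<otimes>\<^bsub>A\<^esub> (c \<odot>\<^bsub>A\<^esub> y)" if "c \<in> carrier K" "x \<in> carrier A" "y \<in> carrier A" for c x y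
    using that by (simp add: smult_eq_sc A.m_ac)
  show "t \<in> carrier T \<Longrightarrow> e t \<in> carrier A"
    by (rule L(1)) (auto simp: s)
  show "s \<in> carrier T \<Longrightarrow> t \<in> carrier T \<Longrightarrow> e (s \<oplus>\<^bsub>T\<^esub> t) = e s \<oplus>\<^bsub>A\<^esub> e t"
    by (rule L(2)) (auto simp: s)
  show "a \<in> carrier A \<Longrightarrow> b \<in> carrier A \<Longrightarrow> e (pt a b) = deg_zero A a \<otimes>\<^bsub>A\<^esub> deg_zero A b"
    by (rule L(3)) (auto simp: s)
qed

text \<open>The augmentation of \<open>A \<otimes> A\<close>. The positive part, given by
  generators, will be recognized as its kernel; in that form it is visibly an ideal.\<close>

definition eT where "eT = tensor_lift A (\<lambda>a b. deg_zero A a \<otimes>\<^bsub>A\<^esub> deg_zero A b)"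

lemmas eT_closed [simp] = deg_zero_lift(1)[folded eT_def]
  and eT_add = deg_zero_lift(2)[folded eT_def]
  and eT_pure = deg_zero_lift(3)[folded eT_def]

lemma eT_zero: "eT \<zero>\<^bsub>T\<^esub> = \<zero>\<^bsub>A\<^esub>"
  using eT_pure[of "\<zero>\<^bsub>A\<^esub>" "\<zero>\<^bsub>A\<^esub>"] by simp

lemma eT_mult:
  assumes "s \<in> carrier T" "t \<in> carrier T"
  shows "eT (s \<otimes>\<^bsub>T\<^esub> t) = eT s \<otimes>\<^bsub>A\<^esub> eT t"
  using assms(1)
proof (induction s rule: T_induct)
  case (pure a b)
  show ?case using assms(2)
  proof (induction t rule: T_induct)
    case (pure c d)
    with \<open>a \<in> carrier A\<close> \<open>b \<in> carrier A\<close> show ?case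
      by (simp add: pt_mult eT_pure deg_zero_mult A.m_ac)
  qed (use pure in \<open>auto simp: eT_zero eT_add T.r_distr A.r_distr\<close>)
qed (use assms in \<open>auto simp: eT_zero eT_add T.l_distr A.l_distr\<close>)

lemma eT_hom: "ring_hom_cring T A eT"
  by (rule ring_hom_cringI[OF T_cring A.cring_axioms])
     (auto intro!: ring_hom_memI simp: eT_mult eT_add pt_one eT_pure)

sublocale eT: ring_hom_cring "tensor_with K A q" A eT
  by (rule eT_hom)

lemma eT_ring_hom: "ring_hom_ring T A eT"
  by (rule ring_hom_ringI2[OF T.ring_axioms A.ring_axioms eT.homh])

lemma eT_zero_part: "t \<in> carrier T \<Longrightarrow> eT t \<in> zero_part A"
  by (induction t rule: T_induct)
     (auto simp: eT_pure subringE(6)[OF zero_part_subring] subringE(7)[OF zero_part_subring])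

definition pos_gens where "pos_gens = {pt x y |x y. x \<in> pos_part A \<and> y \<in> pos_part A}"

lemma pos_gensI: "x \<in> pos_part A \<Longrightarrow> y \<in> pos_part A \<Longrightarrow> pt x y \<in> pos_gens"
  unfolding pos_gens_def by blast

lemma gens_carrier: "pos_gens \<subseteq> carrier T"
  by (auto simp: pos_gens_def)

lemma gens_subgroup: "subgroup (generate (add_monoid T) pos_gens) (add_monoid T)"
  using gens_carrier by (intro group.generate_is_subgroup[OF T.a_group]) auto

text \<open>\<open>tensor_with\<close> writes its generated subgroup over
  \<open>tensor_ring\<close>, while all arguments take place in T; the two records share their
  additive structure.\<close>

lemma generate_tensor_ring:
  "generate (add_monoid (tensor_ring K A)) H = generate (add_monoid T) H"
proof -
  have minv: "inv\<^bsub>add_monoid (tensor_ring K A)\<^esub> x = inv\<^bsub>add_monoid T\<^esub> x" for x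
    by (simp add: m_inv_def T_simps)
  have "x \<in> generate (add_monoid T) H" if "x \<in> generate (add_monoid (tensor_ring K A)) H" for x
    using that
  proof (induction rule: generate.induct)
    case one
    show ?case using generate.one[of "add_monoid T" H] by (simp add: T_simps)
  next
    case (inv h)
    then show ?case using generate.inv[of h H "add_monoid T"] by (simp only: minv)
  next
    case (eng g h)
    then show ?case using generate.eng[of g "add_monoid T" H h] by (simp add: T_simps)
  qed (rule generate.incl)
  moreover have "x \<in> generate (add_monoid (tensor_ring K A)) H" if "x \<in> generate (add_monoid T) H" for x
    using that
  proof (induction rule: generate.induct)
    case one
    show ?case using generate.one[of "add_monoid (tensor_ring K A)" H] by (simp add: T_simps)
  next
    case (inv h)
    then show ?case using generate.inv[of h H "add_monoid (tensor_ring K A)"] by (simp only: minv)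
  next
    case (eng g h)
    then show ?case using generate.eng[of g "add_monoid (tensor_ring K A)" H h] by (simp add: T_simps)
  qed (rule generate.incl)
  ultimately show ?thesis by blast
qed

text \<open>A constant factor moves across the tensor sign, so the first two summands of
  \<open>pos_part T\<close> are the images of \<open>pos_part A\<close> under \<open>j2\<close> and
  \<open>j1\<close>.\<close>

lemma pos_part_T: "t \<in> pos_part T \<longleftrightarrow>
  (\<exists>x\<in>pos_part A. \<exists>y\<in>pos_part A. \<exists>g\<in>generate (add_monoid T) pos_gens. t = j2 x \<oplus>\<^bsub>T\<^esub> j1 y \<oplus>\<^bsub>T\<^esub> g)"
proof -
  have z: "(\<lambda>c. c \<odot>\<^bsub>A\<^esub> \<one>\<^bsub>A\<^esub>) ` carrier K = zero_part A"
    by (simp add: zero_part_sc sc_def image_def)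
  have one: "\<one>\<^bsub>A\<^esub> \<in> zero_part A" by (rule subringE(3)[OF zero_part_subring])
  have 1: "{pt c x |c x. c \<in> zero_part A \<and> x \<in> pos_part A} = j2 ` pos_part A"
  proof (intro equalityI subsetI)
    fix t assume "t \<in> {pt c x |c x. c \<in> zero_part A \<and> x \<in> pos_part A}"
    then obtain c x where "c \<in> zero_part A" "x \<in> pos_part A" "t = pt c x" by blast
    then show "t \<in> j2 ` pos_part A"
      by (intro image_eqI[of _ _ "c \<otimes>\<^bsub>A\<^esub> x"]) (simp_all add: pt_zero_part(2) pos.I_l_closed del: j2.hom_mult)
  qed (use one in \<open>unfold j2_def, blast\<close>)
  have 2: "{pt x c |c x. c \<in> zero_part A \<and> x \<in> pos_part A} = j1 ` pos_part A"
  proof (intro equalityI subsetI)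
    fix t assume "t \<in> {pt x c |c x. c \<in> zero_part A \<and> x \<in> pos_part A}"
    then obtain c x where "c \<in> zero_part A" "x \<in> pos_part A" "t = pt x c" by blast
    then show "t \<in> j1 ` pos_part A"
      by (intro image_eqI[of _ _ "c \<otimes>\<^bsub>A\<^esub> x"]) (simp_all add: pt_zero_part(1) pos.I_l_closed del: j1.hom_mult)
  qed (use one in \<open>unfold j1_def, blast\<close>)
  have "pos_part T = j2 ` pos_part A <+>\<^bsub>tensor_ring K A\<^esub> j1 ` pos_part A <+>\<^bsub>tensor_ring K A\<^esub>
       generate (add_monoid (tensor_ring K A)) pos_gens"
    unfolding tensor_with_def Let_def z 1 2 pos_gens_def by simp
  then show ?thesis
    unfolding generate_tensor_ring by (simp only: set_add_three T_simps(2)[symmetric] bex_simps)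
qed

lemma pos_part_TI:
  "x \<in> pos_part A \<Longrightarrow> y \<in> pos_part A \<Longrightarrow> g \<in> generate (add_monoid T) pos_gens \<Longrightarrow>
    j2 x \<oplus>\<^bsub>T\<^esub> j1 y \<oplus>\<^bsub>T\<^esub> g \<in> pos_part T"
  unfolding pos_part_T by blast

lemma gens_eT: "g \<in> generate (add_monoid T) pos_gens \<Longrightarrow> g \<in> carrier T \<and> eT g = \<zero>\<^bsub>A\<^esub>"
proof -
  interpret k: ideal "a_kernel T A eT" T
    by (rule ring_hom_ring.kernel_is_ideal[OF eT_ring_hom])
  have "pos_gens \<subseteq> a_kernel T A eT"
    unfolding pos_gens_def a_kernel_def' by (auto simp: eT_pure)
  then have "generate (add_monoid T) pos_gens \<subseteq> a_kernel T A eT"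
    by (intro group.generate_subgroup_incl[OF T.a_group]) (auto intro: k.a_subgroup)
  moreover assume "g \<in> generate (add_monoid T) pos_gens"
  ultimately show ?thesis unfolding a_kernel_def' by blast
qed

lemma eT_j: "x \<in> pos_part A \<Longrightarrow> eT (j1 x) = \<zero>\<^bsub>A\<^esub>" "x \<in> pos_part A \<Longrightarrow> eT (j2 x) = \<zero>\<^bsub>A\<^esub>"
  "c \<in> zero_part A \<Longrightarrow> eT (j1 c) = c"
  by (simp_all add: j1_def j2_def eT_pure)

lemma pos_T_add:
  assumes "s \<in> pos_part T" "t \<in> pos_part T"
  shows "s \<oplus>\<^bsub>T\<^esub> t \<in> pos_part T"
proof -
  obtain x y g where s: "x \<in> pos_part A" "y \<in> pos_part A" "g \<in> generate (add_monoid T) pos_gens"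
     "s = j2 x \<oplus>\<^bsub>T\<^esub> j1 y \<oplus>\<^bsub>T\<^esub> g"
    using assms(1) by (auto simp: pos_part_T)
  obtain x' y' g' where t: "x' \<in> pos_part A" "y' \<in> pos_part A" "g' \<in> generate (add_monoid T) pos_gens"
     "t = j2 x' \<oplus>\<^bsub>T\<^esub> j1 y' \<oplus>\<^bsub>T\<^esub> g'"
    using assms(2) by (auto simp: pos_part_T)
  have c: "g \<in> carrier T" "g' \<in> carrier T" using gens_eT s(3) t(3) by auto
  have gg: "g \<oplus>\<^bsub>T\<^esub> g' \<in> generate (add_monoid T) pos_gens"
    using subgroup.m_closed[OF gens_subgroup s(3) t(3)] by simp
  have "s \<oplus>\<^bsub>T\<^esub> t = (j2 x \<oplus>\<^bsub>T\<^esub> j2 x') \<oplus>\<^bsub>T\<^esub> (j1 y \<oplus>\<^bsub>T\<^esub> j1 y') \<oplus>\<^bsub>T\<^esub> (g \<oplus>\<^bsub>T\<^esub> g')"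
    unfolding s(4) t(4) using s(1,2) t(1,2) c by (intro T.add_three_three) auto
  also have "\<dots> = j2 (x \<oplus>\<^bsub>A\<^esub> x') \<oplus>\<^bsub>T\<^esub> j1 (y \<oplus>\<^bsub>A\<^esub> y') \<oplus>\<^bsub>T\<^esub> (g \<oplus>\<^bsub>T\<^esub> g')"
    using s(1,2) t(1,2) by simp
  also have "\<dots> \<in> pos_part T"
    using s(1,2) t(1,2) gg by (intro pos_part_TI) auto
  finally show ?thesis .
qed

lemma pure_decomposition:
  assumes "a \<in> carrier A" "b \<in> carrier A"
  shows "pt a b = j1 (deg_zero A a \<otimes>\<^bsub>A\<^esub> deg_zero A b) \<oplus>\<^bsub>T\<^esub>
    (j2 (deg_zero A a \<otimes>\<^bsub>A\<^esub> pos_of b) \<oplus>\<^bsub>T\<^esub> j1 (deg_zero A b \<otimes>\<^bsub>A\<^esub> pos_of a) \<oplus>\<^bsub>T\<^esub> pt (pos_of a) (pos_of b))"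
proof -
  have "pt a b = pt (deg_zero A a \<oplus>\<^bsub>A\<^esub> pos_of a) (deg_zero A b \<oplus>\<^bsub>A\<^esub> pos_of b)"
    using assms by (simp add: deg_pos_sum)
  also have "\<dots> = pt (deg_zero A a) (deg_zero A b) \<oplus>\<^bsub>T\<^esub>
     (pt (deg_zero A a) (pos_of b) \<oplus>\<^bsub>T\<^esub> pt (pos_of a) (deg_zero A b) \<oplus>\<^bsub>T\<^esub> pt (pos_of a) (pos_of b))"
    using assms by (simp add: pt_add_l pt_add_r T.a_ac del: j1.hom_mult j2.hom_mult)
  finally show ?thesis
    using assms by (simp add: pt_zero_part A.m_comm[of "deg_zero A b" "deg_zero A a"] del: j1.hom_mult j2.hom_mult)
qed

text \<open>Expanding both factors of a pure tensor into constant and positive parts leaves, besides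
  the constant term, one term of each of the three kinds that make up \<open>pos_part T\<close>.
  This is the source of the decomposition of T.\<close>

lemma minus_eT_pos: "t \<in> carrier T \<Longrightarrow> t \<ominus>\<^bsub>T\<^esub> j1 (eT t) \<in> pos_part T"
proof (induction t rule: T_induct)
  case zero
  have "\<zero>\<^bsub>T\<^esub> \<in> pos_part T"
    using pos_part_TI[of "\<zero>\<^bsub>A\<^esub>" "\<zero>\<^bsub>A\<^esub>" "\<zero>\<^bsub>T\<^esub>"] subgroup.one_closed[OF gens_subgroup] by simp
  then show ?case by (simp add: eT_zero T.minus_eq)
next
  case (pure a b)
  let ?r = "j2 (deg_zero A a \<otimes>\<^bsub>A\<^esub> pos_of b) \<oplus>\<^bsub>T\<^esub> j1 (deg_zero A b \<otimes>\<^bsub>A\<^esub> pos_of a) \<oplus>\<^bsub>T\<^esub> pt (pos_of a) (pos_of b)"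
  let ?e = "j1 (deg_zero A a \<otimes>\<^bsub>A\<^esub> deg_zero A b)"
  have "?e \<in> carrier T" "?r \<in> carrier T" using pure by auto
  then have "?e \<oplus>\<^bsub>T\<^esub> ?r \<ominus>\<^bsub>T\<^esub> ?e = ?r"
    by (rule T.add_minus_cancel)
  then have "pt a b \<ominus>\<^bsub>T\<^esub> j1 (eT (pt a b)) = ?r"
    unfolding eT_pure[OF pure] unfolding pure_decomposition[OF pure] .
  moreover have "?r \<in> pos_part T"
    using pure by (intro pos_part_TI generate.incl pos_gensI) (auto simp: pos.I_l_closed)
  ultimately show ?case by simp
next
  case (add s t)
  have "s \<oplus>\<^bsub>T\<^esub> t \<ominus>\<^bsub>T\<^esub> j1 (eT (s \<oplus>\<^bsub>T\<^esub> t)) = (s \<ominus>\<^bsub>T\<^esub> j1 (eT s)) \<oplus>\<^bsub>T\<^esub> (t \<ominus>\<^bsub>T\<^esub> j1 (eT t))"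
    using add by (simp add: T.minus_eq T.minus_add T.a_ac)
  then show ?case using add pos_T_add by simp
qed

lemma pos_T_iff: "t \<in> pos_part T \<longleftrightarrow> t \<in> carrier T \<and> eT t = \<zero>\<^bsub>A\<^esub>"
proof
  assume "t \<in> pos_part T"
  then show "t \<in> carrier T \<and> eT t = \<zero>\<^bsub>A\<^esub>"
    using gens_eT eT_j by (auto simp: pos_part_T)
next
  assume "t \<in> carrier T \<and> eT t = \<zero>\<^bsub>A\<^esub>"
  then show "t \<in> pos_part T" using minus_eT_pos[of t] by (simp add: T.minus_eq)
qed

lemma pos_T_ideal: "ideal (pos_part T) T"
proof -
  have "pos_part T = a_kernel T A eT"
    unfolding a_kernel_def' using pos_T_iff by blast
  then show ?thesis using ring_hom_ring.kernel_is_ideal[OF eT_ring_hom] by simp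
qed

sublocale Tp: ideal "pos_part (tensor_with K A q)" "tensor_with K A q"
  by (rule pos_T_ideal)

lemma pos_T_carrier [simp]: "t \<in> pos_part T \<Longrightarrow> t \<in> carrier T"
  by (rule Tp.Icarr)

lemma j_pos [simp]: "x \<in> pos_part A \<Longrightarrow> j1 x \<in> pos_part T" "x \<in> pos_part A \<Longrightarrow> j2 x \<in> pos_part T"
  "x \<in> pos_part A \<Longrightarrow> a \<in> carrier A \<Longrightarrow> pt x a \<in> pos_part T"
  "x \<in> pos_part A \<Longrightarrow> a \<in> carrier A \<Longrightarrow> pt a x \<in> pos_part T"
  by (auto simp: pos_T_iff eT_j eT_pure)

text \<open>Since the addition formula controls a p-map on sums, its properties can be tested on the
  three kinds of additive generators; negatives of generators are again generators of the same
  kind.\<close>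

lemma Tp_induct [consumes 1, case_names left right both add]:
  assumes "t \<in> pos_part T" 
    and 1: "\<And>x. x \<in> pos_part A \<Longrightarrow> P (j1 x)" and 2: "\<And>x. x \<in> pos_part A \<Longrightarrow> P (j2 x)"
    and 3: "\<And>x y. x \<in> pos_part A \<Longrightarrow> y \<in> pos_part A \<Longrightarrow> P (pt x y)"
    and add: "\<And>s t. s \<in> pos_part T \<Longrightarrow> t \<in> pos_part T \<Longrightarrow> P s \<Longrightarrow> P t \<Longrightarrow> P (s \<oplus>\<^bsub>T\<^esub> t)"
  shows "P t"
proof -
  have g: "g \<in> pos_part T \<and> P g" if "g \<in> generate (add_monoid T) pos_gens" for g
    using that
  proof (induction rule: generate.induct)
    case one
    then show ?case using 1[of "\<zero>\<^bsub>A\<^esub>"] by simp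
  next
    case (incl h)
    then show ?case using 3 by (auto simp: pos_gens_def)
  next
    case (inv h)
    then obtain x y where "x \<in> pos_part A" "y \<in> pos_part A" "h = pt x y" by (auto simp: pos_gens_def)
    then show ?case using 3[of "\<ominus>\<^bsub>A\<^esub> x" y] pt_neg[of x y] by (simp add: a_inv_def[symmetric])
  next
    case (eng g h)
    then show ?case using add[of g h] by simp
  qed
  obtain x y g where s: "x \<in> pos_part A" "y \<in> pos_part A" "g \<in> generate (add_monoid T) pos_gens"
     "t = j2 x \<oplus>\<^bsub>T\<^esub> j1 y \<oplus>\<^bsub>T\<^esub> g"
    using assms(1) by (auto simp: pos_part_T)
  then show ?thesis using 1 2 g add by simp
qed

end

section \<open>The p-map of \<open>A \<otimes> A\<close>\<close>

context pd_tensor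
begin

lemma pos_of_add:
  assumes "a \<in> carrier A" "b \<in> carrier A"
  shows "pos_of (a \<oplus>\<^bsub>A\<^esub> b) = pos_of a \<oplus>\<^bsub>A\<^esub> pos_of b"
  using assms by (simp add: pos_of_def deg_zero_add A.minus_eq A.minus_add A.a_ac)

lemma pos_of_scalar:
  assumes "c \<in> carrier K" "a \<in> carrier A"
  shows "pos_of (c \<odot>\<^bsub>A\<^esub> a) = c \<odot>\<^bsub>A\<^esub> pos_of a"
  using assms by (simp add: pos_of_def deg_zero_scalar) (simp add: A.minus_eq smult_eq_sc A.r_distr A.r_minus)

lemma pos_of_pos [simp]: "x \<in> pos_part A \<Longrightarrow> pos_of x = x"
  by (simp add: pos_of_def A.minus_eq)

lemma pos_of_zero_part [simp]: "c \<in> zero_part A \<Longrightarrow> pos_of c = \<zero>\<^bsub>A\<^esub>"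
  by (simp add: pos_of_def A.minus_eq A.r_neg)

lemma one_zero_part [simp]: "\<one>\<^bsub>A\<^esub> \<in> zero_part A"
  by (rule subringE(3)[OF zero_part_subring])

sublocale E: abelian_group "ext_group (tensor_with K A q) p"
  by (rule T.ext_group_abelian)

text \<open>A \<open>p\<close>-map on \<open>T\<^sub>+\<close> is the second component of an additive section of the extension
  \<open>ext_group T p\<close>, whose addition twists the second component by the cocycle \<open>\<Phi>\<close>.  On a pure
  tensor the section is prescribed by writing \<open>a = a\<^sub>0 + x\<close>, \<open>b = b\<^sub>0 + y\<close> and expanding.\<close>

definition sec1 where "sec1 x = (j1 x, j1 (pmap A x))"
definition sec2 where "sec2 x = (j2 x, j2 (pmap A x))"

text \<open>The last summand has second component 0 because \<open>x \<otimes> y\<close> is the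
  product of the positive elements \<open>x \<otimes> 1\<close> and \<open>1 \<otimes> y\<close>.
  Dropping the constant term makes the section defined on all of T, lying over the projection to
  \<open>pos_part T\<close>.\<close>

definition sec_pure where
  "sec_pure a b = sec1 (deg_zero A b \<otimes>\<^bsub>A\<^esub> pos_of a) \<oplus>\<^bsub>T.E\<^esub>
     sec2 (deg_zero A a \<otimes>\<^bsub>A\<^esub> pos_of b) \<oplus>\<^bsub>T.E\<^esub> (pt (pos_of a) (pos_of b), \<zero>\<^bsub>T\<^esub>)"

lemma sec_closed: "x \<in> pos_part A \<Longrightarrow> sec1 x \<in> carrier T.E" "x \<in> pos_part A \<Longrightarrow> sec2 x \<in> carrier T.E"
  by (simp_all add: sec1_def sec2_def)

lemma sec_add:
  assumes "x \<in> pos_part A" "y \<in> pos_part A"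
  shows "sec1 (x \<oplus>\<^bsub>A\<^esub> y) = sec1 x \<oplus>\<^bsub>T.E\<^esub> sec1 y" "sec2 (x \<oplus>\<^bsub>A\<^esub> y) = sec2 x \<oplus>\<^bsub>T.E\<^esub> sec2 y"
  using assms by (simp_all add: prod_eq_iff sec1_def sec2_def pmap_plus j_Phi)

lemma pos_mult [simp]: "c \<in> carrier A \<Longrightarrow> x \<in> pos_part A \<Longrightarrow> c \<otimes>\<^bsub>A\<^esub> x \<in> pos_part A"
  by (rule pos.I_l_closed)

lemma j_pow_p: "x \<in> pos_part A \<Longrightarrow> j1 x [^]\<^bsub>T\<^esub> p = \<zero>\<^bsub>T\<^esub>" "x \<in> pos_part A \<Longrightarrow> j2 x [^]\<^bsub>T\<^esub> p = \<zero>\<^bsub>T\<^esub>"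
  by (simp_all add: pos_part_pow flip: j_pow)

text \<open>Both tensors are multiples of \<open>1 \<otimes> y\<close>, whose p-th power is 0, so
  their cocycle vanishes.\<close>

lemma sec_pt_add_l:
  assumes "x \<in> pos_part A" "x' \<in> pos_part A" "y \<in> pos_part A"
  shows "(pt (x \<oplus>\<^bsub>A\<^esub> x') y, \<zero>\<^bsub>T\<^esub>) = (pt x y, \<zero>\<^bsub>T\<^esub>) \<oplus>\<^bsub>T.E\<^esub> (pt x' y, \<zero>\<^bsub>T\<^esub>)"
  using assms j_pow_p T.Phi_proportional[of "j1 x" "j1 x'" "j2 y"]
  by (simp add: prod_eq_iff pt_add_l pt_eq del: pt_eq) (simp add: pt_eq)

lemma sec_pt_add_r:
  assumes "x \<in> pos_part A" "y \<in> pos_part A" "y' \<in> pos_part A"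
  shows "(pt x (y \<oplus>\<^bsub>A\<^esub> y'), \<zero>\<^bsub>T\<^esub>) = (pt x y, \<zero>\<^bsub>T\<^esub>) \<oplus>\<^bsub>T.E\<^esub> (pt x y', \<zero>\<^bsub>T\<^esub>)"
  using assms j_pow_p T.Phi_proportional[of "j2 y" "j2 y'" "j1 x"]
  by (simp add: prod_eq_iff pt_add_r) (simp add: pt_eq T.m_comm)

lemma sec_pure_closed: "a \<in> carrier A \<Longrightarrow> b \<in> carrier A \<Longrightarrow> sec_pure a b \<in> carrier T.E"
  unfolding sec_pure_def by (intro E.a_closed sec_closed) auto

lemma sec_pure_add_l:
  assumes "a \<in> carrier A" "a' \<in> carrier A" "b \<in> carrier A"
  shows "sec_pure (a \<oplus>\<^bsub>A\<^esub> a') b = sec_pure a b \<oplus>\<^bsub>T.E\<^esub> sec_pure a' b"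
proof -
  note c = sec_closed
  have "sec_pure (a \<oplus>\<^bsub>A\<^esub> a') b =
    (sec1 (deg_zero A b \<otimes>\<^bsub>A\<^esub> pos_of a) \<oplus>\<^bsub>T.E\<^esub> sec1 (deg_zero A b \<otimes>\<^bsub>A\<^esub> pos_of a')) \<oplus>\<^bsub>T.E\<^esub>
    (sec2 (deg_zero A a \<otimes>\<^bsub>A\<^esub> pos_of b) \<oplus>\<^bsub>T.E\<^esub> sec2 (deg_zero A a' \<otimes>\<^bsub>A\<^esub> pos_of b)) \<oplus>\<^bsub>T.E\<^esub>
    ((pt (pos_of a) (pos_of b), \<zero>\<^bsub>T\<^esub>) \<oplus>\<^bsub>T.E\<^esub> (pt (pos_of a') (pos_of b), \<zero>\<^bsub>T\<^esub>))"
    using assms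
    by (simp add: sec_pure_def pos_of_add deg_zero_add A.l_distr A.r_distr sec_add sec_pt_add_l)
  also have "\<dots> = sec_pure a b \<oplus>\<^bsub>T.E\<^esub> sec_pure a' b"
    unfolding sec_pure_def using assms
    by (intro E.add_three_three[symmetric] sec_closed) auto
  finally show ?thesis .
qed

lemma sec_pure_add_r:
  assumes "a \<in> carrier A" "b \<in> carrier A" "b' \<in> carrier A"
  shows "sec_pure a (b \<oplus>\<^bsub>A\<^esub> b') = sec_pure a b \<oplus>\<^bsub>T.E\<^esub> sec_pure a b'"
proof -
  have "sec_pure a (b \<oplus>\<^bsub>A\<^esub> b') =
    (sec1 (deg_zero A b \<otimes>\<^bsub>A\<^esub> pos_of a) \<oplus>\<^bsub>T.E\<^esub> sec1 (deg_zero A b' \<otimes>\<^bsub>A\<^esub> pos_of a)) \<oplus>\<^bsub>T.E\<^esub>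
    (sec2 (deg_zero A a \<otimes>\<^bsub>A\<^esub> pos_of b) \<oplus>\<^bsub>T.E\<^esub> sec2 (deg_zero A a \<otimes>\<^bsub>A\<^esub> pos_of b')) \<oplus>\<^bsub>T.E\<^esub>
    ((pt (pos_of a) (pos_of b), \<zero>\<^bsub>T\<^esub>) \<oplus>\<^bsub>T.E\<^esub> (pt (pos_of a) (pos_of b'), \<zero>\<^bsub>T\<^esub>))"
    using assms
    by (simp add: sec_pure_def pos_of_add deg_zero_add A.l_distr A.r_distr sec_add sec_pt_add_r)
  also have "\<dots> = sec_pure a b \<oplus>\<^bsub>T.E\<^esub> sec_pure a b'"
    unfolding sec_pure_def using assms
    by (intro E.add_three_three[symmetric] sec_closed) auto
  finally show ?thesis .
qed

lemma smult_zero_part [simp]: "c \<in> carrier K \<Longrightarrow> b \<in> zero_part A \<Longrightarrow> c \<odot>\<^bsub>A\<^esub> b \<in> zero_part A"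
  by (rule zero_part_smult)

lemma sec_pure_scalar:
  assumes c: "c \<in> carrier K" "a \<in> carrier A" "b \<in> carrier A"
  shows "sec_pure (c \<odot>\<^bsub>A\<^esub> a) b = sec_pure a (c \<odot>\<^bsub>A\<^esub> b)"
proof -
  have *: "x \<otimes>\<^bsub>A\<^esub> (c \<odot>\<^bsub>A\<^esub> y) = (c \<odot>\<^bsub>A\<^esub> x) \<otimes>\<^bsub>A\<^esub> y" if "x \<in> carrier A" "y \<in> carrier A" for x y
    using that c by (simp add: smult_eq_sc A.m_ac)
  show ?thesis
    using c by (simp add: sec_pure_def pos_of_scalar deg_zero_scalar * pt_smult)
qed

definition sec where "sec = tensor_lift T.E sec_pure"

lemma sec_T_closed: "t \<in> carrier T \<Longrightarrow> sec t \<in> carrier T.E"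
  and sec_T_add: "s \<in> carrier T \<Longrightarrow> t \<in> carrier T \<Longrightarrow> sec (s \<oplus>\<^bsub>T\<^esub> t) = sec s \<oplus>\<^bsub>T.E\<^esub> sec t"
  and sec_pt: "a \<in> carrier A \<Longrightarrow> b \<in> carrier A \<Longrightarrow> sec (pt a b) = sec_pure a b"
  unfolding sec_def
  by (rule lift_properties[OF E.abelian_group_axioms sec_pure_closed sec_pure_add_l sec_pure_add_r sec_pure_scalar];
      assumption)+

lemma fst_sec:
  assumes "t \<in> carrier T"
  shows "fst (sec t) = t \<ominus>\<^bsub>T\<^esub> j1 (eT t)"
  using assms
proof (induction t rule: T_induct)
  case zero
  have "sec (pt \<zero>\<^bsub>A\<^esub> \<zero>\<^bsub>A\<^esub>) = sec_pure \<zero>\<^bsub>A\<^esub> \<zero>\<^bsub>A\<^esub>" by (rule sec_pt) auto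
  then show ?case
    by (simp add: sec_pure_def sec1_def sec2_def eT_zero T.minus_eq)
next
  case (pure a b)
  let ?r = "j2 (deg_zero A a \<otimes>\<^bsub>A\<^esub> pos_of b) \<oplus>\<^bsub>T\<^esub> j1 (deg_zero A b \<otimes>\<^bsub>A\<^esub> pos_of a) \<oplus>\<^bsub>T\<^esub> pt (pos_of a) (pos_of b)"
  have "fst (sec (pt a b)) = ?r"
    unfolding sec_pt[OF pure] sec_pure_def using pure
    by (simp add: sec1_def sec2_def T.a_comm del: j1.hom_mult j2.hom_mult)
  also have "\<dots> = pt a b \<ominus>\<^bsub>T\<^esub> j1 (eT (pt a b))"
    unfolding eT_pure[OF pure] unfolding pure_decomposition[OF pure]
    using pure by (intro T.add_minus_cancel[symmetric]) auto
  finally show ?case .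
next
  case (add s t)
  have "fst (sec (s \<oplus>\<^bsub>T\<^esub> t)) = (s \<ominus>\<^bsub>T\<^esub> j1 (eT s)) \<oplus>\<^bsub>T\<^esub> (t \<ominus>\<^bsub>T\<^esub> j1 (eT t))"
    using add by (simp add: sec_T_add)
  also have "\<dots> = s \<oplus>\<^bsub>T\<^esub> t \<ominus>\<^bsub>T\<^esub> j1 (eT (s \<oplus>\<^bsub>T\<^esub> t))"
    using add by (simp add: T.minus_eq T.minus_add T.a_ac)
  finally show ?case .
qed

lemma eT_pos: "t \<in> pos_part T \<Longrightarrow> eT t = \<zero>\<^bsub>A\<^esub>"
  using pos_T_iff by blast

lemma fst_sec_pos: "t \<in> pos_part T \<Longrightarrow> fst (sec t) = t"
  by (simp add: fst_sec eT_pos T.minus_eq)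

text \<open>The restriction to \<open>pos_part T\<close> meets the extensionality clause of
  \<open>tensor_pmap\<close>.\<close>

definition qT where "qT = (\<lambda>t\<in>pos_part T. snd (sec t))"

lemma qT_add:
  assumes "s \<in> pos_part T" "t \<in> pos_part T"
  shows "qT (s \<oplus>\<^bsub>T\<^esub> t) = qT s \<oplus>\<^bsub>T\<^esub> qT t \<oplus>\<^bsub>T\<^esub> T.Phi s t"
  using assms by (simp add: qT_def sec_T_add fst_sec_pos)

lemma qT_j:
  assumes "x \<in> pos_part A"
  shows "qT (j1 x) = j1 (pmap A x)" "qT (j2 x) = j2 (pmap A x)"
proof -
  have "sec (j1 x) = sec_pure x \<one>\<^bsub>A\<^esub>" "sec (j2 x) = sec_pure \<one>\<^bsub>A\<^esub> x"
    unfolding j1_def j2_def using assms by (auto intro!: sec_pt)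
  then show "qT (j1 x) = j1 (pmap A x)" "qT (j2 x) = j2 (pmap A x)"
    using assms by (simp_all add: qT_def sec_pure_def sec1_def sec2_def pmap_zero)
qed

lemma qT_pt: "x \<in> pos_part A \<Longrightarrow> y \<in> pos_part A \<Longrightarrow> qT (pt x y) = \<zero>\<^bsub>T\<^esub>"
  by (simp add: qT_def sec_pt sec_pure_def sec1_def sec2_def pmap_zero)

lemma qT_closed: "t \<in> pos_part T \<Longrightarrow> qT t \<in> pos_part T"
  by (induction t rule: Tp_induct)
     (auto simp: qT_j qT_pt qT_add pmap_closed intro!: T.Phi_in_ideal[OF pos_T_ideal])

lemma qT_carrier [simp]: "t \<in> pos_part T \<Longrightarrow> qT t \<in> carrier T"
  by (simp add: qT_closed)

lemma pos_T_pow: "t \<in> pos_part T \<Longrightarrow> t [^]\<^bsub>T\<^esub> p = \<zero>\<^bsub>T\<^esub>"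
proof (induction t rule: Tp_induct)
  case (both x y)
  then show ?case by (simp add: pt_eq T.nat_pow_distrib j_pow_p)
next
  case (add s t)
  then show ?case by (simp add: T.frobenius_add)
qed (auto simp: j_pow_p)

text \<open>The two products are multiples of \<open>u\<close>, so no cocycle term appears.
  Vanishing on products can therefore be tested on generators, in each factor separately.\<close>

lemma qT_mult_add:
  assumes "s \<in> pos_part T" "t \<in> pos_part T" "u \<in> pos_part T"
    "qT (s \<otimes>\<^bsub>T\<^esub> u) = \<zero>\<^bsub>T\<^esub>" "qT (t \<otimes>\<^bsub>T\<^esub> u) = \<zero>\<^bsub>T\<^esub>"
  shows "qT ((s \<oplus>\<^bsub>T\<^esub> t) \<otimes>\<^bsub>T\<^esub> u) = \<zero>\<^bsub>T\<^esub>"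
  using assms
  by (simp add: T.l_distr qT_add Tp.I_l_closed T.Phi_proportional pos_T_pow)

lemma pt_mult_j:
  "a \<in> carrier A \<Longrightarrow> b \<in> carrier A \<Longrightarrow> c \<in> carrier A \<Longrightarrow> j1 c \<otimes>\<^bsub>T\<^esub> pt a b = pt (c \<otimes>\<^bsub>A\<^esub> a) b"
  "a \<in> carrier A \<Longrightarrow> b \<in> carrier A \<Longrightarrow> c \<in> carrier A \<Longrightarrow> j2 c \<otimes>\<^bsub>T\<^esub> pt a b = pt a (c \<otimes>\<^bsub>A\<^esub> b)"
  "a \<in> carrier A \<Longrightarrow> b \<in> carrier A \<Longrightarrow> j1 a \<otimes>\<^bsub>T\<^esub> j2 b = pt a b"
  "a \<in> carrier A \<Longrightarrow> b \<in> carrier A \<Longrightarrow> j1 a \<otimes>\<^bsub>T\<^esub> j1 b = j1 (a \<otimes>\<^bsub>A\<^esub> b)"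
  "a \<in> carrier A \<Longrightarrow> b \<in> carrier A \<Longrightarrow> j2 a \<otimes>\<^bsub>T\<^esub> j2 b = j2 (a \<otimes>\<^bsub>A\<^esub> b)"
  by (simp_all add: j1_def j2_def pt_mult)

lemma qT_mult_gens:
  assumes "x \<in> pos_part A" "y \<in> pos_part A" "u \<in> pos_part T"
  shows "qT (j1 x \<otimes>\<^bsub>T\<^esub> u) = \<zero>\<^bsub>T\<^esub>" "qT (j2 x \<otimes>\<^bsub>T\<^esub> u) = \<zero>\<^bsub>T\<^esub>"
    "qT (pt x y \<otimes>\<^bsub>T\<^esub> u) = \<zero>\<^bsub>T\<^esub>"
proof -
  note [simp del] = j1.hom_mult j2.hom_mult
  note [simp] = pt_mult_j qT_pt qT_j pmap_mult assms(1,2)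
  have c0: "j2 b \<otimes>\<^bsub>T\<^esub> j1 a = pt a b" if "a \<in> carrier A" "b \<in> carrier A" for a b
    using that by (simp add: T.m_comm[of "j2 b" "j1 a"])
  have c1: "pt a b \<otimes>\<^bsub>T\<^esub> j1 c = pt (c \<otimes>\<^bsub>A\<^esub> a) b" "pt a b \<otimes>\<^bsub>T\<^esub> j2 c = pt a (c \<otimes>\<^bsub>A\<^esub> b)"
    if "a \<in> carrier A" "b \<in> carrier A" "c \<in> carrier A" for a b c
    using that by (simp_all add: T.m_comm[of "pt a b" "j1 c"] T.m_comm[of "pt a b" "j2 c"])
  note c = c0 c1
  have comm: "qT (s \<otimes>\<^bsub>T\<^esub> (t \<oplus>\<^bsub>T\<^esub> t')) = \<zero>\<^bsub>T\<^esub>"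
    if "s \<in> pos_part T" "t \<in> pos_part T" "t' \<in> pos_part T"
      "qT (s \<otimes>\<^bsub>T\<^esub> t) = \<zero>\<^bsub>T\<^esub>" "qT (s \<otimes>\<^bsub>T\<^esub> t') = \<zero>\<^bsub>T\<^esub>" for s t t'
    using qT_mult_add[of t t' s] that by (simp add: T.m_comm)
  show "qT (j1 x \<otimes>\<^bsub>T\<^esub> u) = \<zero>\<^bsub>T\<^esub>"
    using assms(3) by (induction u rule: Tp_induct) (simp_all add: comm)
  show "qT (j2 x \<otimes>\<^bsub>T\<^esub> u) = \<zero>\<^bsub>T\<^esub>"
    using assms(3) by (induction u rule: Tp_induct) (simp_all add: comm c)
  show "qT (pt x y \<otimes>\<^bsub>T\<^esub> u) = \<zero>\<^bsub>T\<^esub>"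
    using assms(3) by (induction u rule: Tp_induct) (simp_all add: comm c pt_mult)
qed

lemma qT_mult:
  assumes "t \<in> pos_part T" "u \<in> pos_part T"
  shows "qT (t \<otimes>\<^bsub>T\<^esub> u) = \<zero>\<^bsub>T\<^esub>"
  using assms(1)
  by (induction t rule: Tp_induct) (use assms(2) in \<open>simp_all add: qT_mult_gens qT_mult_add\<close>)

lemma qT_scale:
  assumes c: "c \<in> zero_part A" and t: "t \<in> pos_part T"
  shows "qT (j1 c \<otimes>\<^bsub>T\<^esub> t) = j1 c [^]\<^bsub>T\<^esub> p \<otimes>\<^bsub>T\<^esub> qT t"
  using t
proof (induction t rule: Tp_induct)
  case (left x)
  have cc: "c \<in> carrier A" using c by simp
  have "qT (j1 c \<otimes>\<^bsub>T\<^esub> j1 x) = j1 (pmap A (c \<otimes>\<^bsub>A\<^esub> x))"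
    using cc left by (simp only: pt_mult_j pos_carrier qT_j pos_mult)
  also have "\<dots> = j1 (c [^]\<^bsub>A\<^esub> p) \<otimes>\<^bsub>T\<^esub> j1 (pmap A x)"
    using c cc left by (simp only: pmap_scale j1.hom_mult A.nat_pow_closed pmap_carrier)
  finally show ?case using cc left by (simp only: j_pow qT_j)
next
  case (right x)
  have cc: "c \<in> carrier A" using c by simp
  \<comment> \<open>On \<open>1 \<otimes> x\<close> the constant is placed in the right factor,
    where the axiom for A applies; constants have the same image under \<open>j1\<close> and
    \<open>j2\<close>.\<close>
  have "qT (j2 c \<otimes>\<^bsub>T\<^esub> j2 x) = j2 (pmap A (c \<otimes>\<^bsub>A\<^esub> x))"
    using cc right by (simp only: pt_mult_j pos_carrier qT_j pos_mult)
  also have "\<dots> = j2 (c [^]\<^bsub>A\<^esub> p) \<otimes>\<^bsub>T\<^esub> j2 (pmap A x)"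
    using c cc right by (simp only: pmap_scale j2.hom_mult A.nat_pow_closed pmap_carrier)
  also have "\<dots> = j2 c [^]\<^bsub>T\<^esub> p \<otimes>\<^bsub>T\<^esub> qT (j2 x)"
    using cc right by (simp only: j_pow qT_j)
  finally show ?case by (simp only: j_zero_part[OF c])
next
  case (both x y)
  then show ?case using c by (simp add: pt_mult_j qT_pt del: j1.hom_mult)
next
  case (add s t)
  then show ?case using c
    by (simp add: T.r_distr qT_add Tp.I_l_closed T.Phi_scale)
qed

lemma zero_part_T: "zero_part T = j1 ` zero_part A"
proof -
  have z: "(\<lambda>c. c \<odot>\<^bsub>A\<^esub> \<one>\<^bsub>A\<^esub>) ` carrier K = zero_part A"
    by (simp add: zero_part_sc sc_def image_def)
  have "zero_part T = {pt c c' |c c'. c \<in> zero_part A \<and> c' \<in> zero_part A}"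
    unfolding tensor_with_def Let_def z by simp
  also have "\<dots> = j1 ` zero_part A"
  proof (intro equalityI subsetI)
    fix t assume "t \<in> {pt c c' |c c'. c \<in> zero_part A \<and> c' \<in> zero_part A}"
    then obtain c c' where "c \<in> zero_part A" "c' \<in> zero_part A" "t = pt c c'" by blast
    then show "t \<in> j1 ` zero_part A"
      by (intro image_eqI[of _ _ "c' \<otimes>\<^bsub>A\<^esub> c"])
         (simp_all add: pt_zero_part(1) subringE(6)[OF zero_part_subring] del: j1.hom_mult)
  next
    fix t assume "t \<in> j1 ` zero_part A"
    then show "t \<in> {pt c c' |c c'. c \<in> zero_part A \<and> c' \<in> zero_part A}"
      unfolding j1_def using one_zero_part by blast
  qed
  finally show ?thesis .
qed

lemma zero_part_T_subring: "subring (zero_part T) T"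
proof -
  have "ring_hom_ring A T j1"
    by (rule ring_hom_ringI2[OF A.ring_axioms T.ring_axioms j1.homh])
  then show ?thesis
    unfolding zero_part_T by (rule ring_hom_ring.img_is_subring[OF _ zero_part_subring])
qed

lemma pdCom_T_axioms:
  assumes q: "\<And>t. t \<in> pos_part T \<Longrightarrow> q t = qT t"
  shows "pdCom K T p"
proof (intro pdCom.intro pdCom_axioms.intro T_algebra zero_part_T_subring pos_T_ideal)
  have pm: "pmap T t = qT t" if "t \<in> pos_part T" for t
    using q[OF that] by (simp add: tensor_with_def Let_def)
  show "c \<odot>\<^bsub>T\<^esub> t \<in> zero_part T" if "c \<in> carrier K" "t \<in> zero_part T" for c t
    using that subringE(6)[OF zero_part_T_subring] by (auto simp: T_smult zero_part_T)
  show "zero_part T <+>\<^bsub>T\<^esub> pos_part T = carrier T"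
  proof (intro equalityI subsetI)
    fix t assume "t \<in> zero_part T <+>\<^bsub>T\<^esub> pos_part T"
    then show "t \<in> carrier T" unfolding set_add_def' zero_part_T by auto
  next
    fix t assume t: "t \<in> carrier T"
    then have "t = j1 (eT t) \<oplus>\<^bsub>T\<^esub> (t \<ominus>\<^bsub>T\<^esub> j1 (eT t))"
      by (simp add: T.minus_eq T.a_lcomm T.r_neg)
    moreover have "j1 (eT t) \<in> zero_part T" "t \<ominus>\<^bsub>T\<^esub> j1 (eT t) \<in> pos_part T"
      using t eT_zero_part minus_eT_pos by (auto simp: zero_part_T)
    ultimately show "t \<in> zero_part T <+>\<^bsub>T\<^esub> pos_part T"
      unfolding set_add_def' by blast
  qed
  show "zero_part T \<inter> pos_part T = {\<zero>\<^bsub>T\<^esub>}"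
  proof -
    have "t = \<zero>\<^bsub>T\<^esub>" if "t \<in> zero_part T" "t \<in> pos_part T" for t
      using that eT_pos[OF that(2)] by (auto simp: zero_part_T eT_j)
    moreover have "\<zero>\<^bsub>T\<^esub> \<in> zero_part T" by (rule subringE(2)[OF zero_part_T_subring])
    ultimately show ?thesis using Tp.zero_closed by blast
  qed
  show "pmap T t \<in> pos_part T" if "t \<in> pos_part T" for t
    using that by (simp add: pm qT_closed)
  show "t [^]\<^bsub>T\<^esub> p = \<zero>\<^bsub>T\<^esub>" if "t \<in> pos_part T" for t
    using that by (rule pos_T_pow)
  show "pmap T (s \<oplus>\<^bsub>T\<^esub> t) = pmap T s \<oplus>\<^bsub>T\<^esub> pmap T t \<oplus>\<^bsub>T\<^esub>
          (\<Oplus>\<^bsub>T\<^esub>j\<in>{1..p-1}.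
            ((\<ominus>\<^bsub>K\<^esub> \<one>\<^bsub>K\<^esub>) [^]\<^bsub>K\<^esub> j \<otimes>\<^bsub>K\<^esub> inv\<^bsub>K\<^esub> (add_pow K j \<one>\<^bsub>K\<^esub>))
              \<odot>\<^bsub>T\<^esub> (s [^]\<^bsub>T\<^esub> j \<otimes>\<^bsub>T\<^esub> t [^]\<^bsub>T\<^esub> (p - j)))" if "s \<in> pos_part T" "t \<in> pos_part T" for s t
    using that TK.Phi_scalars[of s t] by (simp add: pm qT_add)
  show "pmap T (s \<otimes>\<^bsub>T\<^esub> t) = \<zero>\<^bsub>T\<^esub>" if "s \<in> pos_part T" "t \<in> pos_part T" for s t
    using that by (simp add: pm qT_mult Tp.I_l_closed)
  show "pmap T (a \<otimes>\<^bsub>T\<^esub> t) = a [^]\<^bsub>T\<^esub> p \<otimes>\<^bsub>T\<^esub> pmap T t" if "a \<in> zero_part T" "t \<in> pos_part T" for a t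
    using that by (auto simp: zero_part_T pm qT_scale Tp.I_l_closed)
qed

text \<open>On \<open>x \<otimes> 1\<close> and \<open>1 \<otimes> y\<close> the value is
  prescribed, on their products the axioms force 0, and the addition formula determines the
  rest.\<close>

lemma qT_unique:
  assumes pd: "pdCom K T p"
    and q: "\<And>x. x \<in> pos_part A \<Longrightarrow> q (pt x \<one>\<^bsub>A\<^esub>) = pt (pmap A x) \<one>\<^bsub>A\<^esub>"
      "\<And>x. x \<in> pos_part A \<Longrightarrow> q (pt \<one>\<^bsub>A\<^esub> x) = pt \<one>\<^bsub>A\<^esub> (pmap A x)"
    and t: "t \<in> pos_part T"
  shows "q t = qT t"
proof -
  interpret TP: pd_char K T p
    using pd field_K prime_p char_K by (intro pd_char.intro)
  have pm: "pmap T t = q t" for t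
    by (simp add: tensor_with_def Let_def)
  show ?thesis using t
  proof (induction t rule: Tp_induct)
    case (left x)
    then show ?case by (simp add: qT_j) (simp add: j1_def q)
  next
    case (right x)
    then show ?case by (simp add: qT_j) (simp add: j2_def q)
  next
    case (both x y)
    then show ?case
      using TP.pmap_mult[of "j1 x" "j2 y"] by (simp add: qT_pt pm pt_mult_j)
  next
    case (add s t)
    then show ?case using TP.pmap_plus[of s t] by (simp add: qT_add pm)
  qed
qed

end

lemma pd_cocycle_tensor_with:
  "pd_cocycle (tensor_with K A q) p = pd_cocycle (tensor_with K A q') p"
  by (simp add: pd_cocycle_def[abs_def] finsum_def a_inv_def add_pow_def nat_pow_def m_inv_def
       tensor_with_def Let_def)

lemma ext_group_tensor_with:
  "ext_group (tensor_with K A q) p = ext_group (tensor_with K A q') p"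
  unfolding ext_group_def pd_cocycle_tensor_with[of K A q p q'] by (simp add: tensor_with_def Let_def)

lemma pos_part_tensor_with: "pos_part (tensor_with K A q) = pos_part (tensor_with K A q')"
  by (simp add: tensor_with_def Let_def)

lemma zero_tensor_with: "\<zero>\<^bsub>tensor_with K A q\<^esub> = \<zero>\<^bsub>tensor_with K A q'\<^esub>"
  by (simp add: tensor_with_def Let_def)

locale pd_aug = pd_char K A p
  for K :: "('k, 'e) ring_scheme" (structure)
    and A :: "('k, 'a, 'z) pd_alg_scheme" (structure)
    and p :: nat +
  assumes zero_part_sc: "zero_part A = sc ` carrier K" and sc_inj: "inj_on sc (carrier K)"
begin

lemma pd_tensor: "pd_tensor K A p"
  by unfold_locales (rule zero_part_sc)

text \<open>The construction reads only fields of \<open>tensor_with K A q\<close> other than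
  \<open>pmap\<close>. This breaks the circle in \<open>tensor_pmap\<close>, where the unknown map
  is part of the record whose axioms it has to satisfy.\<close>

lemma qT_indep: "pd_tensor.qT K A p q = pd_tensor.qT K A p q'"
proof -
  interpret a: pd_tensor K A p q by (rule pd_tensor)
  interpret b: pd_tensor K A p q' by (rule pd_tensor)
  show ?thesis
    unfolding a.qT_def b.qT_def a.sec_def b.sec_def a.sec_pure_def[abs_def] b.sec_pure_def[abs_def]
      a.sec1_def[abs_def] b.sec1_def[abs_def] a.sec2_def[abs_def] b.sec2_def[abs_def]
      a.j1_def[abs_def] b.j1_def[abs_def] a.j2_def[abs_def] b.j2_def[abs_def]
      pos_part_tensor_with[of K A q q'] ext_group_tensor_with[of K A q p q'] zero_tensor_with[of K A q q']
    by (rule refl)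
qed

lemma tensor_pmap_properties:
  "pdCom K (tensor_square K p A) p"
  "\<And>x. x \<in> pos_part A \<Longrightarrow> tensor_pmap K p A (pure_tensor K A x \<one>\<^bsub>A\<^esub>) = pure_tensor K A (pmap A x) \<one>\<^bsub>A\<^esub>"
  "\<And>x. x \<in> pos_part A \<Longrightarrow> tensor_pmap K p A (pure_tensor K A \<one>\<^bsub>A\<^esub> x) = pure_tensor K A \<one>\<^bsub>A\<^esub> (pmap A x)"
proof -
  define q0 where "q0 = pd_tensor.qT K A p undefined"
  let ?P = "\<lambda>q. q \<in> extensional (pos_part (tensor_with K A q)) \<and>
     pdCom K (tensor_with K A q) p \<and>
     (\<forall>a\<in>pos_part A.
        q (pure_tensor K A a \<one>\<^bsub>A\<^esub>) = pure_tensor K A (pmap A a) \<one>\<^bsub>A\<^esub> \<and>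
        q (pure_tensor K A \<one>\<^bsub>A\<^esub> a) = pure_tensor K A \<one>\<^bsub>A\<^esub> (pmap A a))"
  \<comment> \<open>Every candidate yields the same map. Taking \<open>q0\<close> itself as the
    candidate gives existence; taking any solution as the candidate gives uniqueness.\<close>
  have q0: "q0 = pd_tensor.qT K A p q" for q
    unfolding q0_def by (rule qT_indep)
  have P0: "?P q0"
  proof -
    interpret a: pd_tensor K A p q0 by (rule pd_tensor)
    have e: "q0 = a.qT" by (rule q0)
    have "q0 \<in> extensional (pos_part a.T)"
      by (subst e) (simp add: a.qT_def)
    moreover have "pdCom K a.T p"
      by (rule a.pdCom_T_axioms) (simp add: e[symmetric])
    moreover have "q0 (pure_tensor K A x \<one>\<^bsub>A\<^esub>) = pure_tensor K A (pmap A x) \<one>\<^bsub>A\<^esub>"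
      "q0 (pure_tensor K A \<one>\<^bsub>A\<^esub> x) = pure_tensor K A \<one>\<^bsub>A\<^esub> (pmap A x)" if "x \<in> pos_part A" for x
      using a.qT_j[OF that] unfolding e[symmetric] a.j1_def a.j2_def by auto
    ultimately show ?thesis by blast
  qed
  have uniq: "q = q0" if "?P q" for q
  proof (rule extensionalityI)
    interpret a: pd_tensor K A p q by (rule pd_tensor)
    show "q \<in> extensional (pos_part a.T)" using that by blast
    show "q0 \<in> extensional (pos_part a.T)"
      unfolding q0[of q] by (simp add: a.qT_def)
    show "q t = q0 t" if "t \<in> pos_part a.T" for t
      unfolding q0[of q] using that \<open>?P q\<close> by (intro a.qT_unique) auto
  qed
  have "tensor_pmap K p A = q0"
    unfolding tensor_pmap_def using P0 uniq by (rule the_equality)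
  then show "pdCom K (tensor_square K p A) p"
    "\<And>x. x \<in> pos_part A \<Longrightarrow> tensor_pmap K p A (pure_tensor K A x \<one>\<^bsub>A\<^esub>) = pure_tensor K A (pmap A x) \<one>\<^bsub>A\<^esub>"
    "\<And>x. x \<in> pos_part A \<Longrightarrow> tensor_pmap K p A (pure_tensor K A \<one>\<^bsub>A\<^esub> x) = pure_tensor K A \<one>\<^bsub>A\<^esub> (pmap A x)"
    using P0 by (auto simp: tensor_square_def)
qed

end

section \<open>The universal property of the differentials\<close>

text \<open>The product is expanded around \<open>(x, y)\<close> with its second-order term kept
  apart, in preparation for the reduction modulo \<open>I^2\<close>.\<close>

lemma (in cring) leibniz_identity:
  assumes "x \<in> carrier R" "y \<in> carrier R" "u \<in> carrier R" "v \<in> carrier R"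
  shows "u \<otimes> v \<ominus> x \<otimes> y = x \<otimes> (v \<ominus> y) \<oplus> y \<otimes> (u \<ominus> x) \<oplus> (u \<ominus> x) \<otimes> (v \<ominus> y)"
proof -
  have 1: "(x \<oplus> e) \<otimes> (y \<oplus> f) \<ominus> x \<otimes> y = x \<otimes> f \<oplus> y \<otimes> e \<oplus> e \<otimes> f"
    if "e \<in> carrier R" "f \<in> carrier R" for e f
  proof -
    have "(x \<oplus> e) \<otimes> (y \<oplus> f) = x \<otimes> y \<oplus> (x \<otimes> f \<oplus> y \<otimes> e \<oplus> e \<otimes> f)"
      using assms that by (simp add: l_distr r_distr m_comm[of e y] a_ac)
    then show ?thesis using assms that by (simp add: add_minus_cancel)
  qed
  have 2: "x \<oplus> (u \<ominus> x) = u" "y \<oplus> (v \<ominus> y) = v"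
    using assms by (simp_all add: minus_eq a_lcomm r_neg)
  show ?thesis using 1[of "u \<ominus> x" "v \<ominus> y"] assms by (simp add: 2)
qed

section \<open>The kernel I of multiplication\<close>

context pd_aug
begin

sublocale pd_tensor K A p "tensor_pmap K p A"
  by (rule pd_tensor)

lemma tensor_square: "tensor_square K p A = T"
  by (simp add: tensor_square_def)

sublocale TP: pd_char K "tensor_with K A (tensor_pmap K p A)" p
  using tensor_pmap_properties(1) field_K prime_p char_K
  by (intro pd_char.intro) (auto simp: tensor_square)

abbreviation piT where "piT \<equiv> tensor_pmap K p A"

lemma pmap_T: "pmap T t = piT t"
  by (simp add: tensor_with_def Let_def)

lemmas piT_plus = TP.pmap_plus[unfolded pmap_T]
  and piT_mult = TP.pmap_mult[unfolded pmap_T]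
  and piT_scale = TP.pmap_scale'[unfolded pmap_T]
  and piT_neg = TP.pmap_neg[unfolded pmap_T]
  and piT_closed [simp] = TP.pmap_closed[unfolded pmap_T]

lemma piT_carrier [simp]: "t \<in> pos_part T \<Longrightarrow> piT t \<in> carrier T"
  using pos_T_carrier piT_closed by blast

lemma piT_j: "x \<in> pos_part A \<Longrightarrow> piT (j1 x) = j1 (pmap A x)" "x \<in> pos_part A \<Longrightarrow> piT (j2 x) = j2 (pmap A x)"
  using tensor_pmap_properties by (auto simp: j1_def j2_def)

abbreviation mu where "mu \<equiv> mult_map A"

lemma mu_scalar: "c \<in> carrier K \<Longrightarrow> a \<in> carrier A \<Longrightarrow> b \<in> carrier A \<Longrightarrow>
    (c \<odot>\<^bsub>A\<^esub> a) \<otimes>\<^bsub>A\<^esub> b = a \<otimes>\<^bsub>A\<^esub> (c \<odot>\<^bsub>A\<^esub> b)"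
  by (simp add: smult_eq_sc A.m_ac)

lemma mu_closed [simp]: "t \<in> carrier T \<Longrightarrow> mu t \<in> carrier A"
  and mu_add: "s \<in> carrier T \<Longrightarrow> t \<in> carrier T \<Longrightarrow> mu (s \<oplus>\<^bsub>T\<^esub> t) = mu s \<oplus>\<^bsub>A\<^esub> mu t"
  and mu_pt: "a \<in> carrier A \<Longrightarrow> b \<in> carrier A \<Longrightarrow> mu (pt a b) = a \<otimes>\<^bsub>A\<^esub> b"
  unfolding mult_map_lift
  by (rule lift_properties[OF A.abelian_group_axioms A.m_closed A.l_distr A.r_distr mu_scalar]; assumption)+

lemma mu_zero: "mu \<zero>\<^bsub>T\<^esub> = \<zero>\<^bsub>A\<^esub>"
  using mu_pt[of "\<zero>\<^bsub>A\<^esub>" "\<zero>\<^bsub>A\<^esub>"] by simp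

lemma mu_mult:
  assumes "s \<in> carrier T" "t \<in> carrier T"
  shows "mu (s \<otimes>\<^bsub>T\<^esub> t) = mu s \<otimes>\<^bsub>A\<^esub> mu t"
  using assms(1)
proof (induction s rule: T_induct)
  case (pure a b)
  show ?case using assms(2)
  proof (induction t rule: T_induct)
    case (pure c d)
    with \<open>a \<in> carrier A\<close> \<open>b \<in> carrier A\<close> show ?case
      by (simp add: pt_mult mu_pt A.m_ac)
  qed (use pure in \<open>auto simp: mu_zero mu_add T.r_distr A.r_distr\<close>)
qed (use assms in \<open>auto simp: mu_zero mu_add T.l_distr A.l_distr\<close>)

lemma mu_hom: "ring_hom_cring T A mu"
  by (rule ring_hom_cringI[OF T_cring A.cring_axioms])
     (auto intro!: ring_hom_memI simp: mu_mult mu_add pt_one mu_pt)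

sublocale mu: ring_hom_cring "tensor_with K A (tensor_pmap K p A)" A "mult_map A"
  by (rule mu_hom)

lemma mu_j: "a \<in> carrier A \<Longrightarrow> mu (j1 a) = a" "a \<in> carrier A \<Longrightarrow> mu (j2 a) = a"
  by (simp_all add: j1_def j2_def mu_pt)

text \<open>The augmentation of T factors through \<open>mu\<close>. Hence the kernel of
  \<open>mu\<close> lies in \<open>pos_part T\<close>, where the p-map is defined.\<close>

lemma eT_mu: "t \<in> carrier T \<Longrightarrow> eT t = deg_zero A (mu t)"
  by (induction t rule: T_induct)
     (auto simp: eT_zero mu_zero eT_pure mu_pt deg_zero_mult deg_zero_add)

abbreviation II where "II \<equiv> diag_ideal K p A"
abbreviation JJ where "JJ \<equiv> diag_ideal_sq K p A"

lemma II_iff: "t \<in> II \<longleftrightarrow> t \<in> carrier T \<and> mu t = \<zero>\<^bsub>A\<^esub>"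
  unfolding diag_ideal_def tensor_square a_kernel_def' by blast

lemma II_I: "t \<in> carrier T \<Longrightarrow> mu t = \<zero>\<^bsub>A\<^esub> \<Longrightarrow> t \<in> II"
  and mu_II: "t \<in> II \<Longrightarrow> mu t = \<zero>\<^bsub>A\<^esub>"
  unfolding II_iff by simp_all

lemma II_ideal: "ideal II T"
  unfolding diag_ideal_def tensor_square
  by (rule ring_hom_ring.kernel_is_ideal[OF ring_hom_ringI2[OF T.ring_axioms A.ring_axioms mu.homh]])

lemma JJ_ideal: "ideal JJ T"
  unfolding diag_ideal_sq_def tensor_square by (rule T.ideal_prod_is_ideal[OF II_ideal II_ideal])

sublocale II: ideal "diag_ideal K p A" "tensor_with K A (tensor_pmap K p A)"
  by (rule II_ideal)

sublocale JJ: ideal "diag_ideal_sq K p A" "tensor_with K A (tensor_pmap K p A)"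
  by (rule JJ_ideal)

lemma II_carrier [simp]: "t \<in> II \<Longrightarrow> t \<in> carrier T"
  by (rule II.Icarr)

lemma II_pos [simp]: "t \<in> II \<Longrightarrow> t \<in> pos_part T"
  unfolding II_iff pos_T_iff using eT_mu[of t] by simp

lemma JJ_II [simp]: "t \<in> JJ \<Longrightarrow> t \<in> II"
  using T.ideal_prod_inter[OF II_ideal II_ideal] unfolding diag_ideal_sq_def tensor_square by auto

lemma JJ_prod: "s \<in> II \<Longrightarrow> t \<in> II \<Longrightarrow> s \<otimes>\<^bsub>T\<^esub> t \<in> JJ"
  unfolding diag_ideal_sq_def tensor_square by (rule ideal_prod.prod)

lemma JJ_induct [consumes 1, case_names prod sum]:
  assumes "t \<in> JJ" and "\<And>i j. i \<in> II \<Longrightarrow> j \<in> II \<Longrightarrow> P (i \<otimes>\<^bsub>T\<^esub> j)"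
    and "\<And>s t. s \<in> JJ \<Longrightarrow> t \<in> JJ \<Longrightarrow> P s \<Longrightarrow> P t \<Longrightarrow> P (s \<oplus>\<^bsub>T\<^esub> t)"
  shows "P t"
  using assms(1) unfolding diag_ideal_sq_def tensor_square
  by (induction rule: ideal_prod.induct)
     (use assms(2,3) in \<open>auto simp: diag_ideal_sq_def tensor_square\<close>)

text \<open>Checked on the three kinds of generators; sums follow because \<Phi> commutes with the
  ring homomorphism \<open>mu\<close>. This is why the p-map preserves I.\<close>

lemma mu_piT:
  assumes "t \<in> pos_part T"
  shows "mu t \<in> pos_part A \<and> mu (piT t) = pmap A (mu t)"
  using assms
proof (induction t rule: Tp_induct)
  case (left x)
  then show ?case by (simp add: piT_j mu_j)
next
  case (right x)
  then show ?case by (simp add: piT_j mu_j)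
next
  case (both x y)
  then have "piT (pt x y) = \<zero>\<^bsub>T\<^esub>"
    using piT_mult[of "j1 x" "j2 y"] by (simp add: pt_mult_j)
  then show ?case using both by (simp add: mu_pt pmap_mult)
next
  case (add s t)
  then show ?case
    using mu.hom_pd_cocycle[OF T.prime_char_axioms, of s t] by (simp add: piT_plus pmap_plus)
qed

lemma piT_II [simp]: "t \<in> II \<Longrightarrow> piT t \<in> II"
  using mu_piT[of t] by (intro II_I) (simp_all add: mu_II pmap_zero)

text \<open>Every term of \<Phi> contains a positive power of each of its two arguments.\<close>

lemma Phi_JJ: "s \<in> II \<Longrightarrow> t \<in> II \<Longrightarrow> T.Phi s t \<in> JJ"
  by (intro T.Phi_mem[OF JJ_ideal] JJ_prod II.nat_pow_mem) auto

lemma piT_JJ: "t \<in> JJ \<Longrightarrow> piT t \<in> JJ"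
proof (induction t rule: JJ_induct)
  case (prod i j)
  then show ?case by (simp add: piT_mult)
next
  case (sum s t)
  then show ?case by (simp add: piT_plus Phi_JJ)
qed

section \<open>The action of A and P on \<open>I/I^2\<close>\<close>

abbreviation Q where "Q \<equiv> T Quot JJ"
definition rho where "rho t = JJ +>\<^bsub>T\<^esub> t"

lemma Q_cring: "cring Q"
  by (rule JJ.quotient_is_cring[OF T_cring])

lemma rho_hom: "ring_hom_cring T Q rho"
  using JJ.rcos_ring_hom_cring[OF T_cring] by (simp add: rho_def[abs_def])

sublocale Q: cring "tensor_with K A (tensor_pmap K p A) Quot diag_ideal_sq K p A"
  by (rule Q_cring)

sublocale rho: ring_hom_cring "tensor_with K A (tensor_pmap K p A)"
    "tensor_with K A (tensor_pmap K p A) Quot diag_ideal_sq K p A" rho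
  by (rule rho_hom)

sublocale Q: prime_char "tensor_with K A (tensor_pmap K p A) Quot diag_ideal_sq K p A" p
proof
  have "rho (add_pow T n \<one>\<^bsub>T\<^esub>) = add_pow Q n \<one>\<^bsub>Q\<^esub>" for n :: nat
    by (induction n) simp_all
  from this[of p] show "add_pow Q p \<one>\<^bsub>Q\<^esub> = \<zero>\<^bsub>Q\<^esub>" by (simp add: T.char_p)
qed (rule prime_p)

lemma rho_eq_iff: "s \<in> carrier T \<Longrightarrow> t \<in> carrier T \<Longrightarrow> rho s = rho t \<longleftrightarrow> s \<ominus>\<^bsub>T\<^esub> t \<in> JJ"
  unfolding rho_def using T.quotient_eq_iff_same_a_r_cos[OF JJ_ideal, of s t] by simp

lemma rho_zero: "t \<in> JJ \<Longrightarrow> rho t = \<zero>\<^bsub>Q\<^esub>"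
  using rho_eq_iff[of t "\<zero>\<^bsub>T\<^esub>"] by (simp add: T.minus_eq)

lemma rho_pow: "t \<in> carrier T \<Longrightarrow> rho (t [^]\<^bsub>T\<^esub> n) = rho t [^]\<^bsub>Q\<^esub> n" for n :: nat
  by (induction n) simp_all

abbreviation Om where "Om \<equiv> Omega K p A"
definition act where "act a z = rho (j1 a) \<otimes>\<^bsub>Q\<^esub> z"
definition Pop where "Pop z = (\<Union>t\<in>z. rho (piT t))"

lemma Omega_eq: "Om = V_module A (Q\<lparr>carrier := rho ` II\<rparr>) act Pop"
  unfolding Omega_def Let_def tensor_square act_def[abs_def] Pop_def[abs_def] rho_def[abs_def] j1_def pmap_T ..

lemma Om_simps: "carrier Om = rho ` II" "add Om = add Q" "\<zero>\<^bsub>Om\<^esub> = \<zero>\<^bsub>Q\<^esub>"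
  by (simp_all add: Omega_eq V_module_def)

lemma Om_carrier_Q [simp]: "z \<in> carrier Om \<Longrightarrow> z \<in> carrier Q"
  by (auto simp: Om_simps)

lemma rho_Om [simp]: "t \<in> II \<Longrightarrow> rho t \<in> carrier Om"
  by (simp add: Om_simps)

lemma Om_group: "abelian_group Om"
proof (rule abelian_groupI)
  fix x y assume "x \<in> carrier Om" "y \<in> carrier Om"
  then obtain s t where "s \<in> II" "t \<in> II" "x = rho s" "y = rho t" by (auto simp: Om_simps)
  then show "x \<oplus>\<^bsub>Om\<^esub> y \<in> carrier Om"
    unfolding Om_simps by (intro image_eqI[of _ _ "s \<oplus>\<^bsub>T\<^esub> t"]) auto
next
  fix x assume "x \<in> carrier Om"
  then obtain s where s: "s \<in> II" "x = rho s" by (auto simp: Om_simps)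
  then show "\<exists>y\<in>carrier Om. y \<oplus>\<^bsub>Om\<^esub> x = \<zero>\<^bsub>Om\<^esub>"
    by (intro bexI[of _ "rho (\<ominus>\<^bsub>T\<^esub> s)"] rho_Om) (simp_all add: Om_simps(2,3) Q.l_neg)
next
  show "\<zero>\<^bsub>Om\<^esub> \<in> carrier Om"
    unfolding Om_simps by (intro image_eqI[of _ _ "\<zero>\<^bsub>T\<^esub>"]) auto
qed (auto simp: Om_simps(2,3) Q.a_ac)

sublocale Om: abelian_group "Omega K p A"
  by (rule Om_group)

lemma act_rho: "a \<in> carrier A \<Longrightarrow> t \<in> carrier T \<Longrightarrow> act a (rho t) = rho (j1 a \<otimes>\<^bsub>T\<^esub> t)"
  by (simp add: act_def)

lemma act_closed [simp]: "a \<in> carrier A \<Longrightarrow> z \<in> carrier Om \<Longrightarrow> act a z \<in> carrier Om"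
  unfolding Om_simps by (auto simp: act_rho simp del: rho.hom_mult intro!: imageI II.I_l_closed)

lemma act_simps:
  "a \<in> carrier A \<Longrightarrow> x \<in> carrier Om \<Longrightarrow> y \<in> carrier Om \<Longrightarrow> act a (x \<oplus>\<^bsub>Om\<^esub> y) = act a x \<oplus>\<^bsub>Om\<^esub> act a y"
  "a \<in> carrier A \<Longrightarrow> b \<in> carrier A \<Longrightarrow> x \<in> carrier Om \<Longrightarrow> act (a \<oplus>\<^bsub>A\<^esub> b) x = act a x \<oplus>\<^bsub>Om\<^esub> act b x"
  "a \<in> carrier A \<Longrightarrow> b \<in> carrier A \<Longrightarrow> x \<in> carrier Om \<Longrightarrow> act (a \<otimes>\<^bsub>A\<^esub> b) x = act a (act b x)"
  "x \<in> carrier Om \<Longrightarrow> act \<one>\<^bsub>A\<^esub> x = x"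
  "x \<in> carrier Om \<Longrightarrow> act \<zero>\<^bsub>A\<^esub> x = \<zero>\<^bsub>Om\<^esub>"
  by (simp_all add: act_def Om_simps(2,3) Q.l_distr Q.r_distr Q.m_assoc)

text \<open>For \<open>j\<close> in \<open>I^2\<close>, the values \<open>\<pi>(j + t)\<close> and
  \<open>\<pi>(t)\<close> differ by \<open>\<pi>(j) + \<Phi>(j, t)\<close>, which lies in
  \<open>I^2\<close>. So the union that defines \<open>Pop\<close> is taken over equal
  classes.\<close>

lemma Pop_rho:
  assumes t: "t \<in> II"
  shows "Pop (rho t) = rho (piT t)"
proof -
  have "rho (piT s) = rho (piT t)" if s: "s \<in> rho t" for s
  proof -
    obtain j where j: "j \<in> JJ" "s = j \<oplus>\<^bsub>T\<^esub> t"
      using s unfolding rho_def a_r_coset_def' by blast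
    have "rho (piT s) = rho (piT j) \<oplus>\<^bsub>Q\<^esub> rho (piT t) \<oplus>\<^bsub>Q\<^esub> rho (T.Phi j t)"
      using j t by (simp add: piT_plus)
    also have "\<dots> = rho (piT t)"
      using j t by (simp add: rho_zero piT_JJ Phi_JJ)
    finally show ?thesis .
  qed
  moreover have "t \<in> rho t"
    unfolding rho_def using JJ.a_rcos_self[of t] t by simp
  ultimately show ?thesis unfolding Pop_def by blast
qed

lemma Pop_closed [simp]: "z \<in> carrier Om \<Longrightarrow> Pop z \<in> carrier Om"
  by (auto simp: Om_simps Pop_rho)

lemma Pop_add:
  assumes "x \<in> carrier Om" "y \<in> carrier Om"
  shows "Pop (x \<oplus>\<^bsub>Om\<^esub> y) = Pop x \<oplus>\<^bsub>Om\<^esub> Pop y"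
proof -
  obtain s t where st: "s \<in> II" "t \<in> II" "x = rho s" "y = rho t" using assms by (auto simp: Om_simps)
  have "x \<oplus>\<^bsub>Om\<^esub> y = rho (s \<oplus>\<^bsub>T\<^esub> t)" using st by (simp add: Om_simps(2))
  then have "Pop (x \<oplus>\<^bsub>Om\<^esub> y) = rho (piT (s \<oplus>\<^bsub>T\<^esub> t))" using st by (simp only: Pop_rho II.a_closed)
  also have "\<dots> = rho (piT s) \<oplus>\<^bsub>Q\<^esub> rho (piT t) \<oplus>\<^bsub>Q\<^esub> rho (T.Phi s t)"
    using st by (simp add: piT_plus)
  also have "\<dots> = Pop x \<oplus>\<^bsub>Om\<^esub> Pop y"
    using st by (simp add: Pop_rho Om_simps(2) rho_zero Phi_JJ)
  finally show ?thesis .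
qed

lemma Pop_act:
  assumes "a \<in> carrier A" "z \<in> carrier Om"
  shows "Pop (act a z) = act (a [^]\<^bsub>A\<^esub> p) (Pop z)"
proof -
  obtain t where t: "t \<in> II" "z = rho t" using assms by (auto simp: Om_simps)
  have "Pop (act a z) = rho (piT (j1 a \<otimes>\<^bsub>T\<^esub> t))"
    using t assms(1) by (simp only: act_rho II_carrier Pop_rho II.I_l_closed j1.hom_closed)
  also have "\<dots> = rho (j1 (a [^]\<^bsub>A\<^esub> p) \<otimes>\<^bsub>T\<^esub> piT t)"
    using t assms(1) by (simp only: piT_scale II_pos j1.hom_closed j_pow)
  also have "\<dots> = act (a [^]\<^bsub>A\<^esub> p) (Pop z)"
    using t assms(1) by (simp only: Pop_rho act_rho piT_II II_carrier A.nat_pow_closed)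
  finally show ?thesis .
qed

section \<open>The universal derivation of A\<close>

definition dd where "dd a = j2 a \<ominus>\<^bsub>T\<^esub> j1 a"

lemma dd_II [simp]: "a \<in> carrier A \<Longrightarrow> dd a \<in> II"
  by (rule II_I) (simp_all add: dd_def T.minus_eq mu_j A.r_neg)

abbreviation dA where "dA \<equiv> d_A K p A"

lemma dA_rho: "dA a = rho (dd a)"
  by (simp add: d_A_def Let_def tensor_square rho_def dd_def j1_def j2_def)

lemma dA_closed [simp]: "a \<in> carrier A \<Longrightarrow> dA a \<in> carrier Om"
  by (simp add: dA_rho)

lemma dA_add:
  assumes "a \<in> carrier A" "b \<in> carrier A"
  shows "dA (a \<oplus>\<^bsub>A\<^esub> b) = dA a \<oplus>\<^bsub>Om\<^esub> dA b"
proof -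
  have "dd (a \<oplus>\<^bsub>A\<^esub> b) = dd a \<oplus>\<^bsub>T\<^esub> dd b"
    using assms by (simp add: dd_def T.minus_eq T.minus_add T.a_ac)
  then show ?thesis using assms by (simp add: dA_rho Om_simps(2))
qed

text \<open>The term \<open>d(a) d(b)\<close> of the Leibniz rule in \<open>T\<close> lies in \<open>I\<^sup>2\<close>.\<close>

lemma dA_mult:
  assumes "a \<in> carrier A" "b \<in> carrier A"
  shows "dA (a \<otimes>\<^bsub>A\<^esub> b) = act a (dA b) \<oplus>\<^bsub>Om\<^esub> act b (dA a)"
proof -
  have "dd (a \<otimes>\<^bsub>A\<^esub> b) = j1 a \<otimes>\<^bsub>T\<^esub> dd b \<oplus>\<^bsub>T\<^esub> j1 b \<otimes>\<^bsub>T\<^esub> dd a \<oplus>\<^bsub>T\<^esub> dd a \<otimes>\<^bsub>T\<^esub> dd b"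
    using assms by (simp add: dd_def T.leibniz_identity)
  then have "dA (a \<otimes>\<^bsub>A\<^esub> b) =
     rho (j1 a \<otimes>\<^bsub>T\<^esub> dd b) \<oplus>\<^bsub>Q\<^esub> rho (j1 b \<otimes>\<^bsub>T\<^esub> dd a) \<oplus>\<^bsub>Q\<^esub> rho (dd a \<otimes>\<^bsub>T\<^esub> dd b)"
    using assms by (simp add: dA_rho)
  then show ?thesis
    using assms rho_zero[OF JJ_prod[OF dd_II dd_II]]
    by (simp add: dA_rho Om_simps(2) act_rho del: rho.hom_mult)
qed

lemma dA_zero_part:
  assumes "c \<in> zero_part A" "a \<in> carrier A"
  shows "dA (c \<otimes>\<^bsub>A\<^esub> a) = act c (dA a)"
proof -
  have "dd c = \<zero>\<^bsub>T\<^esub>" using assms by (simp add: dd_def j_zero_part T.minus_eq T.r_neg)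
  then have "dA c = \<zero>\<^bsub>Om\<^esub>" by (simp add: dA_rho Om_simps(3))
  then show ?thesis
    using assms by (simp add: dA_mult) (simp add: act_def Om_simps(2,3))
qed

lemma dA_smult: "c \<in> carrier K \<Longrightarrow> a \<in> carrier A \<Longrightarrow> dA (c \<odot>\<^bsub>A\<^esub> a) = act (c \<odot>\<^bsub>A\<^esub> \<one>\<^bsub>A\<^esub>) (dA a)"
  using dA_zero_part[of "sc c" a] by (simp add: smult_eq_sc[of c a] sc_def)

lemma dA_pmap:
  assumes x: "x \<in> pos_part A"
  shows "dA (pmap A x) = Pop (dA x) \<ominus>\<^bsub>Om\<^esub> act (x [^]\<^bsub>A\<^esub> (p - 1)) (dA x)"
proof -
  let ?v = "rho (j1 x)" and ?d = "rho (dd x)"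
  have c [simp]: "j1 x \<in> carrier T" "j2 x \<in> carrier T" "dd x \<in> carrier T"
    using x by auto
  have u: "rho (j2 x) = ?v \<oplus>\<^bsub>Q\<^esub> ?d"
    by (simp add: dd_def T.minus_eq Q.minus_eq) (simp add: Q.a_lcomm[of "rho (j1 x)" "rho (j2 x)"] Q.r_neg)
  have dd0: "?d \<otimes>\<^bsub>Q\<^esub> ?d = \<zero>\<^bsub>Q\<^esub>"
    using rho_zero[OF JJ_prod[OF dd_II dd_II], of x x] x by simp
  have vp: "?v [^]\<^bsub>Q\<^esub> p = \<zero>\<^bsub>Q\<^esub>"
    using x by (simp add: j_pow_p flip: rho_pow)
  have "piT (dd x) = piT (j2 x) \<oplus>\<^bsub>T\<^esub> piT (\<ominus>\<^bsub>T\<^esub> j1 x) \<oplus>\<^bsub>T\<^esub> T.Phi (j2 x) (\<ominus>\<^bsub>T\<^esub> j1 x)"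
    using x by (simp add: dd_def T.minus_eq piT_plus)
  also have "\<dots> = dd (pmap A x) \<oplus>\<^bsub>T\<^esub> T.Phi (j2 x) (\<ominus>\<^bsub>T\<^esub> j1 x)"
    using x by (simp add: piT_neg piT_j dd_def T.minus_eq)
  finally have "Pop (dA x) = dA (pmap A x) \<oplus>\<^bsub>Q\<^esub> rho (T.Phi (j2 x) (\<ominus>\<^bsub>T\<^esub> j1 x))"
    using x by (simp add: dA_rho Pop_rho)
  \<comment> \<open>In the quotient the increment \<open>dd x\<close> from
    \<open>x \<otimes> 1\<close> to \<open>1 \<otimes> x\<close> has square zero, as
    \<open>Phi_deriv\<close> requires.\<close>
  also have "rho (T.Phi (j2 x) (\<ominus>\<^bsub>T\<^esub> j1 x)) = Q.Phi (rho (j2 x)) (\<ominus>\<^bsub>Q\<^esub> ?v)"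
    using rho.hom_pd_cocycle[OF T.prime_char_axioms, of "j2 x" "\<ominus>\<^bsub>T\<^esub> j1 x"] by simp
  also have "\<dots> = ?v [^]\<^bsub>Q\<^esub> (p - 1) \<otimes>\<^bsub>Q\<^esub> ?d"
    unfolding u by (rule Q.Phi_deriv) (simp_all add: dd0 vp)
  also have "\<dots> = act (x [^]\<^bsub>A\<^esub> (p - 1)) (dA x)"
    using x by (simp add: act_def dA_rho j_pow rho_pow)
  finally have e: "Pop (dA x) = dA (pmap A x) \<oplus>\<^bsub>Om\<^esub> act (x [^]\<^bsub>A\<^esub> (p - 1)) (dA x)"
    by (simp add: Om_simps(2))
  have m: "dA (pmap A x) \<in> carrier Om" "act (x [^]\<^bsub>A\<^esub> (p - 1)) (dA x) \<in> carrier Om"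
    using x by auto
  show ?thesis
    unfolding e using m by (simp add: Om.minus_eq Om.a_assoc Om.r_neg)
qed

text \<open>The map \<open>t \<mapsto> t - mu(t) \<otimes> 1\<close> takes T to I, fixes I and sends
  \<open>a \<otimes> b\<close> to \<open>a (1 \<otimes> b - b \<otimes> 1)\<close>. Induction over T
  therefore shows that the classes \<open>a d(b)\<close> generate \<open>I/I^2\<close>
  additively.\<close>

lemma Om_induct [consumes 1, case_names zero gen add]:
  assumes "z \<in> carrier Om" and "P \<zero>\<^bsub>Om\<^esub>"
    and gen: "\<And>a b. a \<in> carrier A \<Longrightarrow> b \<in> carrier A \<Longrightarrow> P (act a (dA b))"
    and add: "\<And>x y. x \<in> carrier Om \<Longrightarrow> y \<in> carrier Om \<Longrightarrow> P x \<Longrightarrow> P y \<Longrightarrow> P (x \<oplus>\<^bsub>Om\<^esub> y)"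
  shows "P z"
proof -
  have "t \<ominus>\<^bsub>T\<^esub> j1 (mu t) \<in> II \<and> P (rho (t \<ominus>\<^bsub>T\<^esub> j1 (mu t)))" if "t \<in> carrier T" for t
    using that
  proof (induction t rule: T_induct)
    case zero
    then show ?case using assms(2) by (simp add: mu_zero T.minus_eq Om_simps(3))
  next
    case (pure a b)
    have "pt a b \<ominus>\<^bsub>T\<^esub> j1 (mu (pt a b)) = j1 a \<otimes>\<^bsub>T\<^esub> dd b"
      unfolding dd_def using pure
      by (simp add: mu_pt T.minus_eq T.r_distr T.r_minus pt_mult_j(3))
    then show ?case using pure gen[OF pure]
      by (simp add: act_rho dA_rho II.I_l_closed del: rho.hom_mult)
  next
    case (add s t)
    have "s \<oplus>\<^bsub>T\<^esub> t \<ominus>\<^bsub>T\<^esub> j1 (mu (s \<oplus>\<^bsub>T\<^esub> t)) = (s \<ominus>\<^bsub>T\<^esub> j1 (mu s)) \<oplus>\<^bsub>T\<^esub> (t \<ominus>\<^bsub>T\<^esub> j1 (mu t))"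
      using add(1,2) by (simp add: T.minus_eq T.minus_add T.a_ac)
    moreover have "P (rho (s \<ominus>\<^bsub>T\<^esub> j1 (mu s)) \<oplus>\<^bsub>Om\<^esub> rho (t \<ominus>\<^bsub>T\<^esub> j1 (mu t)))"
      using add by (blast intro: assms(4) rho_Om)
    ultimately show ?case using add by (simp add: Om_simps(2) del: rho.hom_sub)
  qed
  moreover obtain t where t: "t \<in> II" "z = rho t" using assms(1) by (auto simp: Om_simps)
  ultimately have "P (rho (t \<ominus>\<^bsub>T\<^esub> j1 (mu t)))" by simp
  then show ?thesis using t by (simp add: T.minus_eq mu_II)
qed

end

text \<open>A \<open>V(A)\<close>-module presented by its actions of A and P. The universal property
  is thus kept free of the coefficient sequences that encode \<open>V(A)\<close>, and A may act
  through its identification with the global functions.\<close>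

locale pd_target = pd_aug K A p + G: abelian_group G
  for K :: "('k, 'e) ring_scheme" (structure)
    and A :: "('k, 'a, 'z) pd_alg_scheme" (structure)
    and p :: nat
    and G :: "('g, 'h) ring_scheme" (structure) +
  fixes ac :: "'a \<Rightarrow> 'g \<Rightarrow> 'g" and P :: "'g \<Rightarrow> 'g"
  assumes ac_closed [simp]: "a \<in> carrier A \<Longrightarrow> g \<in> carrier G \<Longrightarrow> ac a g \<in> carrier G"
    and ac_add_r: "a \<in> carrier A \<Longrightarrow> g \<in> carrier G \<Longrightarrow> g' \<in> carrier G \<Longrightarrow>
        ac a (g \<oplus>\<^bsub>G\<^esub> g') = ac a g \<oplus>\<^bsub>G\<^esub> ac a g'"
    and ac_add_l: "a \<in> carrier A \<Longrightarrow> b \<in> carrier A \<Longrightarrow> g \<in> carrier G \<Longrightarrow>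
        ac (a \<oplus>\<^bsub>A\<^esub> b) g = ac a g \<oplus>\<^bsub>G\<^esub> ac b g"
    and ac_assoc: "a \<in> carrier A \<Longrightarrow> b \<in> carrier A \<Longrightarrow> g \<in> carrier G \<Longrightarrow>
        ac (a \<otimes>\<^bsub>A\<^esub> b) g = ac a (ac b g)"
    and ac_one: "g \<in> carrier G \<Longrightarrow> ac \<one>\<^bsub>A\<^esub> g = g"
    and P_closed [simp]: "g \<in> carrier G \<Longrightarrow> P g \<in> carrier G"
    and P_add: "g \<in> carrier G \<Longrightarrow> g' \<in> carrier G \<Longrightarrow> P (g \<oplus>\<^bsub>G\<^esub> g') = P g \<oplus>\<^bsub>G\<^esub> P g'"
    and P_ac: "a \<in> carrier A \<Longrightarrow> g \<in> carrier G \<Longrightarrow> P (ac a g) = ac (a [^]\<^bsub>A\<^esub> p) (P g)"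
begin

lemma idempotent_zero: "g \<in> carrier G \<Longrightarrow> g = g \<oplus>\<^bsub>G\<^esub> g \<Longrightarrow> g = \<zero>\<^bsub>G\<^esub>"
  using G.add.l_cancel_one[of g g] by simp

lemma ac_zero [simp]: "g \<in> carrier G \<Longrightarrow> ac \<zero>\<^bsub>A\<^esub> g = \<zero>\<^bsub>G\<^esub>" "a \<in> carrier A \<Longrightarrow> ac a \<zero>\<^bsub>G\<^esub> = \<zero>\<^bsub>G\<^esub>"
  and P_zero [simp]: "P \<zero>\<^bsub>G\<^esub> = \<zero>\<^bsub>G\<^esub>"
  using ac_add_l[of "\<zero>\<^bsub>A\<^esub>" "\<zero>\<^bsub>A\<^esub>" g] ac_add_r[of a "\<zero>\<^bsub>G\<^esub>" "\<zero>\<^bsub>G\<^esub>"] P_add[of "\<zero>\<^bsub>G\<^esub>" "\<zero>\<^bsub>G\<^esub>"]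
  by (auto intro!: idempotent_zero)

definition is_der :: "('a \<Rightarrow> 'g) \<Rightarrow> bool" where
  "is_der D \<longleftrightarrow> D \<in> carrier A \<rightarrow> carrier G \<and>
     (\<forall>a\<in>carrier A. \<forall>b\<in>carrier A. D (a \<oplus>\<^bsub>A\<^esub> b) = D a \<oplus>\<^bsub>G\<^esub> D b) \<and>
     (\<forall>c\<in>carrier K. \<forall>a\<in>carrier A. D (c \<odot>\<^bsub>A\<^esub> a) = ac (c \<odot>\<^bsub>A\<^esub> \<one>\<^bsub>A\<^esub>) (D a)) \<and>
     (\<forall>a\<in>carrier A. \<forall>b\<in>carrier A. D (a \<otimes>\<^bsub>A\<^esub> b) = ac a (D b) \<oplus>\<^bsub>G\<^esub> ac b (D a)) \<and>
     (\<forall>x\<in>pos_part A. D (pmap A x) = P (D x) \<ominus>\<^bsub>G\<^esub> ac (x [^]\<^bsub>A\<^esub> (p - 1)) (D x))"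

definition is_lin :: "(('a \<times> 'a \<Rightarrow>\<^sub>0 int) set set \<Rightarrow> 'g) \<Rightarrow> bool" where
  "is_lin F \<longleftrightarrow> F \<in> carrier Om \<rightarrow> carrier G \<and>
     (\<forall>x\<in>carrier Om. \<forall>y\<in>carrier Om. F (x \<oplus>\<^bsub>Om\<^esub> y) = F x \<oplus>\<^bsub>G\<^esub> F y) \<and>
     (\<forall>a\<in>carrier A. \<forall>x\<in>carrier Om. F (act a x) = ac a (F x)) \<and>
     (\<forall>x\<in>carrier Om. F (Pop x) = P (F x))"

lemma is_lin_zero: "is_lin F \<Longrightarrow> F \<zero>\<^bsub>Om\<^esub> = \<zero>\<^bsub>G\<^esub>"
  using Om.l_zero[of "\<zero>\<^bsub>Om\<^esub>"] unfolding is_lin_def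
  by (metis Om.zero_closed funcset_mem idempotent_zero)

lemma is_lin_minus:
  assumes F: "is_lin F" and xy: "x \<in> carrier Om" "y \<in> carrier Om"
  shows "F (x \<ominus>\<^bsub>Om\<^esub> y) = F x \<ominus>\<^bsub>G\<^esub> F y"
proof -
  have "F x = F (x \<ominus>\<^bsub>Om\<^esub> y \<oplus>\<^bsub>Om\<^esub> y)"
    using xy by (simp add: Om.minus_eq Om.a_assoc Om.l_neg)
  also have "\<dots> = F (x \<ominus>\<^bsub>Om\<^esub> y) \<oplus>\<^bsub>G\<^esub> F y"
    using F xy unfolding is_lin_def by simp
  finally show ?thesis
    using F xy unfolding is_lin_def by (auto simp: Pi_iff G.minus_eq G.a_assoc G.r_neg)
qed

lemma is_lin_der:
  assumes F: "is_lin F"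
  shows "is_der (\<lambda>a. F (dA a))"
  using F is_lin_minus[OF F]
  unfolding is_der_def is_lin_def by (auto simp: Pi_iff dA_add dA_smult dA_mult dA_pmap)

lemma is_der_cong:
  assumes "is_der D" and eq: "\<And>a. a \<in> carrier A \<Longrightarrow> D' a = D a"
  shows "is_der D'"
  using assms(1) unfolding is_der_def Pi_iff by (simp add: eq)

lemma is_lin_unique:
  assumes F: "is_lin F" and F': "is_lin F'" and eq: "\<And>a. a \<in> carrier A \<Longrightarrow> F (dA a) = F' (dA a)"
    and z: "z \<in> carrier Om"
  shows "F z = F' z"
  using z
proof (induction z rule: Om_induct)
  case zero
  then show ?case using is_lin_zero[OF F] is_lin_zero[OF F'] by simp
next
  case (gen a b)
  then show ?case using F F' eq unfolding is_lin_def by simp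
next
  case (add x y)
  then show ?case using F F' unfolding is_lin_def by simp
qed

lemma der_one: "is_der D \<Longrightarrow> D \<one>\<^bsub>A\<^esub> = \<zero>\<^bsub>G\<^esub>"
  unfolding is_der_def
  by (intro idempotent_zero) (auto simp: Pi_iff ac_one dest!: bspec[of _ _ "\<one>\<^bsub>A\<^esub>"])

lemma der_zero_part:
  assumes D: "is_der D" and c: "c \<in> zero_part A"
  shows "D c = \<zero>\<^bsub>G\<^esub>"
proof -
  obtain k where k: "k \<in> carrier K" "c = sc k" using c zero_part_sc by auto
  then have "D c = ac c (D \<one>\<^bsub>A\<^esub>)"
    using D unfolding is_der_def sc_def by simp
  then show ?thesis using c der_one[OF D] by simp
qed

text \<open>Constants are killed, so a derivation sees only positive parts. In this way the
  condition on the p-map, which speaks of \<open>pos_part A\<close>, becomes applicable at every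
  element.\<close>

lemma der_pos_of:
  assumes D: "is_der D" and a: "a \<in> carrier A"
  shows "D a = D (pos_of a)"
proof -
  have "D (deg_zero A a \<oplus>\<^bsub>A\<^esub> pos_of a) = D (deg_zero A a) \<oplus>\<^bsub>G\<^esub> D (pos_of a)"
    using D a unfolding is_der_def by simp
  moreover have "D (pos_of a) \<in> carrier G"
    using D a unfolding is_der_def by (auto simp: Pi_iff)
  ultimately show ?thesis
    using a by (simp add: deg_pos_sum der_zero_part[OF D])
qed

lemma dA_pos_of:
  assumes a: "a \<in> carrier A"
  shows "dA a = dA (pos_of a)"
proof -
  have "dA (deg_zero A a) = \<zero>\<^bsub>Om\<^esub>"
    using a by (simp add: dA_rho dd_def j_zero_part T.minus_eq T.r_neg Om_simps(3))
  then show ?thesis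
    using a dA_add[of "deg_zero A a" "pos_of a"] by (simp add: deg_pos_sum)
qed

text \<open>The map \<open>a \<otimes> b \<mapsto> a D(b)\<close> on T obeys a Leibniz rule over
  \<open>mu\<close>. Since \<open>mu\<close> vanishes on I, it kills products of two elements of I,
  and its restriction to I descends to \<open>I/I^2\<close>.\<close>

lemma is_lin_exists:
  assumes D: "is_der D"
  obtains F where "is_lin F" "\<And>a. a \<in> carrier A \<Longrightarrow> F (dA a) = D a"
proof -
  have Dc [simp]: "D a \<in> carrier G" if "a \<in> carrier A" for a
    using D that unfolding is_der_def by (auto simp: Pi_iff)
  have Da: "D (a \<oplus>\<^bsub>A\<^esub> b) = D a \<oplus>\<^bsub>G\<^esub> D b" and Dm: "D (a \<otimes>\<^bsub>A\<^esub> b) = ac a (D b) \<oplus>\<^bsub>G\<^esub> ac b (D a)"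
    if "a \<in> carrier A" "b \<in> carrier A" for a b
    using D that unfolding is_der_def by auto
  have Dp: "D (pmap A x) = P (D x) \<ominus>\<^bsub>G\<^esub> ac (x [^]\<^bsub>A\<^esub> (p - 1)) (D x)" if "x \<in> pos_part A" for x
    using D that unfolding is_der_def by auto
  have Ds: "D (c \<odot>\<^bsub>A\<^esub> a) = ac (sc c) (D a)" if "c \<in> carrier K" "a \<in> carrier A" for a c
    using D that unfolding is_der_def sc_def by auto
  define f where "f = tensor_lift G (\<lambda>a b. ac a (D b))"
  have h: "ac (c \<odot>\<^bsub>A\<^esub> a) (D b) = ac a (D (c \<odot>\<^bsub>A\<^esub> b))"
    if "c \<in> carrier K" "a \<in> carrier A" "b \<in> carrier A" for a b c
    using that Ds[of c b] by (simp add: smult_eq_sc[of c a] A.m_comm[of "sc c" a] ac_assoc)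
  note L = lift_properties[OF G.abelian_group_axioms, of "\<lambda>a b. ac a (D b)", folded f_def]
  have fc [simp]: "f t \<in> carrier G" if "t \<in> carrier T" for t
    using that by (intro L(1)) (auto simp: ac_add_l ac_add_r Da h)
  have fa: "f (s \<oplus>\<^bsub>T\<^esub> t) = f s \<oplus>\<^bsub>G\<^esub> f t" if "s \<in> carrier T" "t \<in> carrier T" for s t
    using that by (intro L(2)) (auto simp: ac_add_l ac_add_r Da h)
  have fp: "f (pt a b) = ac a (D b)" if "a \<in> carrier A" "b \<in> carrier A" for a b
    using that by (intro L(3)) (auto simp: ac_add_l ac_add_r Da h)
  have fz: "f \<zero>\<^bsub>T\<^esub> = \<zero>\<^bsub>G\<^esub>"
    using fp[of "\<zero>\<^bsub>A\<^esub>" "\<zero>\<^bsub>A\<^esub>"] by simp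
  have fm: "f (s \<otimes>\<^bsub>T\<^esub> t) = ac (mu s) (f t) \<oplus>\<^bsub>G\<^esub> ac (mu t) (f s)"
    if s: "s \<in> carrier T" and t: "t \<in> carrier T" for s t
    using s
  proof (induction s rule: T_induct)
    case (pure a b)
    note ab = pure
    show ?case using t
    proof (induction t rule: T_induct)
      case (pure c d)
      note cd = pure
      have e: "ac (a \<otimes>\<^bsub>A\<^esub> c) (ac b x) = ac (a \<otimes>\<^bsub>A\<^esub> b) (ac c x)" "ac (a \<otimes>\<^bsub>A\<^esub> c) (ac d x) = ac (c \<otimes>\<^bsub>A\<^esub> d) (ac a x)"
        if "x \<in> carrier G" for x
        using ab cd that by (simp_all add: ac_assoc[symmetric] A.m_ac)
      show ?case
        using ab cd by (simp add: pt_mult fp mu_pt Dm ac_add_r e)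
    next
      case (add u v)
      then show ?case
        using ab by (simp add: T.r_distr fa mu_add ac_add_l ac_add_r G.a_ac)
    qed (use ab in \<open>simp add: fz mu_zero\<close>)
  next
    case (add u v)
    then show ?case
      using t by (simp add: T.l_distr fa mu_add ac_add_l ac_add_r G.a_ac)
  qed (use t in \<open>simp add: fz mu_zero\<close>)
  have f0: "f t = \<zero>\<^bsub>G\<^esub>" if "t \<in> JJ" for t
    using that
  proof (induction t rule: JJ_induct)
    case (prod i j)
    then show ?case by (simp add: fm mu_II)
  next
    case (sum s t)
    then show ?case by (simp add: fa)
  qed
  \<comment> \<open>The choice is harmless: two representatives in I differ by an element of
    \<open>I^2\<close>, where \<open>f\<close> vanishes.\<close>
  define F where "F z = f (SOME t. t \<in> II \<and> rho t = z)" for z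
  have Fr: "F (rho t) = f t" if t: "t \<in> II" for t
  proof -
    define s where "s = (SOME s. s \<in> II \<and> rho s = rho t)"
    have s: "s \<in> II" "rho s = rho t"
      using someI[of "\<lambda>s. s \<in> II \<and> rho s = rho t" t] t unfolding s_def by auto
    have sc: "s \<in> carrier T" "t \<in> carrier T" using s t by auto
    have j: "s \<ominus>\<^bsub>T\<^esub> t \<in> JJ" using s(2) rho_eq_iff[OF sc] by simp
    have "s = (s \<ominus>\<^bsub>T\<^esub> t) \<oplus>\<^bsub>T\<^esub> t"
      using sc by (simp add: T.minus_eq T.a_assoc T.l_neg)
    then have "f s = f (s \<ominus>\<^bsub>T\<^esub> t) \<oplus>\<^bsub>G\<^esub> f t"
      using fa[of "s \<ominus>\<^bsub>T\<^esub> t" t] sc by simp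
    then have "f s = f t" using f0[OF j] sc by simp
    then show ?thesis by (simp add: F_def s_def)
  qed
  have Fc: "F \<in> carrier Om \<rightarrow> carrier G"
    by (auto simp: Om_simps Fr)
  have Fa: "F (x \<oplus>\<^bsub>Om\<^esub> y) = F x \<oplus>\<^bsub>G\<^esub> F y" if xy: "x \<in> carrier Om" "y \<in> carrier Om" for x y
  proof -
    obtain s t where st: "s \<in> II" "t \<in> II" "x = rho s" "y = rho t" using xy by (auto simp: Om_simps)
    have "x \<oplus>\<^bsub>Om\<^esub> y = rho (s \<oplus>\<^bsub>T\<^esub> t)" using st by (simp add: Om_simps(2))
    then show ?thesis using st by (simp only: Fr II.a_closed fa II_carrier)
  qed
  have D1: "D \<one>\<^bsub>A\<^esub> = \<zero>\<^bsub>G\<^esub>" by (rule der_one[OF D])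
  have fj1: "f (j1 a) = \<zero>\<^bsub>G\<^esub>" and fj2: "f (j2 a) = D a" if "a \<in> carrier A" for a
    using that by (simp_all add: j1_def j2_def fp D1 ac_one)
  have Fact: "F (act a x) = ac a (F x)" if ax: "a \<in> carrier A" "x \<in> carrier Om" for a x
  proof -
    obtain t where t: "t \<in> II" "x = rho t" using ax(2) by (auto simp: Om_simps)
    have "F (act a x) = f (j1 a \<otimes>\<^bsub>T\<^esub> t)"
      using t ax(1) by (simp only: act_rho II_carrier Fr II.I_l_closed j1.hom_closed)
    also have "\<dots> = ac a (f t)"
      using t ax(1) by (simp add: fm mu_j mu_II fj1)
    finally show ?thesis using t by (simp add: Fr)
  qed
  have Fd: "F (dA a) = D a" if a: "a \<in> carrier A" for a
  proof -
    have "j2 a = dd a \<oplus>\<^bsub>T\<^esub> j1 a"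
      using a by (simp add: dd_def T.minus_eq T.a_assoc T.l_neg)
    then have "f (j2 a) = f (dd a) \<oplus>\<^bsub>G\<^esub> f (j1 a)"
      using a by (simp add: fa)
    then show ?thesis using a by (simp add: dA_rho Fr fj1 fj2)
  qed
  \<comment> \<open>Both operators P are additive and semilinear for the p-th power, so the
    generators \<open>a d(b)\<close> suffice. There \<open>b\<close> is replaced by its positive
    part, to which \<open>dA_pmap\<close> and the condition on \<open>D\<close> apply.\<close>
  have FP: "F (Pop z) = P (F z)" if "z \<in> carrier Om" for z
    using that
  proof (induction z rule: Om_induct)
    case zero
    have Fz: "F \<zero>\<^bsub>Om\<^esub> = \<zero>\<^bsub>G\<^esub>"
      using Fr[of "\<zero>\<^bsub>T\<^esub>"] by (simp add: fz Om_simps(3))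
    have "Pop \<zero>\<^bsub>Om\<^esub> = Pop (act \<zero>\<^bsub>A\<^esub> \<zero>\<^bsub>Om\<^esub>)" by (simp add: act_simps)
    also have "\<dots> = \<zero>\<^bsub>Om\<^esub>"
      by (subst Pop_act) (auto simp: act_simps A.nat_pow_zero)
    finally show ?case by (simp add: Fz)
  next
    case (gen a b)
    let ?x = "pos_of b"
    have x: "?x \<in> pos_part A" "?x \<in> carrier A" using gen by auto
    have c: "act (?x [^]\<^bsub>A\<^esub> (p - 1)) (dA ?x) \<in> carrier Om" "Pop (dA ?x) \<in> carrier Om"
      "dA (pmap A ?x) \<in> carrier Om"
      using x by auto
    have Pd: "Pop (dA ?x) = dA (pmap A ?x) \<oplus>\<^bsub>Om\<^esub> act (?x [^]\<^bsub>A\<^esub> (p - 1)) (dA ?x)"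
      using c dA_pmap[OF x(1)] by (simp add: Om.minus_eq Om.a_assoc Om.l_neg)
    have "F (Pop (dA ?x)) = D (pmap A ?x) \<oplus>\<^bsub>G\<^esub> ac (?x [^]\<^bsub>A\<^esub> (p - 1)) (D ?x)"
      unfolding Pd using c x by (simp add: Fa Fact Fd)
    also have "\<dots> = P (D ?x)"
      using x by (simp add: Dp G.minus_eq G.a_assoc G.l_neg)
    finally have e: "F (Pop (dA b)) = P (D b)"
      using gen dA_pos_of[of b] der_pos_of[OF D, of b] by simp
    show ?case
      using gen by (simp add: Pop_act Fact e Fd P_ac)
  next
    case (add x y)
    then show ?case using Fc by (simp add: Pop_add Fa P_add Pi_iff)
  qed
  have "is_lin F"
    unfolding is_lin_def using Fc Fa Fact FP by blast
  then show ?thesis using Fd that by blast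
qed

end

text \<open>Moves the structure from A to the ring of global sections, whose elements are functions
  on the spectrum: each axiom is pulled back along the bijection \<open>h\<close>.\<close>

lemma (in pd_char) pdCom_transport:
  fixes B :: "('k, 'b, 'w) pd_alg_scheme"
  assumes inj: "inj_on h (carrier A)" and car: "carrier B = h ` carrier A"
    and add: "\<And>a b. a \<in> carrier A \<Longrightarrow> b \<in> carrier A \<Longrightarrow> h (a \<oplus>\<^bsub>A\<^esub> b) = h a \<oplus>\<^bsub>B\<^esub> h b"
    and mult: "\<And>a b. a \<in> carrier A \<Longrightarrow> b \<in> carrier A \<Longrightarrow> h (a \<otimes>\<^bsub>A\<^esub> b) = h a \<otimes>\<^bsub>B\<^esub> h b"
    and one: "h \<one>\<^bsub>A\<^esub> = \<one>\<^bsub>B\<^esub>" and zero: "h \<zero>\<^bsub>A\<^esub> = \<zero>\<^bsub>B\<^esub>"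
    and smult: "\<And>c a. c \<in> carrier K \<Longrightarrow> a \<in> carrier A \<Longrightarrow> h (c \<odot>\<^bsub>A\<^esub> a) = c \<odot>\<^bsub>B\<^esub> h a"
    and zp: "zero_part B = h ` zero_part A" and pp: "pos_part B = h ` pos_part A"
    and pm: "\<And>x. x \<in> pos_part A \<Longrightarrow> pmap B (h x) = h (pmap A x)"
  shows "pd_char K B p"
proof -
  have iso: "h \<in> ring_iso A B"
    using inj car add mult one by (intro ring_iso_memI) (auto simp: bij_betw_def)
  have "cring (B\<lparr>zero := h \<zero>\<^bsub>A\<^esub>\<rparr>)"
    by (rule A.ring_iso_imp_img_cring[OF iso])
  then have B: "cring B" by (rule cring_cong) (simp_all add: zero)
  then interpret B: cring B .
  interpret h: ring_hom_cring A B h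
    using iso by (intro ring_hom_cringI[OF A.cring_axioms B]) (auto simp: ring_iso_def)
  have pow: "h (a [^]\<^bsub>A\<^esub> n) = h a [^]\<^bsub>B\<^esub> n" if "a \<in> carrier A" for a and n :: nat
    using that by (induction n) auto
  have neg: "\<ominus>\<^bsub>B\<^esub> h a = h (\<ominus>\<^bsub>A\<^esub> a)" if "a \<in> carrier A" for a
    using that by simp
  have hrh: "ring_hom_ring A B h"
    by (rule ring_hom_ringI2[OF A.ring_axioms B.ring_axioms h.homh])
  note [simp del] = h.hom_add h.hom_mult
  have algB: "Module.algebra K B"
  proof (rule algebraI[OF K.cring_axioms B])
    show "\<And>a b x. \<lbrakk>a \<in> carrier K; b \<in> carrier K; x \<in> carrier B\<rbrakk> \<Longrightarrow>
        (a \<oplus>\<^bsub>K\<^esub> b) \<odot>\<^bsub>B\<^esub> x = a \<odot>\<^bsub>B\<^esub> x \<oplus>\<^bsub>B\<^esub> b \<odot>\<^bsub>B\<^esub> x"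
      by (auto simp: car smult[symmetric] smult_l_distr add)
    show "\<And>a x y. \<lbrakk>a \<in> carrier K; x \<in> carrier B; y \<in> carrier B\<rbrakk> \<Longrightarrow>
        a \<odot>\<^bsub>B\<^esub> (x \<oplus>\<^bsub>B\<^esub> y) = a \<odot>\<^bsub>B\<^esub> x \<oplus>\<^bsub>B\<^esub> a \<odot>\<^bsub>B\<^esub> y"
      by (auto simp: car smult[symmetric] smult_r_distr simp flip: add)
    show "\<And>a b x. \<lbrakk>a \<in> carrier K; b \<in> carrier K; x \<in> carrier B\<rbrakk> \<Longrightarrow>
        (a \<otimes>\<^bsub>K\<^esub> b) \<odot>\<^bsub>B\<^esub> x = a \<odot>\<^bsub>B\<^esub> (b \<odot>\<^bsub>B\<^esub> x)"
      by (auto simp: car smult[symmetric] smult_assoc1)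
    show "\<And>a x y. \<lbrakk>a \<in> carrier K; x \<in> carrier B; y \<in> carrier B\<rbrakk> \<Longrightarrow>
        (a \<odot>\<^bsub>B\<^esub> x) \<otimes>\<^bsub>B\<^esub> y = a \<odot>\<^bsub>B\<^esub> (x \<otimes>\<^bsub>B\<^esub> y)"
      by (auto simp: car smult[symmetric] smult_assoc2 simp flip: mult)
  qed (auto simp: car smult[symmetric])
  interpret BK: char_algebra K B p
    using algB field_K prime_p char_K by (intro char_algebra.intro)
  have "pdCom K B p"
  proof (intro pdCom.intro pdCom_axioms.intro algB)
    show "subring (zero_part B) B"
      unfolding zp by (rule ring_hom_ring.img_is_subring[OF hrh zero_part_subring])
    show "\<And>c a. c \<in> carrier K \<Longrightarrow> a \<in> zero_part B \<Longrightarrow> c \<odot>\<^bsub>B\<^esub> a \<in> zero_part B"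
      unfolding zp by (auto simp: smult[symmetric] zero_part_smult)
    show "ideal (pos_part B) B"
    proof (rule idealI[OF B.ring_axioms])
      show "subgroup (pos_part B) (add_monoid B)"
      proof (rule group.subgroupI[OF B.a_group])
        fix x assume "x \<in> pos_part B"
        then obtain a where a: "a \<in> pos_part A" "x = h a" by (auto simp: pp)
        then have "\<ominus>\<^bsub>B\<^esub> x = h (\<ominus>\<^bsub>A\<^esub> a)" by (simp only: neg pos_carrier)
        then show "inv\<^bsub>add_monoid B\<^esub> x \<in> pos_part B"
          unfolding pp using a pos.a_inv_closed[OF a(1)] unfolding a_inv_def by (metis image_eqI)
      next
        show "\<And>x y. x \<in> pos_part B \<Longrightarrow> y \<in> pos_part B \<Longrightarrow> x \<otimes>\<^bsub>add_monoid B\<^esub> y \<in> pos_part B"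
          by (auto simp: pp simp flip: add)
      next
        show "pos_part B \<noteq> {}"
          unfolding pp using pos.zero_closed by blast
      qed (auto simp: pp car)
      show "\<And>a x. a \<in> pos_part B \<Longrightarrow> x \<in> carrier B \<Longrightarrow> x \<otimes>\<^bsub>B\<^esub> a \<in> pos_part B"
        by (auto simp: pp car pos.I_l_closed simp flip: mult)
      show "\<And>a x. a \<in> pos_part B \<Longrightarrow> x \<in> carrier B \<Longrightarrow> a \<otimes>\<^bsub>B\<^esub> x \<in> pos_part B"
        by (auto simp: pp car pos.I_r_closed simp flip: mult)
    qed
    show "zero_part B <+>\<^bsub>B\<^esub> pos_part B = carrier B"
    proof (intro equalityI subsetI)
      fix x assume "x \<in> zero_part B <+>\<^bsub>B\<^esub> pos_part B"
      then show "x \<in> carrier B" unfolding set_add_def' zp pp by auto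
    next
      fix x assume "x \<in> carrier B"
      then obtain a where a: "a \<in> carrier A" "x = h a" by (auto simp: car)
      then have "x = h (deg_zero A a) \<oplus>\<^bsub>B\<^esub> h (pos_of a)" by (simp add: deg_pos_sum flip: add)
      moreover have "h (deg_zero A a) \<in> h ` zero_part A" "h (pos_of a) \<in> h ` pos_part A"
        using a by auto
      ultimately show "x \<in> zero_part B <+>\<^bsub>B\<^esub> pos_part B"
        unfolding set_add_def' zp pp by blast
    qed
    show "zero_part B \<inter> pos_part B = {\<zero>\<^bsub>B\<^esub>}"
    proof -
      have "zero_part A \<subseteq> carrier A" "pos_part A \<subseteq> carrier A"
        using zero_carrier pos_carrier by blast+
      then have "h ` zero_part A \<inter> h ` pos_part A = h ` (zero_part A \<inter> pos_part A)"
        by (rule inj_on_image_Int[OF inj, symmetric])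
      then show ?thesis unfolding zp pp parts_inter using zero by simp
    qed
    show "\<And>x. x \<in> pos_part B \<Longrightarrow> pmap B x \<in> pos_part B"
      by (auto simp: pp pm pmap_closed)
    show "\<And>x. x \<in> pos_part B \<Longrightarrow> x [^]\<^bsub>B\<^esub> p = \<zero>\<^bsub>B\<^esub>"
      by (auto simp: pp pos_part_pow simp flip: pow)
    show "\<And>x y. x \<in> pos_part B \<Longrightarrow> y \<in> pos_part B \<Longrightarrow>
        pmap B (x \<otimes>\<^bsub>B\<^esub> y) = \<zero>\<^bsub>B\<^esub>"
      by (auto simp: pp pm pos.I_l_closed pmap_mult simp flip: mult)
    show "\<And>a x. a \<in> zero_part B \<Longrightarrow> x \<in> pos_part B \<Longrightarrow>
        pmap B (a \<otimes>\<^bsub>B\<^esub> x) = a [^]\<^bsub>B\<^esub> p \<otimes>\<^bsub>B\<^esub> pmap B x"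
    proof -
      fix a x assume "a \<in> zero_part B" "x \<in> pos_part B"
      then obtain b y where bxy: "b \<in> zero_part A" "y \<in> pos_part A" "a = h b" "x = h y" by (auto simp: zp pp)
      have "a \<otimes>\<^bsub>B\<^esub> x = h (b \<otimes>\<^bsub>A\<^esub> y)" using bxy by (simp add: mult)
      moreover have "h (pmap A (b \<otimes>\<^bsub>A\<^esub> y)) = h b [^]\<^bsub>B\<^esub> p \<otimes>\<^bsub>B\<^esub> h (pmap A y)"
        using bxy by (simp add: pmap_scale mult pow)
      ultimately show "pmap B (a \<otimes>\<^bsub>B\<^esub> x) = a [^]\<^bsub>B\<^esub> p \<otimes>\<^bsub>B\<^esub> pmap B x"
        using bxy by (simp add: pm pos.I_l_closed)
    qed
    show "pmap B (x \<oplus>\<^bsub>B\<^esub> y) = pmap B x \<oplus>\<^bsub>B\<^esub> pmap B y \<oplus>\<^bsub>B\<^esub>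
          (\<Oplus>\<^bsub>B\<^esub>j\<in>{1..p-1}.
            ((\<ominus>\<^bsub>K\<^esub> \<one>\<^bsub>K\<^esub>) [^]\<^bsub>K\<^esub> j \<otimes>\<^bsub>K\<^esub> inv\<^bsub>K\<^esub> (add_pow K j \<one>\<^bsub>K\<^esub>))
              \<odot>\<^bsub>B\<^esub> (x [^]\<^bsub>B\<^esub> j \<otimes>\<^bsub>B\<^esub> y [^]\<^bsub>B\<^esub> (p - j)))"
      if xy: "x \<in> pos_part B" "y \<in> pos_part B" for x y
    proof -
      obtain a b where ab: "a \<in> pos_part A" "b \<in> pos_part A" "x = h a" "y = h b"
        using xy by (auto simp: pp)
      have "pmap B (x \<oplus>\<^bsub>B\<^esub> y) = pmap B (h (a \<oplus>\<^bsub>A\<^esub> b))"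
        using ab by (simp add: add)
      also have "\<dots> = h (pmap A a \<oplus>\<^bsub>A\<^esub> pmap A b \<oplus>\<^bsub>A\<^esub> A.Phi a b)"
        using ab by (simp add: pm pmap_plus)
      also have "\<dots> = pmap B x \<oplus>\<^bsub>B\<^esub> pmap B y \<oplus>\<^bsub>B\<^esub> pd_cocycle B p x y"
        using ab h.hom_pd_cocycle[OF A.prime_char_axioms, of a b] by (simp add: pm add)
      finally show ?thesis
        using BK.Phi_scalars[of x y] ab by simp
    qed
  qed
  then show ?thesis
    using field_K prime_p char_K by (intro pd_char.intro)
qed

section \<open>Modules over \<open>V(A)\<close>\<close>

lemma monom_apply: "a \<in> carrier A \<Longrightarrow> monom (UP A) a n = (\<lambda>i. if i = n then a else \<zero>\<^bsub>A\<^esub>)"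
  by (simp add: UP_def)

lemma abelian_group_cong:
  assumes "abelian_group G" "carrier H = carrier G" "add H = add G" "zero H = zero G"
  shows "abelian_group H"
proof -
  interpret G: abelian_group G by fact
  show ?thesis
    by (rule abelian_groupI) (auto simp: assms(2-) G.a_ac intro: G.l_neg)
qed

text \<open>The group axioms pass to the image of an additive map, and sums and differences are
  carried along. Applied to fractions with denominator 1, it turns calculations in a localization
  into calculations in \<open>I/I^2\<close>.\<close>

lemma image_group:
  assumes G: "abelian_group G" and car: "carrier H = h ` carrier G"
    and add: "\<And>x y. x \<in> carrier G \<Longrightarrow> y \<in> carrier G \<Longrightarrow> h (x \<oplus>\<^bsub>G\<^esub> y) = h x \<oplus>\<^bsub>H\<^esub> h y"
    and zero: "h \<zero>\<^bsub>G\<^esub> = \<zero>\<^bsub>H\<^esub>"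
  shows abelian_group_image: "abelian_group H"
    and minus_image: "x \<in> carrier G \<Longrightarrow> y \<in> carrier G \<Longrightarrow> h x \<ominus>\<^bsub>H\<^esub> h y = h (x \<ominus>\<^bsub>G\<^esub> y)"
    and finsum_image: "finite F \<Longrightarrow> f \<in> F \<rightarrow> carrier G \<Longrightarrow> finsum H (\<lambda>i. h (f i)) F = h (finsum G f F)"
proof -
  interpret G: abelian_group G by fact
  show H: "abelian_group H"
  proof (rule abelian_groupI)
    fix x assume "x \<in> carrier H"
    then obtain a where a: "a \<in> carrier G" "x = h a" by (auto simp: car)
    then have "h (\<ominus>\<^bsub>G\<^esub> a) \<oplus>\<^bsub>H\<^esub> x = \<zero>\<^bsub>H\<^esub>"
      by (simp add: G.l_neg zero flip: add)
    then show "\<exists>y\<in>carrier H. y \<oplus>\<^bsub>H\<^esub> x = \<zero>\<^bsub>H\<^esub>"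
      using a by (intro bexI[of _ "h (\<ominus>\<^bsub>G\<^esub> a)"]) (auto simp: car)
  qed (auto simp: car G.a_ac simp flip: add zero)
  interpret H: abelian_group H by (rule H)
  show "h x \<ominus>\<^bsub>H\<^esub> h y = h (x \<ominus>\<^bsub>G\<^esub> y)" if xy: "x \<in> carrier G" "y \<in> carrier G"
  proof -
    have c: "h (x \<ominus>\<^bsub>G\<^esub> y) \<in> carrier H" "h y \<in> carrier H" using xy by (auto simp: car)
    have "h x = h (x \<ominus>\<^bsub>G\<^esub> y) \<oplus>\<^bsub>H\<^esub> h y"
      using xy by (simp add: G.minus_eq G.a_assoc G.l_neg flip: add)
    then show ?thesis using c by (simp add: H.minus_eq H.a_assoc H.r_neg)
  qed
  show "finite F \<Longrightarrow> f \<in> F \<rightarrow> carrier G \<Longrightarrow> finsum H (\<lambda>i. h (f i)) F = h (finsum G f F)"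
  proof (induction F rule: finite_induct)
    case (insert i F)
    then show ?case by (simp add: add car Pi_iff)
  qed (simp add: zero)
qed

text \<open>\<open>V_module\<close> sums over the nonzero coefficients. For \<open>a\<close> equal
  to zero that sum is empty, and the last hypothesis supplies the matching value on the
  right.\<close>

lemma V_module_monom:
  assumes "abelian_group N" "a \<in> carrier A" "act a ((P ^^ n) m) \<in> carrier N"
    and "a = \<zero>\<^bsub>A\<^esub> \<Longrightarrow> act a ((P ^^ n) m) = \<zero>\<^bsub>N\<^esub>"
  shows "monom (UP A) a n \<odot>\<^bsub>V_module A N act P\<^esub> m = act a ((P ^^ n) m)"
proof -
  interpret N: abelian_group N by fact
  show ?thesis
  proof (cases "a = \<zero>\<^bsub>A\<^esub>")
    case True
    then show ?thesis using assms by (simp add: V_module_def monom_apply)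
  next
    case False
    then have "{i. (if i = n then a else \<zero>\<^bsub>A\<^esub>) \<noteq> \<zero>\<^bsub>A\<^esub>} = {n}" by auto
    then show ?thesis using assms by (simp add: V_module_def monom_apply)
  qed
qed

locale V_mod = pd_char K A p + N: left_module "V_ring p A" N
  for K :: "('k, 'e) ring_scheme" (structure)
    and A :: "('k, 'a, 'z) pd_alg_scheme" (structure)
    and p :: nat
    and N :: "(nat \<Rightarrow> 'a, 'm, 'y) module_scheme" (structure)
begin

lemma V_carrier: "carrier (V_ring p A) = up A"
  and V_add: "v \<in> up A \<Longrightarrow> w \<in> up A \<Longrightarrow> v \<oplus>\<^bsub>V_ring p A\<^esub> w = (\<lambda>i. v i \<oplus>\<^bsub>A\<^esub> w i)"
  and V_one: "\<one>\<^bsub>V_ring p A\<^esub> = V_of A \<one>\<^bsub>A\<^esub>"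
  by (simp_all add: V_ring_def UP_def V_of_def)

lemma monom_up [simp]: "a \<in> carrier A \<Longrightarrow> monom (UP A) a n \<in> up A"
  by (auto simp: monom_apply up_def bound_def intro!: exI[of _ n])

lemma V_of_up [simp]: "a \<in> carrier A \<Longrightarrow> V_of A a \<in> up A"
  and V_P_up [simp]: "V_P A \<in> up A"
  by (simp_all add: V_of_def V_P_def)

lemma monom_add: "a \<in> carrier A \<Longrightarrow> b \<in> carrier A \<Longrightarrow>
    monom (UP A) (a \<oplus>\<^bsub>A\<^esub> b) n = monom (UP A) a n \<oplus>\<^bsub>V_ring p A\<^esub> monom (UP A) b n"
  by (simp add: V_add) (auto simp: monom_apply fun_eq_iff)

lemma A_act_closed [simp]: "a \<in> carrier A \<Longrightarrow> m \<in> carrier N \<Longrightarrow> A_act A N a m \<in> carrier N"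
  and P_act_closed [simp]: "m \<in> carrier N \<Longrightarrow> P_act A N m \<in> carrier N"
  by (simp_all add: A_act_def P_act_def N.smult_closed V_carrier)

lemma A_act_add_l: "a \<in> carrier A \<Longrightarrow> b \<in> carrier A \<Longrightarrow> m \<in> carrier N \<Longrightarrow>
    A_act A N (a \<oplus>\<^bsub>A\<^esub> b) m = A_act A N a m \<oplus>\<^bsub>N\<^esub> A_act A N b m"
  by (simp add: A_act_def V_of_def monom_add N.smult_l_distr V_carrier)

lemma A_act_add_r: "a \<in> carrier A \<Longrightarrow> m \<in> carrier N \<Longrightarrow> m' \<in> carrier N \<Longrightarrow>
    A_act A N a (m \<oplus>\<^bsub>N\<^esub> m') = A_act A N a m \<oplus>\<^bsub>N\<^esub> A_act A N a m'"
  by (simp add: A_act_def N.smult_r_distr V_carrier)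

lemma P_act_add: "m \<in> carrier N \<Longrightarrow> m' \<in> carrier N \<Longrightarrow>
    P_act A N (m \<oplus>\<^bsub>N\<^esub> m') = P_act A N m \<oplus>\<^bsub>N\<^esub> P_act A N m'"
  by (simp add: P_act_def N.smult_r_distr V_carrier)

lemma A_act_one: "m \<in> carrier N \<Longrightarrow> A_act A N \<one>\<^bsub>A\<^esub> m = m"
  by (simp add: A_act_def N.smult_one flip: V_one)

lemmas V_mult_monom = pdCom.V_mult_monom[OF pd A.p_gt_0]

lemma A_act_mult: "a \<in> carrier A \<Longrightarrow> b \<in> carrier A \<Longrightarrow> m \<in> carrier N \<Longrightarrow>
    A_act A N (a \<otimes>\<^bsub>A\<^esub> b) m = A_act A N a (A_act A N b m)"
  by (simp add: A_act_def V_carrier flip: N.smult_assoc) (simp add: V_of_def V_mult_monom)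

lemma P_act_A_act:
  assumes "a \<in> carrier A" "m \<in> carrier N"
  shows "P_act A N (A_act A N a m) = A_act A N (a [^]\<^bsub>A\<^esub> p) (P_act A N m)"
proof -
  have "V_P A \<otimes>\<^bsub>V_ring p A\<^esub> V_of A a = V_of A (a [^]\<^bsub>A\<^esub> p) \<otimes>\<^bsub>V_ring p A\<^esub> V_P A"
    using assms by (simp add: V_P_def V_of_def V_mult_monom V_frob_pow)
  then show ?thesis
    using assms by (simp add: A_act_def P_act_def V_carrier flip: N.smult_assoc)
qed

lemma monom_smult:
  "a \<in> carrier A \<Longrightarrow> m \<in> carrier N \<Longrightarrow> monom (UP A) a n \<odot>\<^bsub>N\<^esub> m = A_act A N a ((P_act A N ^^ n) m)"
proof (induction n arbitrary: m)
  case 0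
  then show ?case by (simp add: A_act_def V_of_def)
next
  case (Suc n)
  have one: "(V_frob p A ^^ n) \<one>\<^bsub>A\<^esub> = \<one>\<^bsub>A\<^esub>"
    by (induction n) (simp_all add: V_frob_pow)
  have "monom (UP A) a (Suc n) = monom (UP A) a n \<otimes>\<^bsub>V_ring p A\<^esub> V_P A"
    using Suc.prems by (simp add: V_P_def V_mult_monom one)
  then have "monom (UP A) a (Suc n) \<odot>\<^bsub>N\<^esub> m = monom (UP A) a n \<odot>\<^bsub>N\<^esub> P_act A N m"
    using Suc.prems by (simp add: N.smult_assoc V_carrier P_act_def)
  then show ?case
    using Suc by (simp add: funpow_swap1)
qed

lemma P_act_iter_closed [simp]: "m \<in> carrier N \<Longrightarrow> (P_act A N ^^ n) m \<in> carrier N"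
  by (induction n) auto

lemma A_act_zero [simp]: "m \<in> carrier N \<Longrightarrow> A_act A N \<zero>\<^bsub>A\<^esub> m = \<zero>\<^bsub>N\<^esub>"
  using A_act_add_l[of "\<zero>\<^bsub>A\<^esub>" "\<zero>\<^bsub>A\<^esub>" m] N.M.add.l_cancel_one[of "A_act A N \<zero>\<^bsub>A\<^esub> m" "A_act A N \<zero>\<^bsub>A\<^esub> m"]
  by simp

text \<open>An element of \<open>V(A)\<close> is a finite sum of monomials \<open>a P^i\<close>, so
  its action is determined by those of A and P; the induction splits off one coefficient at a time.
  Allowing an index set larger than the support lets sequences over different rings be compared
  without comparing supports.\<close>

lemma smult_superset:
  assumes "finite F"
  shows "v \<in> up A \<Longrightarrow> {i. v i \<noteq> \<zero>\<^bsub>A\<^esub>} \<subseteq> F \<Longrightarrow> m \<in> carrier N \<Longrightarrow>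
    v \<odot>\<^bsub>N\<^esub> m = (\<Oplus>\<^bsub>N\<^esub>i\<in>F. A_act A N (v i) ((P_act A N ^^ i) m))"
  using assms
proof (induction F arbitrary: v rule: finite_induct)
  case empty
  then have v: "v = monom (UP A) \<zero>\<^bsub>A\<^esub> 0" by (auto simp: monom_apply)
  have "v \<odot>\<^bsub>N\<^esub> m = A_act A N \<zero>\<^bsub>A\<^esub> ((P_act A N ^^ 0) m)"
    unfolding v using empty(3) by (intro monom_smult) auto
  then show ?case using empty(3) by simp
next
  case (insert k F)
  let ?w = "v(k := \<zero>\<^bsub>A\<^esub>)"
  have vk [simp]: "v i \<in> carrier A" for i using insert.prems(1) by auto
  have w: "?w \<in> up A"
  proof -
    obtain n where "bound \<zero>\<^bsub>A\<^esub> n v" using insert.prems(1) by (auto simp: up_def)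
    then have "bound \<zero>\<^bsub>A\<^esub> n ?w" by (auto simp: bound_def)
    then show ?thesis using insert.prems(1) by (auto simp: up_def)
  qed
  have v: "v = ?w \<oplus>\<^bsub>V_ring p A\<^esub> monom (UP A) (v k) k"
  proof -
    have "?w \<oplus>\<^bsub>V_ring p A\<^esub> monom (UP A) (v k) k = (\<lambda>i. ?w i \<oplus>\<^bsub>A\<^esub> monom (UP A) (v k) k i)"
      using w by (intro V_add) auto
    then show ?thesis by (auto simp: monom_apply fun_eq_iff)
  qed
  have F: "{i. ?w i \<noteq> \<zero>\<^bsub>A\<^esub>} \<subseteq> F" using insert.prems(2) by auto
  have "v \<odot>\<^bsub>N\<^esub> m = ?w \<odot>\<^bsub>N\<^esub> m \<oplus>\<^bsub>N\<^esub> monom (UP A) (v k) k \<odot>\<^bsub>N\<^esub> m"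
    using w insert.prems(3) by (subst v) (simp add: N.smult_l_distr V_carrier)
  also have "?w \<odot>\<^bsub>N\<^esub> m = (\<Oplus>\<^bsub>N\<^esub>i\<in>F. A_act A N (?w i) ((P_act A N ^^ i) m))"
    using insert.IH[OF w F insert.prems(3)] .
  also have "\<dots> = (\<Oplus>\<^bsub>N\<^esub>i\<in>F. A_act A N (v i) ((P_act A N ^^ i) m))"
    using insert.hyps insert.prems(3) by (intro N.M.finsum_cong') auto
  also have "\<dots> \<oplus>\<^bsub>N\<^esub> monom (UP A) (v k) k \<odot>\<^bsub>N\<^esub> m =
     (\<Oplus>\<^bsub>N\<^esub>i\<in>insert k F. A_act A N (v i) ((P_act A N ^^ i) m))"
    using insert.hyps insert.prems(3)
    by (subst N.M.finsum_insert) (auto simp: monom_smult N.M.a_comm)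
  finally show ?case .
qed

end

text \<open>When all denominators are units, every fraction has a unique representative with
  denominator 1.\<close>

locale unit_frac = cring R for R (structure) +
  fixes N :: "('m, 'n) ring_scheme" and ac :: "'a \<Rightarrow> 'm \<Rightarrow> 'm" and S :: "'a set"
  assumes S_Units: "S \<subseteq> Units R" and S_one [simp]: "\<one> \<in> S"
    and S_mult [simp]: "s \<in> S \<Longrightarrow> t \<in> S \<Longrightarrow> s \<otimes> t \<in> S"
    and ac_closed [simp]: "a \<in> carrier R \<Longrightarrow> m \<in> carrier N \<Longrightarrow> ac a m \<in> carrier N"
    and ac_assoc: "a \<in> carrier R \<Longrightarrow> b \<in> carrier R \<Longrightarrow> m \<in> carrier N \<Longrightarrow> ac (a \<otimes> b) m = ac a (ac b m)"
    and ac_one: "m \<in> carrier N \<Longrightarrow> ac \<one> m = m"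
begin

lemma S_carrier [simp]: "s \<in> S \<Longrightarrow> s \<in> carrier R"
  using S_Units by auto

lemma S_inv [simp]: "s \<in> S \<Longrightarrow> inv s \<in> carrier R"
  using S_Units by auto

lemma ac_inv: "s \<in> S \<Longrightarrow> m \<in> carrier N \<Longrightarrow> ac (inv s) (ac s m) = m"
  "s \<in> S \<Longrightarrow> m \<in> carrier N \<Longrightarrow> ac s (ac (inv s) m) = m"
  using S_Units by (auto simp: ac_one simp flip: ac_assoc)

lemma ac_cancel: "s \<in> S \<Longrightarrow> m \<in> carrier N \<Longrightarrow> n \<in> carrier N \<Longrightarrow> ac s m = ac s n \<longleftrightarrow> m = n"
  by (metis ac_inv(1))

lemma frac_mem:
  assumes "m \<in> carrier N" "s \<in> S"
  shows "(n, t) \<in> frac N ac S m s \<longleftrightarrow> n \<in> carrier N \<and> t \<in> S \<and> ac t m = ac s n"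
proof -
  have "(\<exists>u\<in>S. ac u (ac t m) = ac u (ac s n)) \<longleftrightarrow> ac t m = ac s n" if "n \<in> carrier N" "t \<in> S"
    using that assms S_one by (auto simp: ac_cancel)
  then show ?thesis
    using assms by (auto simp: frac_def frac_rel_def)
qed

lemma frac_one_mem: "m \<in> carrier N \<Longrightarrow> (n, t) \<in> frac N ac S m \<one> \<longleftrightarrow> t \<in> S \<and> n = ac t m"
  by (auto simp: frac_mem ac_one)

lemma frac_scale:
  assumes "m \<in> carrier N" "s \<in> S"
  shows "frac N ac S (ac s m) s = frac N ac S m \<one>"
proof -
  have *: "(n, t) \<in> frac N ac S (ac s m) s \<longleftrightarrow> (n, t) \<in> frac N ac S m \<one>" for n t
  proof -
    have "ac t (ac s m) = ac s (ac t m)" if "t \<in> S"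
      using that assms by (simp add: m_comm flip: ac_assoc)
    then show ?thesis using assms by (auto simp: frac_mem frac_one_mem ac_cancel ac_one)
  qed
  show ?thesis using * by auto
qed

lemma frac_rep: "m \<in> carrier N \<Longrightarrow> s \<in> S \<Longrightarrow> frac N ac S m s = frac N ac S (ac (inv s) m) \<one>"
  using frac_scale[of "ac (inv s) m" s] by (simp add: ac_inv)

lemma frac_inj: "m \<in> carrier N \<Longrightarrow> n \<in> carrier N \<Longrightarrow>
    frac N ac S m \<one> = frac N ac S n \<one> \<longleftrightarrow> m = n"
  using frac_one_mem[of m m \<one>] frac_one_mem[of n m \<one>] by (auto simp: ac_one)

text \<open>The representatives of \<open>m/1\<close> are the pairs \<open>(s m, s)\<close>. An
  operation given as a union over representatives is thus computed by evaluating it at such a pair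
  and letting \<open>s\<close> cancel; the pair \<open>(m, 1)\<close> shows that the union is not
  empty.\<close>

lemma UN_frac:
  assumes "m \<in> carrier N" "\<And>s. s \<in> S \<Longrightarrow> F (ac s m) s = C"
  shows "(\<Union>(n, s)\<in>frac N ac S m \<one>. F n s) = C"
proof -
  have "(\<Union>u\<in>frac N ac S m \<one>. case u of (n, s) \<Rightarrow> F n s) = (\<Union>u\<in>frac N ac S m \<one>. C)"
    using assms by (intro SUP_cong) (auto simp: frac_one_mem)
  moreover have "(m, \<one>) \<in> frac N ac S m \<one>" using assms by (simp add: frac_one_mem ac_one)
  ultimately show ?thesis by auto
qed

lemma frac_range: "{frac N ac S m s |m s. m \<in> carrier N \<and> s \<in> S} = (\<lambda>m. frac N ac S m \<one>) ` carrier N"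
proof (intro equalityI subsetI)
  fix x assume "x \<in> {frac N ac S m s |m s. m \<in> carrier N \<and> s \<in> S}"
  then obtain m s where "m \<in> carrier N" "s \<in> S" "x = frac N ac S m s" by blast
  then show "x \<in> (\<lambda>m. frac N ac S m \<one>) ` carrier N"
    using frac_rep[of m s] by (intro image_eqI[of _ _ "ac (inv s) m"]) auto
qed (use S_one in blast)

declare S_carrier [simp del]

end

section \<open>The spectrum as a single point\<close>

context pd_aug
begin

lemma one_not_zero: "\<one>\<^bsub>A\<^esub> \<noteq> \<zero>\<^bsub>A\<^esub>"
proof
  assume e: "\<one>\<^bsub>A\<^esub> = \<zero>\<^bsub>A\<^esub>"
  have "\<one>\<^bsub>K\<^esub> = \<zero>\<^bsub>K\<^esub>" by (rule inj_onD[OF sc_inj]) (simp_all add: e)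
  then show False using K.one_not_zero by simp
qed

lemma zero_part_unit:
  assumes "c \<in> zero_part A" "c \<noteq> \<zero>\<^bsub>A\<^esub>"
  obtains d where "d \<in> zero_part A" "c \<otimes>\<^bsub>A\<^esub> d = \<one>\<^bsub>A\<^esub>"
proof -
  obtain k where k: "k \<in> carrier K" "c = sc k" using assms(1) zero_part_sc by auto
  then have "k \<noteq> \<zero>\<^bsub>K\<^esub>" using assms(2) by auto
  then have u: "k \<in> Units K" using k K.field_Units by auto
  then have "c \<otimes>\<^bsub>A\<^esub> sc (inv\<^bsub>K\<^esub> k) = sc (k \<otimes>\<^bsub>K\<^esub> inv\<^bsub>K\<^esub> k)"
    using k u by (simp only: sc.hom_mult K.Units_inv_closed)
  then have "c \<otimes>\<^bsub>A\<^esub> sc (inv\<^bsub>K\<^esub> k) = \<one>\<^bsub>A\<^esub>"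
    using u by (simp only: K.Units_r_inv sc.hom_one)
  then show ?thesis using u that[of "sc (inv\<^bsub>K\<^esub> k)"] by simp
qed

abbreviation mx where "mx \<equiv> pos_part A"

text \<open>Taking the degree zero part is multiplicative with kernel \<open>mx\<close>, and its
  values lie in a copy of the field K, which has no zero divisors.\<close>

lemma mx_prime: "primeideal mx A"
proof (rule primeidealI[OF pos_part_ideal A.cring_axioms])
  show "carrier A \<noteq> mx"
    using one_not_zero deg_zero_ker[of "\<one>\<^bsub>A\<^esub>"] by auto
  fix a b assume ab: "a \<in> carrier A" "b \<in> carrier A" "a \<otimes>\<^bsub>A\<^esub> b \<in> mx"
  then have "deg_zero A a \<otimes>\<^bsub>A\<^esub> deg_zero A b = \<zero>\<^bsub>A\<^esub>"
    using deg_zero_mult[of a b] by simp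
  moreover have "deg_zero A a = \<zero>\<^bsub>A\<^esub>" if h: "deg_zero A a \<otimes>\<^bsub>A\<^esub> deg_zero A b = \<zero>\<^bsub>A\<^esub>" "deg_zero A b \<noteq> \<zero>\<^bsub>A\<^esub>"
  proof -
    obtain d where "d \<in> zero_part A" "deg_zero A b \<otimes>\<^bsub>A\<^esub> d = \<one>\<^bsub>A\<^esub>"
      using zero_part_unit[of "deg_zero A b"] h(2) ab by auto
    then have "deg_zero A a = deg_zero A a \<otimes>\<^bsub>A\<^esub> deg_zero A b \<otimes>\<^bsub>A\<^esub> d"
      using ab by (simp add: A.m_assoc)
    then show ?thesis using h(1) \<open>d \<in> zero_part A\<close> by simp
  qed
  ultimately show "a \<in> mx \<or> b \<in> mx"
    using ab deg_zero_ker[of a] deg_zero_ker[of b] by blast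
qed

abbreviation S where "S \<equiv> carrier A - mx"

text \<open>Since \<open>a^p\<close> is the p-th power of the constant part of \<open>a\<close>, and
  \<open>d\<close> inverts that constant part, the element \<open>a^(p-1) d^p\<close> inverts
  \<open>a\<close>.\<close>

lemma S_units: "S \<subseteq> Units A"
proof
  fix a assume a: "a \<in> S"
  then have "deg_zero A a \<noteq> \<zero>\<^bsub>A\<^esub>" by (simp add: deg_zero_ker)
  then obtain d where d: "d \<in> zero_part A" "deg_zero A a \<otimes>\<^bsub>A\<^esub> d = \<one>\<^bsub>A\<^esub>"
    using zero_part_unit[of "deg_zero A a"] a by auto
  obtain q where q: "p = Suc q" using A.p_gt_0 by (metis gr0_conv_Suc)
  have "a [^]\<^bsub>A\<^esub> p \<otimes>\<^bsub>A\<^esub> d [^]\<^bsub>A\<^esub> p = (deg_zero A a \<otimes>\<^bsub>A\<^esub> d) [^]\<^bsub>A\<^esub> p"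
    using a d(1) by (simp add: A.nat_pow_distrib pow_p_deg_zero[of a])
  then have "a [^]\<^bsub>A\<^esub> p \<otimes>\<^bsub>A\<^esub> d [^]\<^bsub>A\<^esub> p = \<one>\<^bsub>A\<^esub>"
    by (simp only: d A.nat_pow_one)
  then have e: "a \<otimes>\<^bsub>A\<^esub> (a [^]\<^bsub>A\<^esub> q \<otimes>\<^bsub>A\<^esub> d [^]\<^bsub>A\<^esub> p) = \<one>\<^bsub>A\<^esub>"
    using a d unfolding q by (simp add: A.m_ac)
  have c: "a [^]\<^bsub>A\<^esub> q \<otimes>\<^bsub>A\<^esub> d [^]\<^bsub>A\<^esub> p \<in> carrier A" using a d by simp
  then have "(a [^]\<^bsub>A\<^esub> q \<otimes>\<^bsub>A\<^esub> d [^]\<^bsub>A\<^esub> p) \<otimes>\<^bsub>A\<^esub> a = \<one>\<^bsub>A\<^esub>"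
    using e a by (simp add: A.m_comm)
  then show "a \<in> Units A" using e c a unfolding Units_def by blast
qed

lemma primeideal_iff: "primeideal P A \<longleftrightarrow> P = mx"
proof
  assume "primeideal P A"
  then interpret P: primeideal P A .
  have pow: "x \<in> P" if "x [^]\<^bsub>A\<^esub> n \<in> P" "x \<in> carrier A" for x and n :: nat
    using that
  proof (induction n)
    case 0
    then have "carrier A = P" using P.one_imp_carrier by simp
    then show ?case using 0 by simp
  next
    case (Suc n)
    then show ?case using P.I_prime[of "x [^]\<^bsub>A\<^esub> n" x] by auto
  qed
  have "mx \<subseteq> P"
  proof
    fix x assume "x \<in> mx"
    then show "x \<in> P" using pow[of x p] by (simp add: pos_part_pow)
  qed
  moreover have "P \<subseteq> mx"
  proof
    fix a assume a: "a \<in> P"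
    show "a \<in> mx"
    proof (rule ccontr)
      assume "a \<notin> mx"
      then have "a \<in> Units A" using S_units a P.Icarr by auto
      then have "inv\<^bsub>A\<^esub> a \<otimes>\<^bsub>A\<^esub> a \<in> P" using a by (intro P.I_l_closed) auto
      then have "\<one>\<^bsub>A\<^esub> \<in> P" using \<open>a \<in> Units A\<close> by simp
      then show False using P.one_imp_carrier P.I_notcarr by simp
    qed
  qed
  ultimately show "P = mx" by simp
qed (simp add: mx_prime)

abbreviation X0 where "X0 \<equiv> {mx}"

lemma openin_Spec: "openin (Spec A) U \<longleftrightarrow> U = {} \<or> U = X0"
proof -
  have b: "basic_open A f = (if f \<in> mx then {} else X0)" for f
    by (auto simp: basic_open_def primeideal_iff)
  have "\<one>\<^bsub>A\<^esub> \<notin> mx"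
    using one_not_zero deg_zero_ker[of "\<one>\<^bsub>A\<^esub>"] by simp
  then have t: "topspace (Spec A) = X0"
    unfolding Spec_def topology_generated_by_topspace by (auto simp: b split: if_splits)
  show ?thesis
  proof
    assume "openin (Spec A) U"
    then have "U \<subseteq> X0" using openin_subset t by fastforce
    then show "U = {} \<or> U = X0" by auto
  next
    assume "U = {} \<or> U = X0"
    then show "openin (Spec A) U" using openin_topspace[of "Spec A"] by (auto simp: t)
  qed
qed

lemma Om_prime_group: "abelian_group (Q\<lparr>carrier := rho ` II\<rparr>)"
  by (rule abelian_group_cong[OF Om_group]) (simp_all add: Om_simps)

lemma A_act_Om: "a \<in> carrier A \<Longrightarrow> z \<in> carrier Om \<Longrightarrow> A_act A Om a z = act a z"
proof -
  assume az: "a \<in> carrier A" "z \<in> carrier Om"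
  have "monom (UP A) a 0 \<odot>\<^bsub>V_module A (Q\<lparr>carrier := rho ` II\<rparr>) act Pop\<^esub> z = act a ((Pop ^^ 0) z)"
    using az act_closed[OF az] act_simps(5)[OF az(2)]
    by (intro V_module_monom[OF Om_prime_group]) (simp_all add: Om_simps)
  then show ?thesis by (simp add: A_act_def V_of_def Omega_eq)
qed

lemma P_act_Om: "z \<in> carrier Om \<Longrightarrow> P_act A Om z = Pop z"
proof -
  assume z: "z \<in> carrier Om"
  have "monom (UP A) \<one>\<^bsub>A\<^esub> 1 \<odot>\<^bsub>V_module A (Q\<lparr>carrier := rho ` II\<rparr>) act Pop\<^esub> z = act \<one>\<^bsub>A\<^esub> ((Pop ^^ 1) z)"
    using Pop_closed[OF z] act_simps(4)[OF Pop_closed[OF z]] one_not_zero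
    by (intro V_module_monom[OF Om_prime_group]) (simp_all add: Om_simps)
  then show ?thesis using act_simps(4)[OF Pop_closed[OF z]] by (simp add: P_act_def V_P_def Omega_eq)
qed

lemma S_mult: "s \<in> S \<Longrightarrow> t \<in> S \<Longrightarrow> s \<otimes>\<^bsub>A\<^esub> t \<in> S"
  using primeideal.I_prime[OF mx_prime, of s t] by auto

lemma S_one: "\<one>\<^bsub>A\<^esub> \<in> S"
  using one_not_zero deg_zero_ker[of "\<one>\<^bsub>A\<^esub>"] by simp

sublocale fA: unit_frac A A "mult A" "carrier A - pos_part A"
  using S_units S_mult S_one
  by (intro unit_frac.intro unit_frac_axioms.intro A.cring_axioms) (auto simp: A.m_assoc)

sublocale fO: unit_frac A "Omega K p A" "A_act A (Omega K p A)" "carrier A - pos_part A"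
  using S_units S_mult S_one
  by (intro unit_frac.intro unit_frac_axioms.intro A.cring_axioms) (auto simp: A_act_Om act_simps)

end

section \<open>Sections over the spectrum\<close>

context pd_aug
begin

section \<open>Localization at the units\<close>

abbreviation iota where "iota a \<equiv> Defs.frac A (mult A) S a \<one>\<^bsub>A\<^esub>"
abbreviation io where "io z \<equiv> Defs.frac Om (A_act A Om) S z \<one>\<^bsub>A\<^esub>"
abbreviation LA where "LA \<equiv> loc_alg p A S"
abbreviation LM where "LM \<equiv> loc_module p A Om S"
abbreviation LG where "LG \<equiv> loc_group A Om S"

lemma S_pow: "s \<in> S \<Longrightarrow> s [^]\<^bsub>A\<^esub> n \<in> S" for n :: nat
  by (induction n) (use S_one S_mult in auto)

lemma LA_one: "\<one>\<^bsub>LA\<^esub> = iota \<one>\<^bsub>A\<^esub>" and LA_zero: "\<zero>\<^bsub>LA\<^esub> = iota \<zero>\<^bsub>A\<^esub>"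
  by (simp_all add: loc_alg_def Let_def)

text \<open>By \<open>fA.UN_frac\<close> it suffices to evaluate at representatives
  \<open>(s a, s)\<close> and \<open>(t b, t)\<close>, where \<open>s t\<close> cancels between
  numerator and denominator. Addition and scalar multiplication follow the same pattern.\<close>

lemma LA_mult:
  assumes ab: "a \<in> carrier A" "b \<in> carrier A"
  shows "iota a \<otimes>\<^bsub>LA\<^esub> iota b = iota (a \<otimes>\<^bsub>A\<^esub> b)"
proof -
  have "Defs.frac A (mult A) S ((s \<otimes>\<^bsub>A\<^esub> a) \<otimes>\<^bsub>A\<^esub> (t \<otimes>\<^bsub>A\<^esub> b)) (s \<otimes>\<^bsub>A\<^esub> t) = iota (a \<otimes>\<^bsub>A\<^esub> b)"
    if st: "s \<in> S" "t \<in> S" for s t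
  proof -
    have "(s \<otimes>\<^bsub>A\<^esub> a) \<otimes>\<^bsub>A\<^esub> (t \<otimes>\<^bsub>A\<^esub> b) = (s \<otimes>\<^bsub>A\<^esub> t) \<otimes>\<^bsub>A\<^esub> (a \<otimes>\<^bsub>A\<^esub> b)"
      using ab st by (simp add: A.m_ac)
    then show ?thesis using fA.frac_scale[of "a \<otimes>\<^bsub>A\<^esub> b" "s \<otimes>\<^bsub>A\<^esub> t"] ab S_mult[OF st] by simp
  qed
  then show ?thesis
    using ab by (simp add: loc_alg_def Let_def) (intro fA.UN_frac; simp)
qed

lemma LA_add:
  assumes ab: "a \<in> carrier A" "b \<in> carrier A"
  shows "iota a \<oplus>\<^bsub>LA\<^esub> iota b = iota (a \<oplus>\<^bsub>A\<^esub> b)"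
proof -
  have "Defs.frac A (mult A) S (t \<otimes>\<^bsub>A\<^esub> (s \<otimes>\<^bsub>A\<^esub> a) \<oplus>\<^bsub>A\<^esub> s \<otimes>\<^bsub>A\<^esub> (t \<otimes>\<^bsub>A\<^esub> b)) (s \<otimes>\<^bsub>A\<^esub> t) = iota (a \<oplus>\<^bsub>A\<^esub> b)"
    if st: "s \<in> S" "t \<in> S" for s t
  proof -
    have "t \<otimes>\<^bsub>A\<^esub> (s \<otimes>\<^bsub>A\<^esub> a) \<oplus>\<^bsub>A\<^esub> s \<otimes>\<^bsub>A\<^esub> (t \<otimes>\<^bsub>A\<^esub> b) = (s \<otimes>\<^bsub>A\<^esub> t) \<otimes>\<^bsub>A\<^esub> (a \<oplus>\<^bsub>A\<^esub> b)"
      using ab st by (simp add: A.m_ac A.r_distr)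
    then show ?thesis using fA.frac_scale[of "a \<oplus>\<^bsub>A\<^esub> b" "s \<otimes>\<^bsub>A\<^esub> t"] ab S_mult[OF st] by simp
  qed
  then show ?thesis
    using ab by (simp add: loc_alg_def Let_def) (intro fA.UN_frac; simp)
qed

lemma LA_smult:
  assumes ca: "c \<in> carrier K" "a \<in> carrier A"
  shows "c \<odot>\<^bsub>LA\<^esub> iota a = iota (c \<odot>\<^bsub>A\<^esub> a)"
proof -
  have "Defs.frac A (mult A) S (c \<odot>\<^bsub>A\<^esub> (s \<otimes>\<^bsub>A\<^esub> a)) s = iota (c \<odot>\<^bsub>A\<^esub> a)" if s: "s \<in> S" for s
  proof -
    have "c \<odot>\<^bsub>A\<^esub> (s \<otimes>\<^bsub>A\<^esub> a) = s \<otimes>\<^bsub>A\<^esub> (c \<odot>\<^bsub>A\<^esub> a)"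
      using ca s by (simp add: smult_eq_sc A.m_ac)
    then show ?thesis using fA.frac_scale[of "c \<odot>\<^bsub>A\<^esub> a" s] ca s by simp
  qed
  then show ?thesis
    using ca by (simp add: loc_alg_def Let_def) (intro fA.UN_frac; simp)
qed

lemma inv_zero_part:
  assumes "s \<in> S" "s \<in> zero_part A"
  shows "inv\<^bsub>A\<^esub> s \<in> zero_part A"
proof -
  have "s \<noteq> \<zero>\<^bsub>A\<^esub>" using assms by auto
  then obtain d where d: "d \<in> zero_part A" "s \<otimes>\<^bsub>A\<^esub> d = \<one>\<^bsub>A\<^esub>" using zero_part_unit assms by blast
  then have "inv\<^bsub>A\<^esub> s = d" using assms by (intro A.comm_inv_char) auto
  then show ?thesis using d by simp
qed

lemma LA_zero_part: "zero_part LA = iota ` zero_part A"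
proof -
  have "{Defs.frac A (mult A) S a s |a s. a \<in> zero_part A \<and> s \<in> S \<inter> zero_part A} = iota ` zero_part A"
  proof (intro equalityI subsetI)
    fix x assume "x \<in> {Defs.frac A (mult A) S a s |a s. a \<in> zero_part A \<and> s \<in> S \<inter> zero_part A}"
    then obtain a s where as: "a \<in> zero_part A" "s \<in> S" "s \<in> zero_part A" "x = Defs.frac A (mult A) S a s" by blast
    then have "inv\<^bsub>A\<^esub> s \<otimes>\<^bsub>A\<^esub> a \<in> zero_part A"
      using inv_zero_part subringE(6)[OF zero_part_subring] by blast
    moreover have "x = iota (inv\<^bsub>A\<^esub> s \<otimes>\<^bsub>A\<^esub> a)"
      using as fA.frac_rep[of a s] by simp
    ultimately show "x \<in> iota ` zero_part A" by blast
  qed (use S_one one_zero_part in blast)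
  then show ?thesis by (simp add: loc_alg_def Let_def)
qed

lemma LA_pos_part: "pos_part LA = iota ` mx"
proof -
  have "{Defs.frac A (mult A) S a s |a s. a \<in> mx \<and> s \<in> S} = iota ` mx"
  proof (intro equalityI subsetI)
    fix x assume "x \<in> {Defs.frac A (mult A) S a s |a s. a \<in> mx \<and> s \<in> S}"
    then obtain a s where as: "a \<in> mx" "s \<in> S" "x = Defs.frac A (mult A) S a s" by blast
    then have "inv\<^bsub>A\<^esub> s \<otimes>\<^bsub>A\<^esub> a \<in> mx" by (intro pos_mult fA.S_inv)
    moreover have "x = iota (inv\<^bsub>A\<^esub> s \<otimes>\<^bsub>A\<^esub> a)"
      using as fA.frac_rep[of a s] by simp
    ultimately show "x \<in> iota ` mx" by blast
  qed (use S_one in blast)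
  then show ?thesis by (simp add: loc_alg_def Let_def)
qed

text \<open>When \<open>x\<close> is positive, all representatives have positive numerators, so the
  restricted union runs over the whole fraction. The denominators need not be constants, hence
  \<open>pmap_scale'\<close> in place of the axiom.\<close>

lemma LA_pmap:
  assumes x: "x \<in> mx"
  shows "pmap LA (iota x) = iota (pmap A x)"
proof -
  have xc: "x \<in> carrier A" using x by simp
  have "{(a, s). (a, s) \<in> iota x \<and> a \<in> mx} = iota x"
    using x xc by (auto simp: fA.frac_one_mem)
  moreover have "(\<Union>(a, s)\<in>iota x. Defs.frac A (mult A) S (pmap A a) (s [^]\<^bsub>A\<^esub> p)) = iota (pmap A x)"
  proof (rule fA.UN_frac[OF xc])
    fix s assume s: "s \<in> S"
    show "Defs.frac A (mult A) S (pmap A (s \<otimes>\<^bsub>A\<^esub> x)) (s [^]\<^bsub>A\<^esub> p) = iota (pmap A x)"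
      using fA.frac_scale[of "pmap A x" "s [^]\<^bsub>A\<^esub> p"] x s S_pow[OF s, of p] by (simp add: pmap_scale')
  qed
  ultimately show ?thesis by (simp add: loc_alg_def Let_def)
qed

lemma iota_inj: "a \<in> carrier A \<Longrightarrow> b \<in> carrier A \<Longrightarrow> iota a = iota b \<longleftrightarrow> a = b"
  by (rule fA.frac_inj)

lemma LG_carrier: "carrier LG = io ` carrier Om" and LG_zero: "\<zero>\<^bsub>LG\<^esub> = io \<zero>\<^bsub>Om\<^esub>"
  using fO.frac_range by (simp_all add: loc_group_def Let_def)

lemma LG_add:
  assumes xy: "x \<in> carrier Om" "y \<in> carrier Om"
  shows "io (x \<oplus>\<^bsub>Om\<^esub> y) = io x \<oplus>\<^bsub>LG\<^esub> io y"
proof -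
  have "Defs.frac Om (A_act A Om) S (A_act A Om t (A_act A Om s x) \<oplus>\<^bsub>Om\<^esub> A_act A Om s (A_act A Om t y)) (s \<otimes>\<^bsub>A\<^esub> t)
      = io (x \<oplus>\<^bsub>Om\<^esub> y)"
    if st: "s \<in> S" "t \<in> S" for s t
  proof -
    have "act t (act s x) \<oplus>\<^bsub>Om\<^esub> act s (act t y) = act (s \<otimes>\<^bsub>A\<^esub> t) (x \<oplus>\<^bsub>Om\<^esub> y)"
    proof -
      have "act t (act s x) = act (t \<otimes>\<^bsub>A\<^esub> s) x" "act s (act t y) = act (s \<otimes>\<^bsub>A\<^esub> t) y"
        using xy st by (simp_all add: act_simps(3))
      moreover have "t \<otimes>\<^bsub>A\<^esub> s = s \<otimes>\<^bsub>A\<^esub> t" using st by (simp add: A.m_comm)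
      ultimately show ?thesis using xy st by (simp add: act_simps(1))
    qed
    then have "A_act A Om t (A_act A Om s x) \<oplus>\<^bsub>Om\<^esub> A_act A Om s (A_act A Om t y) = A_act A Om (s \<otimes>\<^bsub>A\<^esub> t) (x \<oplus>\<^bsub>Om\<^esub> y)"
      using xy st by (simp add: A_act_Om)
    then show ?thesis using fO.frac_scale[of "x \<oplus>\<^bsub>Om\<^esub> y" "s \<otimes>\<^bsub>A\<^esub> t"] xy S_mult[OF st] by simp
  qed
  then have "(\<Union>(m, s)\<in>io x. \<Union>(n, t)\<in>io y. Defs.frac Om (A_act A Om) S
      (A_act A Om t m \<oplus>\<^bsub>Om\<^esub> A_act A Om s n) (s \<otimes>\<^bsub>A\<^esub> t)) = io (x \<oplus>\<^bsub>Om\<^esub> y)"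
    using xy by (intro fO.UN_frac; simp)
  then show ?thesis by (simp add: loc_group_def Let_def)
qed

definition lact where "lact = (\<lambda>x y. \<Union>(a, s)\<in>x. \<Union>(m, t)\<in>y.
  Defs.frac Om (A_act A Om) S (A_act A Om a m) (s \<otimes>\<^bsub>A\<^esub> t))"
definition lP where "lP = (\<lambda>y. \<Union>(m, s)\<in>y. Defs.frac Om (A_act A Om) S (P_act A Om m) (s [^]\<^bsub>A\<^esub> p))"

lemma LM_eq: "LM = V_module LA LG lact lP"
  by (simp add: loc_module_def Let_def lact_def lP_def)

lemma lact_io:
  assumes az: "a \<in> carrier A" "z \<in> carrier Om"
  shows "lact (iota a) (io z) = io (act a z)"
proof -
  have "Defs.frac Om (A_act A Om) S (A_act A Om (s \<otimes>\<^bsub>A\<^esub> a) (A_act A Om t z)) (s \<otimes>\<^bsub>A\<^esub> t) = io (act a z)"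
    if st: "s \<in> S" "t \<in> S" for s t
  proof -
    have "A_act A Om (s \<otimes>\<^bsub>A\<^esub> a) (A_act A Om t z) = act ((s \<otimes>\<^bsub>A\<^esub> a) \<otimes>\<^bsub>A\<^esub> t) z"
      using az st by (simp add: A_act_Om act_simps)
    also have "(s \<otimes>\<^bsub>A\<^esub> a) \<otimes>\<^bsub>A\<^esub> t = (s \<otimes>\<^bsub>A\<^esub> t) \<otimes>\<^bsub>A\<^esub> a"
      using az st by (simp add: A.m_ac)
    finally have "A_act A Om (s \<otimes>\<^bsub>A\<^esub> a) (A_act A Om t z) = A_act A Om (s \<otimes>\<^bsub>A\<^esub> t) (act a z)"
      using az st by (simp add: A_act_Om act_simps)
    then show ?thesis using fO.frac_scale[of "act a z" "s \<otimes>\<^bsub>A\<^esub> t"] az S_mult[OF st] by simp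
  qed
  then have "(\<Union>(m, t)\<in>io z. Defs.frac Om (A_act A Om) S (A_act A Om (s \<otimes>\<^bsub>A\<^esub> a) m) (s \<otimes>\<^bsub>A\<^esub> t)) = io (act a z)"
    if "s \<in> S" for s
    using az that by (intro fO.UN_frac) auto
  then show ?thesis
    unfolding lact_def using az by (intro fA.UN_frac) auto
qed

lemma lP_io:
  assumes z: "z \<in> carrier Om"
  shows "lP (io z) = io (Pop z)"
proof -
  have "Defs.frac Om (A_act A Om) S (P_act A Om (A_act A Om s z)) (s [^]\<^bsub>A\<^esub> p) = io (Pop z)" if s: "s \<in> S" for s
  proof -
    have "P_act A Om (A_act A Om s z) = A_act A Om (s [^]\<^bsub>A\<^esub> p) (Pop z)"
      using z s by (simp add: A_act_Om P_act_Om Pop_act)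
    then show ?thesis using fO.frac_scale[of "Pop z" "s [^]\<^bsub>A\<^esub> p"] z S_pow[OF s] by simp
  qed
  then show ?thesis
    unfolding lP_def using z by (intro fO.UN_frac) auto
qed

lemma Pop_iter_closed [simp]: "z \<in> carrier Om \<Longrightarrow> (Pop ^^ n) z \<in> carrier Om"
  by (induction n) auto

lemma lP_iter: "z \<in> carrier Om \<Longrightarrow> (lP ^^ n) (io z) = io ((Pop ^^ n) z)"
  by (induction n) (auto simp: lP_io)

text \<open>The action of the element of \<open>V(A)\<close> with coefficients \<open>b\<close> on
  \<open>I/I^2\<close>, computed over A itself; actions on fractions and on sections are reduced to
  it.\<close>

definition vsum where "vsum b z = (\<Oplus>\<^bsub>Om\<^esub>i\<in>{i. b i \<noteq> \<zero>\<^bsub>A\<^esub>}. act (b i) ((Pop ^^ i) z))"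

lemma vsum_superset:
  assumes "finite F" "{i. b i \<noteq> \<zero>\<^bsub>A\<^esub>} \<subseteq> F" "\<And>i. b i \<in> carrier A" "z \<in> carrier Om"
  shows "vsum b z = (\<Oplus>\<^bsub>Om\<^esub>i\<in>F. act (b i) ((Pop ^^ i) z))"
  unfolding vsum_def using assms
  by (intro Om.add.finprod_mono_neutral_cong_left) (auto simp: act_simps)

lemma vsum_closed: "(\<And>i. b i \<in> carrier A) \<Longrightarrow> z \<in> carrier Om \<Longrightarrow> vsum b z \<in> carrier Om"
  unfolding vsum_def by (intro Om.finsum_closed) auto

lemma LM_smult:
  assumes b: "\<And>i. b i \<in> carrier A" and fin: "finite {i. b i \<noteq> \<zero>\<^bsub>A\<^esub>}" and z: "z \<in> carrier Om"
  shows "(\<lambda>i. iota (b i)) \<odot>\<^bsub>LM\<^esub> io z = io (vsum b z)"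
proof -
  have s: "{i. iota (b i) \<noteq> \<zero>\<^bsub>LA\<^esub>} = {i. b i \<noteq> \<zero>\<^bsub>A\<^esub>}"
    using b by (auto simp: LA_zero iota_inj)
  have "(\<lambda>i. iota (b i)) \<odot>\<^bsub>LM\<^esub> io z =
      (\<Oplus>\<^bsub>LG\<^esub>i\<in>{i. iota (b i) \<noteq> \<zero>\<^bsub>LA\<^esub>}. lact (iota (b i)) ((lP ^^ i) (io z)))"
    by (simp add: LM_eq V_module_def)
  also have "\<dots> = (\<Oplus>\<^bsub>LG\<^esub>i\<in>{i. b i \<noteq> \<zero>\<^bsub>A\<^esub>}. io (act (b i) ((Pop ^^ i) z)))"
    using b z unfolding s by (simp add: lP_iter lact_io)
  also have "\<dots> = io (vsum b z)"
    unfolding vsum_def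
    by (rule finsum_image[OF Om_group LG_carrier LG_add LG_zero[symmetric] fin]) (use b z in auto)
  finally show ?thesis .
qed

lemma LM_minus: "x \<in> carrier Om \<Longrightarrow> y \<in> carrier Om \<Longrightarrow> io x \<ominus>\<^bsub>LM\<^esub> io y = io (x \<ominus>\<^bsub>Om\<^esub> y)"
proof (rule minus_image[OF Om_group])
  show "carrier LM = io ` carrier Om" by (simp add: LM_eq V_module_def LG_carrier)
  show "io \<zero>\<^bsub>Om\<^esub> = \<zero>\<^bsub>LM\<^esub>" by (simp add: LM_eq V_module_def LG_zero)
  show "\<And>x y. x \<in> carrier Om \<Longrightarrow> y \<in> carrier Om \<Longrightarrow> io (x \<oplus>\<^bsub>Om\<^esub> y) = io x \<oplus>\<^bsub>LM\<^esub> io y"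
    by (simp add: LM_eq V_module_def LG_add)
qed

text \<open>At the representative \<open>(s a, s)\<close> the quotient rule reads
  \<open>d(s a)/s - s a d(s)/s^2\<close>, and the Leibniz rule leaves \<open>d(a)\<close>.\<close>

lemma d_loc_iota:
  assumes a: "a \<in> carrier A"
  shows "d_loc K p A S (iota a) = io (dA a)"
proof -
  have "Defs.frac Om (A_act A Om) S (dA (s \<otimes>\<^bsub>A\<^esub> a)) s \<ominus>\<^bsub>LM\<^esub>
      Defs.frac Om (A_act A Om) S (A_act A Om (s \<otimes>\<^bsub>A\<^esub> a) (dA s)) (s \<otimes>\<^bsub>A\<^esub> s) = io (dA a)"
    if s: "s \<in> S" for s
  proof -
    have sc: "s \<in> carrier A" "inv\<^bsub>A\<^esub> s \<in> carrier A" using s by auto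
    have si: "s \<otimes>\<^bsub>A\<^esub> inv\<^bsub>A\<^esub> s = \<one>\<^bsub>A\<^esub>" using s S_units by auto
    \<comment> \<open>This is \<open>(a/s) d(s)\<close>: the excess of \<open>d(s a)/s\<close> over
      \<open>d(a)\<close>, and also the value of the fraction that is subtracted.\<close>
    define e where "e = act (inv\<^bsub>A\<^esub> s \<otimes>\<^bsub>A\<^esub> a) (dA s)"
    have ec: "e \<in> carrier Om" using sc a by (simp add: e_def)
    have se: "act s e = act a (dA s)"
      using sc a by (simp add: e_def si flip: act_simps(3) A.m_assoc)
    have "dA (s \<otimes>\<^bsub>A\<^esub> a) = A_act A Om s (dA a \<oplus>\<^bsub>Om\<^esub> e)"
      using sc a ec by (simp add: dA_mult A_act_Om act_simps(1) se)
    then have 1: "Defs.frac Om (A_act A Om) S (dA (s \<otimes>\<^bsub>A\<^esub> a)) s = io (dA a \<oplus>\<^bsub>Om\<^esub> e)"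
      using fO.frac_scale[of "dA a \<oplus>\<^bsub>Om\<^esub> e" s] a ec s by simp
    have "A_act A Om (s \<otimes>\<^bsub>A\<^esub> a) (dA s) = A_act A Om (s \<otimes>\<^bsub>A\<^esub> s) e"
      using sc a ec by (simp add: A_act_Om act_simps(3) se)
    then have 2: "Defs.frac Om (A_act A Om) S (A_act A Om (s \<otimes>\<^bsub>A\<^esub> a) (dA s)) (s \<otimes>\<^bsub>A\<^esub> s) = io e"
      using fO.frac_scale[of e "s \<otimes>\<^bsub>A\<^esub> s"] ec S_mult[OF s s] by simp
    have "(dA a \<oplus>\<^bsub>Om\<^esub> e) \<ominus>\<^bsub>Om\<^esub> e = dA a"
      using a ec by (simp add: Om.minus_eq Om.a_assoc Om.r_neg)
    then show ?thesis
      unfolding 1 2 using a ec by (simp add: LM_minus)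
  qed
  then show ?thesis
    unfolding d_loc_def Let_def using a by (intro fA.UN_frac) auto
qed

text \<open>A neighbourhood of the only point is the whole space, so a section is a single fraction,
  and its denominator is a unit that can be absorbed into the numerator.\<close>

lemma frac_sections_X0:
  assumes "unit_frac A N ac S"
  shows "frac_sections A N ac X0 = (\<lambda>m. \<lambda>P\<in>X0. Defs.frac N ac S m \<one>\<^bsub>A\<^esub>) ` carrier N"
proof -
  interpret f: unit_frac A N ac S by fact
  show ?thesis
  proof (intro equalityI subsetI)
    fix s assume s: "s \<in> frac_sections A N ac X0"
    have "\<forall>P\<in>X0. \<exists>W m f. openin (Spec A) W \<and> P \<in> W \<and> W \<subseteq> X0 \<and> m \<in> carrier N \<and> f \<in> carrier A \<and>
       (\<forall>P'\<in>W. f \<notin> P' \<and> s P' = Defs.frac N ac (carrier A - P') m f)"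
      using s unfolding frac_sections_def mem_Collect_eq by (rule conjunct2)
    from bspec[OF this singletonI]
    obtain W m f where W: "mx \<in> W" "m \<in> carrier N" "f \<in> carrier A"
      and sW: "\<forall>P\<in>W. f \<notin> P \<and> s P = Defs.frac N ac (carrier A - P) m f"
      by (elim exE conjE)
    from bspec[OF sW W(1)] W(3) have f: "f \<in> S" and sm: "s mx = Defs.frac N ac S m f" by simp_all
    have "s = (\<lambda>P\<in>X0. Defs.frac N ac S (ac (inv\<^bsub>A\<^esub> f) m) \<one>\<^bsub>A\<^esub>)"
    proof (rule extensionalityI[of _ X0])
      show "s \<in> extensional X0" using s by (simp add: frac_sections_def)
      show "s P = (\<lambda>P\<in>X0. Defs.frac N ac S (ac (inv\<^bsub>A\<^esub> f) m) \<one>\<^bsub>A\<^esub>) P" if "P \<in> X0" for P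
        using that sm f.frac_rep[OF W(2) f] by simp
    qed simp
    moreover have "ac (inv\<^bsub>A\<^esub> f) m \<in> carrier N" using f W(2) by (intro f.ac_closed f.S_inv)
    ultimately show "s \<in> (\<lambda>m. \<lambda>P\<in>X0. Defs.frac N ac S m \<one>\<^bsub>A\<^esub>) ` carrier N" by blast
  next
    fix s assume "s \<in> (\<lambda>m. \<lambda>P\<in>X0. Defs.frac N ac S m \<one>\<^bsub>A\<^esub>) ` carrier N"
    then obtain m where m: "m \<in> carrier N" "s = (\<lambda>P\<in>X0. Defs.frac N ac S m \<one>\<^bsub>A\<^esub>)" by blast
    have "\<exists>W n f. openin (Spec A) W \<and> P \<in> W \<and> W \<subseteq> X0 \<and> n \<in> carrier N \<and> f \<in> carrier A \<and>
       (\<forall>P'\<in>W. f \<notin> P' \<and> s P' = Defs.frac N ac (carrier A - P') n f)" if "P \<in> X0" for P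
      using that m S_one by (intro exI[of _ X0] exI[of _ m] exI[of _ "\<one>\<^bsub>A\<^esub>"]) (auto simp: openin_Spec)
    then show "s \<in> frac_sections A N ac X0"
      unfolding frac_sections_def using m(2) by auto
  qed
qed

lemma frac_sections_empty: "frac_sections A N ac {} = {\<lambda>_. undefined}"
  by (auto simp: frac_sections_def)

section \<open>The sections over the whole space\<close>

definition glob where "glob a = (\<lambda>P\<in>X0. iota a)"
definition globO where "globO z = (\<lambda>P\<in>X0. io z)"
abbreviation R1 where "R1 \<equiv> O_sections p A X0"
abbreviation N1 where "N1 \<equiv> tilde_sections p A Om X0"

lemma glob_mx [simp]: "glob a mx = iota a" and globO_mx [simp]: "globO z mx = io z"
  by (simp_all add: glob_def globO_def)

lemma glob_inj: "inj_on glob (carrier A)"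
  by (rule inj_onI) (metis glob_mx iota_inj)

lemma globO_inj: "inj_on globO (carrier Om)"
  by (rule inj_onI) (metis globO_mx fO.frac_inj)

lemma R1_carrier: "carrier R1 = glob ` carrier A"
  using frac_sections_X0[OF fA.unit_frac_axioms]
  by (simp add: O_sections_def Let_def glob_def[abs_def])

lemma N1_carrier: "carrier N1 = globO ` carrier Om"
  using frac_sections_X0[OF fO.unit_frac_axioms]
  by (simp add: tilde_sections_def globO_def[abs_def])

lemma R1_sets:
  assumes "Y \<subseteq> carrier A"
  shows "{s \<in> carrier R1. \<forall>P\<in>X0. s P \<in> iota ` Y} = glob ` Y"
proof (intro equalityI subsetI)
  fix s assume "s \<in> {s \<in> carrier R1. \<forall>P\<in>X0. s P \<in> iota ` Y}"
  then obtain a b where a: "a \<in> carrier A" "s = glob a" "b \<in> Y" "iota a = iota b"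
    by (auto simp: R1_carrier)
  then have "a = b" using iota_inj[of a b] assms by blast
  then show "s \<in> glob ` Y" using a by simp
next
  fix s assume "s \<in> glob ` Y"
  then show "s \<in> {s \<in> carrier R1. \<forall>P\<in>X0. s P \<in> iota ` Y}"
    using assms by (auto simp: R1_carrier)
qed

lemma R1_carrier_def: "carrier R1 = frac_sections A A (mult A) X0"
  by (simp add: O_sections_def Let_def)

lemma R1_zero_part: "zero_part R1 = glob ` zero_part A"
proof -
  have "zero_part R1 = {s \<in> carrier R1. \<forall>P\<in>X0. s P \<in> iota ` zero_part A}"
    unfolding R1_carrier_def LA_zero_part[symmetric]
    by (simp add: O_sections_def Let_def stalk_alg_def)
  moreover have "zero_part A \<subseteq> carrier A" using zero_carrier by blast
  ultimately show ?thesis using R1_sets[of "zero_part A"] by simp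
qed

lemma R1_pos_part: "pos_part R1 = glob ` mx"
proof -
  have "pos_part R1 = {s \<in> carrier R1. \<forall>P\<in>X0. s P \<in> iota ` mx}"
    unfolding R1_carrier_def LA_pos_part[symmetric]
    by (simp add: O_sections_def Let_def stalk_alg_def)
  moreover have "mx \<subseteq> carrier A" using pos_carrier by blast
  ultimately show ?thesis using R1_sets[of mx] by simp
qed

lemma R1_ops:
  "a \<in> carrier A \<Longrightarrow> b \<in> carrier A \<Longrightarrow> glob (a \<oplus>\<^bsub>A\<^esub> b) = glob a \<oplus>\<^bsub>R1\<^esub> glob b"
  "a \<in> carrier A \<Longrightarrow> b \<in> carrier A \<Longrightarrow> glob (a \<otimes>\<^bsub>A\<^esub> b) = glob a \<otimes>\<^bsub>R1\<^esub> glob b"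
  "glob \<one>\<^bsub>A\<^esub> = \<one>\<^bsub>R1\<^esub>" "glob \<zero>\<^bsub>A\<^esub> = \<zero>\<^bsub>R1\<^esub>"
  "c \<in> carrier K \<Longrightarrow> a \<in> carrier A \<Longrightarrow> glob (c \<odot>\<^bsub>A\<^esub> a) = c \<odot>\<^bsub>R1\<^esub> glob a"
  "x \<in> mx \<Longrightarrow> pmap R1 (glob x) = glob (pmap A x)"
  by (auto simp: glob_def[abs_def] O_sections_def Let_def stalk_alg_def LA_add LA_mult LA_one LA_zero
      LA_smult LA_pmap fun_eq_iff)

lemma R1_pd: "pd_char K R1 p"
  by (rule pdCom_transport[OF glob_inj R1_carrier R1_ops(1-5) R1_zero_part R1_pos_part R1_ops(6)])

lemma N1_ops:
  "x \<in> carrier Om \<Longrightarrow> y \<in> carrier Om \<Longrightarrow> globO (x \<oplus>\<^bsub>Om\<^esub> y) = globO x \<oplus>\<^bsub>N1\<^esub> globO y"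
  by (auto simp: globO_def[abs_def] tilde_sections_def stalk_module_def LM_eq V_module_def LG_add fun_eq_iff)

lemma N1_smult:
  assumes "\<And>i. b i \<in> carrier A" "finite {i. b i \<noteq> \<zero>\<^bsub>A\<^esub>}" "z \<in> carrier Om"
  shows "(\<lambda>i. glob (b i)) \<odot>\<^bsub>N1\<^esub> globO z = globO (vsum b z)"
  using LM_smult[OF assms]
  by (auto simp: globO_def tilde_sections_def stalk_module_def fun_eq_iff glob_def)

lemma up_R1:
  assumes v: "v \<in> up R1"
  obtains b where "\<And>i. b i \<in> carrier A" "finite {i. b i \<noteq> \<zero>\<^bsub>A\<^esub>}" "v = (\<lambda>i. glob (b i))"
proof -
  have "\<exists>a. a \<in> carrier A \<and> v i = glob a" for i
    using mem_upD[OF v, of i] by (auto simp: R1_carrier)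
  then obtain b where b: "\<And>i. b i \<in> carrier A" "\<And>i. v i = glob (b i)" by metis
  obtain n where n: "bound \<zero>\<^bsub>R1\<^esub> n v" using v by (auto simp: up_def)
  have "b i = \<zero>\<^bsub>A\<^esub>" if "n < i" for i
  proof -
    have "glob (b i) = glob \<zero>\<^bsub>A\<^esub>"
      using n that b(2)[of i] unfolding bound_def by (auto simp: R1_ops(4))
    then show ?thesis using b(1) by (auto dest: inj_onD[OF glob_inj])
  qed
  then have "{i. b i \<noteq> \<zero>\<^bsub>A\<^esub>} \<subseteq> {..n}" by (auto simp: not_less[symmetric])
  then have "finite {i. b i \<noteq> \<zero>\<^bsub>A\<^esub>}" by (rule finite_subset) simp
  then show ?thesis using that b by auto
qed

lemma d_univ_glob: "a \<in> carrier A \<Longrightarrow> d_univ K p A X0 (glob a) = globO (dA a)"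
  by (auto simp: d_univ_def O_Spec_def openin_Spec R1_carrier globO_def d_loc_iota intro!: restrict_ext)

end

section \<open>The bijection\<close>

locale pd_sheaf = pd_aug K A p + Sh: p_O_module p "Spec A" "O_Spec p A" M
  for K :: "('k, 'e) ring_scheme" (structure)
    and A :: "('k, 'a, 'z) pd_alg_scheme" (structure)
    and p :: nat
    and M :: "('a set, 'm, (nat \<Rightarrow> 'a spec_section, 'm, 'y) module_scheme, 'w) presheaf_scheme"
begin

abbreviation M0 where "M0 \<equiv> sections M {}"
abbreviation M1 where "M1 \<equiv> sections M X0"
abbreviation O0 where "O0 \<equiv> O_sections p A {}"
abbreviation N0 where "N0 \<equiv> tilde_sections p A Om {}"

lemma sections_simps [simp]: "sections (O_Spec p A) = O_sections p A"
  "sections (tilde p A Om) = tilde_sections p A Om"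
  "restr (O_Spec p A) U W s = restrict s W" "restr (tilde p A Om) U W t = restrict t W"
  by (auto simp: O_Spec_def tilde_def)

lemma open_simps [simp]: "openin (Spec A) {}" "openin (Spec A) X0"
  by (auto simp: openin_Spec)

sublocale VM: V_mod K "O_sections p A {pos_part A}" p "sections M {pos_part A}"
  using Sh.sections_module[of X0] R1_pd by (intro V_mod.intro) auto

text \<open>The isomorphism \<open>glob\<close> of A with the ring of global functions makes the
  global sections of M a target for the universal property of \<open>I/I^2\<close>.\<close>

sublocale T0: pd_target K A p "sections M {pos_part A}"
   "\<lambda>a. A_act R1 M1 (glob a)" "P_act R1 M1"
proof -
  have g: "glob a \<in> carrier R1" if "a \<in> carrier A" for a using that by (simp add: R1_carrier)
  have pw: "glob (a [^]\<^bsub>A\<^esub> n) = glob a [^]\<^bsub>R1\<^esub> n" if "a \<in> carrier A" for a and n :: nat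
    using that by (induction n) (simp_all add: R1_ops)
  show "pd_target K A p M1 (\<lambda>a. A_act R1 M1 (glob a)) (P_act R1 M1)"
    by (intro pd_target.intro pd_target_axioms.intro pd_aug_axioms VM.N.M.abelian_group_axioms)
       (auto simp: g R1_ops(1-4) VM.A_act_add_r VM.A_act_add_l VM.A_act_mult VM.A_act_one VM.P_act_add
         VM.P_act_A_act pw)
qed

lemma glob_closed [simp]: "a \<in> carrier A \<Longrightarrow> glob a \<in> carrier R1"
  by (simp add: R1_carrier)

lemma globO_closed [simp]: "z \<in> carrier Om \<Longrightarrow> globO z \<in> carrier N1"
  by (simp add: N1_carrier)

lemma glob_pow: "a \<in> carrier A \<Longrightarrow> glob (a [^]\<^bsub>A\<^esub> n) = glob a [^]\<^bsub>R1\<^esub> n" for n :: nat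
  by (induction n) (simp_all add: R1_ops)

text \<open>Locality for the empty cover of the empty set: it has no member on which two sections
  could differ.\<close>

lemma M0_single: "x \<in> carrier M0 \<Longrightarrow> y \<in> carrier M0 \<Longrightarrow> x = y"
  by (rule Sh.locality[of "{}" "{}"]) auto

lemma O0_carrier: "carrier O0 = {\<lambda>_. undefined}" and N0_carrier: "carrier N0 = {\<lambda>_. undefined}"
  by (simp_all add: O_sections_def tilde_sections_def Let_def frac_sections_empty)

lemma N0_smult: "v \<odot>\<^bsub>N0\<^esub> s \<in> carrier N0"
  unfolding N0_carrier by (auto simp: tilde_sections_def)

lemma restr_M0: "openin (Spec A) U \<Longrightarrow> s \<in> carrier (sections M U) \<Longrightarrow> restr M U {} s \<in> carrier M0"
  using Sh.restr_hom[of U "{}"] by (auto simp: hom_def)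

text \<open>With two open sets only, the component at \<open>X0\<close> carries all the information.
  Equations in \<open>M0\<close> hold automatically because it has a single element, so over the
  empty set, and for restriction to it, membership is all that has to be known.\<close>

lemma sheaf_homI:
  assumes ext: "\<phi> \<in> extensional {U. openin (Spec A) U}"
    and restr: "\<And>U W s. restr F U W s = restrict s W"
    and car0: "carrier (sections F {}) = {\<lambda>_. undefined}"
    and add0: "\<And>s t. s \<oplus>\<^bsub>sections F {}\<^esub> t \<in> carrier (sections F {})"
    and car1: "carrier (sections F X0) \<subseteq> extensional X0"
    and ext0: "\<phi> {} \<in> extensional (carrier (sections F {}))"
    and cl0: "\<And>s. s \<in> carrier (sections F {}) \<Longrightarrow> \<phi> {} s \<in> carrier M0"
    and ext1: "\<phi> X0 \<in> extensional (carrier (sections F X0))"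
    and hom1: "\<phi> X0 \<in> hom (add_monoid (sections F X0)) (add_monoid M1)"
  shows "\<phi> \<in> sheaf_hom (Spec A) F M"
proof -
  have hom0: "\<phi> {} \<in> hom (add_monoid (sections F {})) (add_monoid M0)"
  proof (rule homI)
    fix s t assume "s \<in> carrier (add_monoid (sections F {}))" "t \<in> carrier (add_monoid (sections F {}))"
    then have st: "\<phi> {} s \<in> carrier M0" "\<phi> {} t \<in> carrier M0" using cl0 by auto
    have "abelian_group M0" by (rule Sh.sections_group) simp
    then have "\<phi> {} s \<oplus>\<^bsub>M0\<^esub> \<phi> {} t \<in> carrier M0"
      using st by (simp add: abelian_groupE(1))
    then show "\<phi> {} (s \<otimes>\<^bsub>add_monoid (sections F {})\<^esub> t) = \<phi> {} s \<otimes>\<^bsub>add_monoid M0\<^esub> \<phi> {} t"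
      using cl0[OF add0[of s t]] by (simp add: M0_single)
  qed (use cl0 in auto)
  have res: "\<phi> W (restr F U W s) = restr M U W (\<phi> U s)"
    if "openin (Spec A) U" "openin (Spec A) W" "W \<subseteq> U" "s \<in> carrier (sections F U)" for U W s
  proof (cases "W = {}")
    case True
    have "\<phi> U s \<in> carrier (sections M U)"
      using that hom0 hom1 unfolding openin_Spec hom_def by auto
    then have "restr M U {} (\<phi> U s) \<in> carrier M0" using that by (intro restr_M0)
    moreover have "\<phi> {} (restrict s {}) \<in> carrier M0"
      using cl0[of "restrict s {}"] by (simp add: car0 restrict_def)
    ultimately show ?thesis using True by (simp add: restr M0_single)
  next
    case False
    then have W: "W = X0" "U = X0" using that by (auto simp: openin_Spec)
    have "restrict s X0 = s" using that car1 W by (auto simp: extensional_restrict)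
    moreover have "\<phi> X0 s \<in> carrier M1" using hom1 that W by (auto simp: hom_def)
    ultimately show ?thesis using W by (simp add: restr Sh.restr_id)
  qed
  have each: "\<phi> U \<in> extensional (carrier (sections F U)) \<and>
        \<phi> U \<in> hom (add_monoid (sections F U)) (add_monoid (sections M U))" if "openin (Spec A) U" for U
    using that ext0 ext1 hom0 hom1 unfolding openin_Spec by auto
  show ?thesis
    unfolding sheaf_hom_def using ext each res by blast
qed

text \<open>All required equations take place in the one-element group \<open>M0\<close>, so they
  hold as soon as both sides are seen to lie in its carrier; the module structure over the empty set
  provides this.\<close>

lemma Der_empty:
  assumes D: "D \<in> carrier O0 \<rightarrow>\<^sub>E carrier M0"
  shows "D \<in> Der_p K p O0 M0"
proof -
  let ?u = "\<lambda>_. undefined"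
  interpret L: left_module "V_ring p O0" M0
    using Sh.sections_module[of "{}"] by simp
  have ops: "a \<oplus>\<^bsub>O0\<^esub> b = ?u" "a \<otimes>\<^bsub>O0\<^esub> b = ?u" "\<one>\<^bsub>O0\<^esub> = ?u" "\<zero>\<^bsub>O0\<^esub> = ?u" "c \<odot>\<^bsub>O0\<^esub> a = ?u" "pmap O0 a = ?u"
    for a b c by (auto simp: O_sections_def Let_def)
  have pow: "a [^]\<^bsub>O0\<^esub> n = ?u" for a and n :: nat
    by (cases n) (simp_all add: nat_pow_def ops)
  have Dc: "D ?u \<in> carrier M0" using D by (auto simp: O0_carrier)
  have up: "monom (UP O0) ?u n \<in> up O0" for n
    by (auto simp: UP_def O0_carrier up_def bound_def ops)
  have car: "carrier (V_ring p O0) = up O0" by (simp add: V_ring_def)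
  have A: "A_act O0 M0 ?u m \<in> carrier M0" and P: "P_act O0 M0 m \<in> carrier M0" if "m \<in> carrier M0" for m
    using that up L.smult_closed unfolding A_act_def P_act_def V_of_def V_P_def car by (auto simp: ops)
  have pos: "a = ?u" if "a \<in> pos_part O0" for a
    using that O0_carrier by (auto simp: O_sections_def Let_def)
  have fc: "D \<in> {?u} \<rightarrow>\<^sub>E carrier M0" using D by (simp add: O0_carrier)
  show ?thesis
    unfolding Der_p_def O0_carrier
    using fc Dc A P pos
    by (auto simp: ops pow intro!: M0_single L.M.a_closed L.M.minus_closed dest!: pos)
qed

lemma Der_X0_iff:
  assumes D: "D \<in> carrier R1 \<rightarrow>\<^sub>E carrier M1"
  shows "D \<in> Der_p K p R1 M1 \<longleftrightarrow> T0.is_der (\<lambda>a. D (glob a))"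
proof -
  have "(\<lambda>a. D (glob a)) \<in> carrier A \<rightarrow> carrier M1"
    using D by (auto simp: R1_carrier)
  then show ?thesis
    using D unfolding Der_p_def T0.is_der_def R1_carrier R1_pos_part
    by (simp add: R1_ops[symmetric] glob_pow[symmetric])
qed

lemma V_of_glob: "a \<in> carrier A \<Longrightarrow> V_of R1 (glob a) = (\<lambda>i. glob (if i = 0 then a else \<zero>\<^bsub>A\<^esub>))"
  and V_P_glob: "V_P R1 = (\<lambda>i. glob (if i = 1 then \<one>\<^bsub>A\<^esub> else \<zero>\<^bsub>A\<^esub>))"
  using monom_apply[of "glob a" R1 0] monom_apply[of "\<one>\<^bsub>R1\<^esub>" R1 1] glob_closed[of a] glob_closed[of "\<one>\<^bsub>A\<^esub>"]
  by (auto simp: V_of_def V_P_def R1_ops fun_eq_iff)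

lemma V_of_N1:
  assumes "a \<in> carrier A" "z \<in> carrier Om"
  shows "V_of R1 (glob a) \<odot>\<^bsub>N1\<^esub> globO z = globO (act a z)"
proof -
  let ?b = "\<lambda>i::nat. if i = 0 then a else \<zero>\<^bsub>A\<^esub>"
  have fin: "{i. ?b i \<noteq> \<zero>\<^bsub>A\<^esub>} \<subseteq> {0}" by auto
  then have "finite {i. ?b i \<noteq> \<zero>\<^bsub>A\<^esub>}" by (rule finite_subset) simp
  then have "V_of R1 (glob a) \<odot>\<^bsub>N1\<^esub> globO z = globO (vsum ?b z)"
    using assms by (subst V_of_glob) (auto intro!: N1_smult)
  also have "vsum ?b z = act a z"
    using assms by (subst vsum_superset[OF _ fin]) auto
  finally show ?thesis .
qed

lemma V_P_N1:
  assumes "z \<in> carrier Om"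
  shows "V_P R1 \<odot>\<^bsub>N1\<^esub> globO z = globO (Pop z)"
proof -
  let ?b = "\<lambda>i::nat. if i = 1 then \<one>\<^bsub>A\<^esub> else \<zero>\<^bsub>A\<^esub>"
  have fin: "{i. ?b i \<noteq> \<zero>\<^bsub>A\<^esub>} \<subseteq> {1}" by auto
  then have "finite {i. ?b i \<noteq> \<zero>\<^bsub>A\<^esub>}" by (rule finite_subset) simp
  then have "V_P R1 \<odot>\<^bsub>N1\<^esub> globO z = globO (vsum ?b z)"
    using assms unfolding V_P_glob by (intro N1_smult) auto
  also have "vsum ?b z = Pop z"
    using assms by (subst vsum_superset[OF _ fin]) (auto simp: act_simps)
  finally show ?thesis .
qed

text \<open>Linearity over the ring \<open>V\<close> of global functions is evaluated at its
  generators \<open>V_of\<close> and \<open>V_P\<close>, whose actions on the sheaf of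
  \<open>I/I^2\<close> are those of A and P. The converse passage is
  \<open>is_lin_vsum\<close>.\<close>

lemma Hom_is_lin:
  assumes \<alpha>: "\<alpha> \<in> Hom_p_O p (Spec A) (O_Spec p A) (tilde p A Om) M"
  shows "T0.is_lin (\<lambda>z. \<alpha> X0 (globO z))"
proof -
  have hom: "\<alpha> X0 \<in> hom (add_monoid N1) (add_monoid M1)"
    and lin: "\<And>v m. v \<in> up R1 \<Longrightarrow> m \<in> carrier N1 \<Longrightarrow> \<alpha> X0 (v \<odot>\<^bsub>N1\<^esub> m) = v \<odot>\<^bsub>M1\<^esub> \<alpha> X0 m"
    using \<alpha> unfolding Hom_p_O_def sheaf_hom_def by (auto simp: V_ring_def)
  show ?thesis
    unfolding T0.is_lin_def
  proof (intro conjI ballI)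
    show "(\<lambda>z. \<alpha> X0 (globO z)) \<in> carrier Om \<rightarrow> carrier M1"
      using hom by (auto simp: hom_def)
    fix x assume x: "x \<in> carrier Om"
    show "\<alpha> X0 (globO (x \<oplus>\<^bsub>Om\<^esub> y)) = \<alpha> X0 (globO x) \<oplus>\<^bsub>M1\<^esub> \<alpha> X0 (globO y)" if "y \<in> carrier Om" for y
      using hom x that by (auto simp: hom_def N1_ops)
    show "\<alpha> X0 (globO (Pop x)) = P_act R1 M1 (\<alpha> X0 (globO x))"
      using x lin[of "V_P R1" "globO x"] by (simp add: V_P_N1 P_act_def)
    show "\<alpha> X0 (globO (act a x)) = A_act R1 M1 (glob a) (\<alpha> X0 (globO x))" if "a \<in> carrier A" for a
      using x that lin[of "V_of R1 (glob a)" "globO x"] by (simp add: V_of_N1 A_act_def)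
  qed
qed

lemma is_lin_iter:
  assumes F: "T0.is_lin F" and z: "z \<in> carrier Om"
  shows "F ((Pop ^^ n) z) = (P_act R1 M1 ^^ n) (F z)"
  by (induction n) (use F z in \<open>auto simp: T0.is_lin_def\<close>)

text \<open>Commuting with A and P implies linearity over all of \<open>V(A)\<close>, because on
  both sides an element acts as the finite sum of its monomials.\<close>

lemma is_lin_vsum:
  assumes F: "T0.is_lin F" and z: "z \<in> carrier Om"
    and b: "\<And>i. b i \<in> carrier A" and fin: "finite {i. b i \<noteq> \<zero>\<^bsub>A\<^esub>}"
    and v: "(\<lambda>i. glob (b i)) \<in> up R1"
  shows "F (vsum b z) = (\<lambda>i. glob (b i)) \<odot>\<^bsub>M1\<^esub> F z"
proof -
  have Fc: "F x \<in> carrier M1" if "x \<in> carrier Om" for x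
    using F that by (auto simp: T0.is_lin_def)
  have sum: "F (finsum Om f H) = finsum M1 (\<lambda>i. F (f i)) H" if "finite H" "f \<in> H \<rightarrow> carrier Om" for f and H :: "nat set"
    using that
  proof (induction H rule: finite_induct)
    case empty
    then show ?case using T0.is_lin_zero[OF F] by simp
  next
    case (insert i H)
    then have "F (f i \<oplus>\<^bsub>Om\<^esub> finsum Om f H) = F (f i) \<oplus>\<^bsub>M1\<^esub> F (finsum Om f H)"
      using F unfolding T0.is_lin_def by (auto simp: Pi_iff)
    then show ?case using insert Fc by (simp add: Pi_iff)
  qed
  have s: "{i. glob (b i) \<noteq> \<zero>\<^bsub>R1\<^esub>} \<subseteq> {i. b i \<noteq> \<zero>\<^bsub>A\<^esub>}"
    by (auto simp: R1_ops)
  have "F (vsum b z) = finsum M1 (\<lambda>i. F (act (b i) ((Pop ^^ i) z))) {i. b i \<noteq> \<zero>\<^bsub>A\<^esub>}"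
    unfolding vsum_def using fin b z by (intro sum) auto
  also have "\<dots> = (\<Oplus>\<^bsub>M1\<^esub>i\<in>{i. b i \<noteq> \<zero>\<^bsub>A\<^esub>}. A_act R1 M1 (glob (b i)) ((P_act R1 M1 ^^ i) (F z)))"
  proof (rule VM.N.M.finsum_cong')
    show "F (act (b i) ((Pop ^^ i) z)) = A_act R1 M1 (glob (b i)) ((P_act R1 M1 ^^ i) (F z))" for i
      using F b z is_lin_iter[OF F z] unfolding T0.is_lin_def by simp
  qed (use b z Fc in auto)
  also have "\<dots> = (\<lambda>i. glob (b i)) \<odot>\<^bsub>M1\<^esub> F z"
    using VM.smult_superset[OF fin v s Fc[OF z]] by simp
  finally show ?thesis .
qed

section \<open>Composition with the universal derivation\<close>

abbreviation Hom where "Hom \<equiv> Hom_p_O p (Spec A) (O_Spec p A) (tilde p A Om) M"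
abbreviation Der where "Der \<equiv> Der_p_O K p (Spec A) (O_Spec p A) M"
definition comp_univ where "comp_univ \<alpha> = sheaf_comp (Spec A) (O_Spec p A) \<alpha> (d_univ K p A)"

lemma comp_univ_X0: "a \<in> carrier A \<Longrightarrow> comp_univ \<alpha> X0 (glob a) = \<alpha> X0 (globO (dA a))"
  by (simp add: comp_univ_def sheaf_comp_def compose_def d_univ_glob)

lemma d_univ_empty: "s \<in> carrier O0 \<Longrightarrow> d_univ K p A {} s \<in> carrier N0"
  unfolding N0_carrier by (auto simp: d_univ_def)

lemma Hom_hom: "\<alpha> \<in> Hom \<Longrightarrow> openin (Spec A) U \<Longrightarrow>
    \<alpha> U \<in> hom (add_monoid (tilde_sections p A Om U)) (add_monoid (sections M U))"
  unfolding Hom_p_O_def sheaf_hom_def by simp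

lemma Hom_empty: "\<alpha> \<in> Hom \<Longrightarrow> s \<in> carrier N0 \<Longrightarrow> \<alpha> {} s \<in> carrier M0"
  using Hom_hom[of \<alpha> "{}"] by (auto simp: hom_def)

lemma comp_univ_Der:
  assumes \<alpha>: "\<alpha> \<in> Hom"
  shows "comp_univ \<alpha> \<in> Der"
proof -
  have F: "T0.is_lin (\<lambda>z. \<alpha> X0 (globO z))" by (rule Hom_is_lin[OF \<alpha>])
  have der: "T0.is_der (\<lambda>a. comp_univ \<alpha> X0 (glob a))"
    using T0.is_lin_der[OF F] by (rule T0.is_der_cong) (simp add: comp_univ_X0)
  have ext: "comp_univ \<alpha> X0 \<in> extensional (carrier R1)" "comp_univ \<alpha> {} \<in> extensional (carrier O0)"
    by (auto simp: comp_univ_def sheaf_comp_def compose_def)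
  have c1: "comp_univ \<alpha> X0 s \<in> carrier M1" if "s \<in> carrier R1" for s
    using that der by (auto simp: R1_carrier T0.is_der_def)
  have c0: "comp_univ \<alpha> {} s \<in> carrier M0" if "s \<in> carrier O0" for s
    using that Hom_empty[OF \<alpha> d_univ_empty] by (simp add: comp_univ_def sheaf_comp_def compose_def)
  have "comp_univ \<alpha> \<in> sheaf_hom (Spec A) (O_Spec p A) M"
  proof (rule sheaf_homI)
    show "comp_univ \<alpha> \<in> extensional {U. openin (Spec A) U}" by (simp add: comp_univ_def sheaf_comp_def)
    show "carrier (sections (O_Spec p A) X0) \<subseteq> extensional X0"
      by (auto simp: R1_carrier glob_def)
    show "comp_univ \<alpha> X0 \<in> hom (add_monoid (sections (O_Spec p A) X0)) (add_monoid M1)"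
    proof (rule homI)
      fix s t assume "s \<in> carrier (add_monoid (sections (O_Spec p A) X0))"
        "t \<in> carrier (add_monoid (sections (O_Spec p A) X0))"
      then obtain a b where "a \<in> carrier A" "b \<in> carrier A" "s = glob a" "t = glob b"
        by (auto simp: R1_carrier)
      then show "comp_univ \<alpha> X0 (s \<otimes>\<^bsub>add_monoid (sections (O_Spec p A) X0)\<^esub> t) =
          comp_univ \<alpha> X0 s \<otimes>\<^bsub>add_monoid M1\<^esub> comp_univ \<alpha> X0 t"
        using der unfolding T0.is_der_def by (simp flip: R1_ops)
    qed (use c1 in auto)
    show "\<And>s t. s \<oplus>\<^bsub>sections (O_Spec p A) {}\<^esub> t \<in> carrier (sections (O_Spec p A) {})"
      by (simp add: O0_carrier) (simp add: O_sections_def Let_def restrict_def)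
  qed (use ext c0 O0_carrier in auto)
  moreover have "comp_univ \<alpha> U \<in> Der_p K p (sections (O_Spec p A) U) (sections M U)" if "openin (Spec A) U" for U
  proof -
    have "comp_univ \<alpha> X0 \<in> Der_p K p R1 M1"
      using Der_X0_iff[of "comp_univ \<alpha> X0"] der ext c1 by (auto simp: PiE_def)
    moreover have "comp_univ \<alpha> {} \<in> Der_p K p O0 M0"
      using ext c0 by (intro Der_empty) (auto simp: PiE_def)
    ultimately show ?thesis using that unfolding openin_Spec by auto
  qed
  ultimately show ?thesis unfolding Der_p_O_def by blast
qed

lemma Hom_extensional:
  "\<alpha> \<in> Hom \<Longrightarrow> \<alpha> \<in> extensional {U. openin (Spec A) U}"
  "\<alpha> \<in> Hom \<Longrightarrow> \<alpha> X0 \<in> extensional (carrier N1)"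
  "\<alpha> \<in> Hom \<Longrightarrow> \<alpha> {} \<in> extensional (carrier N0)"
  unfolding Hom_p_O_def sheaf_hom_def by auto

text \<open>At \<open>X0\<close> the values on the classes \<open>d(a)\<close> determine a linear
  map, since their multiples generate \<open>I/I^2\<close>; over the empty set there is only one
  possible value.\<close>

lemma comp_univ_inj: "inj_on comp_univ Hom"
proof (rule inj_onI)
  fix \<alpha> \<beta> assume ab: "\<alpha> \<in> Hom" "\<beta> \<in> Hom" "comp_univ \<alpha> = comp_univ \<beta>"
  have "\<alpha> X0 (globO z) = \<beta> X0 (globO z)" if "z \<in> carrier Om" for z
  proof (rule T0.is_lin_unique[OF Hom_is_lin[OF ab(1)] Hom_is_lin[OF ab(2)] _ that])
    show "\<alpha> X0 (globO (dA a)) = \<beta> X0 (globO (dA a))" if "a \<in> carrier A" for a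
      using comp_univ_X0[OF that, of \<alpha>] comp_univ_X0[OF that, of \<beta>] ab(3) by simp
  qed
  then have 1: "\<alpha> X0 = \<beta> X0"
    using Hom_extensional(2)[OF ab(1)] Hom_extensional(2)[OF ab(2)]
    by (intro extensionalityI[of _ "carrier N1"]) (auto simp: N1_carrier)
  have 0: "\<alpha> {} = \<beta> {}"
    using Hom_extensional(3)[OF ab(1)] Hom_extensional(3)[OF ab(2)]
    by (rule extensionalityI) (intro M0_single Hom_empty ab)
  show "\<alpha> = \<beta>"
    using Hom_extensional(1)[OF ab(1)] Hom_extensional(1)[OF ab(2)]
    by (rule extensionalityI) (use 0 1 in \<open>auto simp: openin_Spec\<close>)
qed

lemma comp_univ_surj:
  assumes D: "D \<in> Der"
  shows "D \<in> comp_univ ` Hom"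
proof -
  have DX: "D X0 \<in> Der_p K p R1 M1" and D0: "D {} \<in> Der_p K p O0 M0"
    and Dext: "D \<in> extensional {U. openin (Spec A) U}"
    using D unfolding Der_p_O_def sheaf_hom_def by auto
  have DXf: "D X0 \<in> carrier R1 \<rightarrow>\<^sub>E carrier M1" and D0f: "D {} \<in> carrier O0 \<rightarrow>\<^sub>E carrier M0"
    using DX D0 by (auto simp: Der_p_def)
  have der: "T0.is_der (\<lambda>a. D X0 (glob a))"
    using Der_X0_iff[OF DXf] DX by simp
  obtain F where F: "T0.is_lin F" "\<And>a. a \<in> carrier A \<Longrightarrow> F (dA a) = D X0 (glob a)"
    using T0.is_lin_exists[OF der] by blast
  have Fc: "F z \<in> carrier M1" if "z \<in> carrier Om" for z
    using F(1) that by (auto simp: T0.is_lin_def)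
  have z0: "\<zero>\<^bsub>M0\<^esub> \<in> carrier M0"
    using abelian_groupE(2)[OF Sh.sections_group[of "{}"]] by simp
  \<comment> \<open>Over \<open>X0\<close> the map \<open>F\<close> is read through the bijection
    \<open>globO\<close>; over the empty set the zero of \<open>M0\<close> is the only value
    available.\<close>
  define \<alpha> where "\<alpha> = (\<lambda>U\<in>{U. openin (Spec A) U}. if U = {} then (\<lambda>s\<in>carrier N0. \<zero>\<^bsub>M0\<^esub>)
     else (\<lambda>s\<in>carrier N1. F (the_inv_into (carrier Om) globO s)))"
  have a0: "\<alpha> {} = (\<lambda>s\<in>carrier N0. \<zero>\<^bsub>M0\<^esub>)" by (simp add: \<alpha>_def)
  have a1: "\<alpha> X0 = (\<lambda>s\<in>carrier N1. F (the_inv_into (carrier Om) globO s))" by (simp add: \<alpha>_def)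
  have ag: "\<alpha> X0 (globO z) = F z" if "z \<in> carrier Om" for z
    using that by (simp add: a1 the_inv_into_f_f[OF globO_inj])
  have "\<alpha> \<in> sheaf_hom (Spec A) (tilde p A Om) M"
  proof (rule sheaf_homI)
    show "\<alpha> \<in> extensional {U. openin (Spec A) U}" by (simp add: \<alpha>_def)
    show "carrier (sections (tilde p A Om) X0) \<subseteq> extensional X0"
      by (auto simp: N1_carrier globO_def)
    show "\<alpha> X0 \<in> hom (add_monoid (sections (tilde p A Om) X0)) (add_monoid M1)"
    proof (rule homI)
      fix s assume "s \<in> carrier (add_monoid (sections (tilde p A Om) X0))"
      then show "\<alpha> X0 s \<in> carrier (add_monoid M1)" by (auto simp: N1_carrier ag Fc)
    next
      fix s t assume "s \<in> carrier (add_monoid (sections (tilde p A Om) X0))"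
        "t \<in> carrier (add_monoid (sections (tilde p A Om) X0))"
      then obtain x y where xy: "x \<in> carrier Om" "y \<in> carrier Om" "s = globO x" "t = globO y"
        by (auto simp: N1_carrier)
      then have "\<alpha> X0 (s \<oplus>\<^bsub>N1\<^esub> t) = F (x \<oplus>\<^bsub>Om\<^esub> y)"
        by (simp add: ag flip: N1_ops)
      also have "\<dots> = \<alpha> X0 s \<oplus>\<^bsub>M1\<^esub> \<alpha> X0 t"
        using F(1) xy unfolding T0.is_lin_def by (simp add: ag)
      finally show "\<alpha> X0 (s \<otimes>\<^bsub>add_monoid (sections (tilde p A Om) X0)\<^esub> t) =
          \<alpha> X0 s \<otimes>\<^bsub>add_monoid M1\<^esub> \<alpha> X0 t" by simp
    qed
    show "\<And>s t. s \<oplus>\<^bsub>sections (tilde p A Om) {}\<^esub> t \<in> carrier (sections (tilde p A Om) {})"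
      by (simp add: N0_carrier) (simp add: tilde_sections_def restrict_def)
  qed (use a0 a1 z0 N0_carrier in auto)
  moreover have "\<alpha> U (v \<odot>\<^bsub>tilde_sections p A Om U\<^esub> m) = v \<odot>\<^bsub>sections M U\<^esub> \<alpha> U m"
    if U: "openin (Spec A) U" and v: "v \<in> carrier (V_ring p (O_sections p A U))"
      and m: "m \<in> carrier (tilde_sections p A Om U)" for U v m
  proof (cases "U = {}")
    case True
    interpret L: left_module "V_ring p O0" M0
      using Sh.sections_module[of "{}"] by simp
    have "\<alpha> {} s \<in> carrier M0" if "s \<in> carrier N0" for s using that z0 by (simp add: a0)
    then show ?thesis
      using True v m N0_smult by (auto intro!: M0_single L.smult_closed)
  next
    case False
    then have UX: "U = X0" using U by (simp add: openin_Spec)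
    obtain z where z: "z \<in> carrier Om" "m = globO z" using m UX by (auto simp: N1_carrier)
    have vu: "v \<in> up R1" using v UX by (simp add: V_ring_def)
    obtain b where b: "\<And>i. b i \<in> carrier A" "finite {i. b i \<noteq> \<zero>\<^bsub>A\<^esub>}" "v = (\<lambda>i. glob (b i))"
      using up_R1[OF vu] by blast
    have "v \<odot>\<^bsub>N1\<^esub> m = globO (vsum b z)" using b z N1_smult[OF b(1,2) z(1)] by simp
    then have "\<alpha> X0 (v \<odot>\<^bsub>N1\<^esub> m) = F (vsum b z)"
      using vsum_closed[OF b(1) z(1)] by (simp add: ag)
    also have "\<dots> = v \<odot>\<^bsub>M1\<^esub> F z"
      using is_lin_vsum[OF F(1) z(1) b(1,2)] vu b(3) by simp
    finally show ?thesis using UX z by (simp add: ag)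
  qed
  ultimately have hom: "\<alpha> \<in> Hom"
    unfolding Hom_p_O_def by simp
  have "comp_univ \<alpha> U = D U" if "openin (Spec A) U" for U
  proof (cases "U = {}")
    case True
    have "comp_univ \<alpha> {} = D {}"
    proof (rule extensionalityI[of _ "carrier O0"])
      show "comp_univ \<alpha> {} s = D {} s" if "s \<in> carrier O0" for s
      proof (rule M0_single)
        show "comp_univ \<alpha> {} s \<in> carrier M0"
          using that Hom_empty[OF hom d_univ_empty] by (simp add: comp_univ_def sheaf_comp_def compose_def)
        show "D {} s \<in> carrier M0" using D0f that by auto
      qed
    qed (use D0f in \<open>auto simp: comp_univ_def sheaf_comp_def compose_def PiE_def\<close>)
    then show ?thesis using True by simp
  next
    case False
    have "comp_univ \<alpha> X0 = D X0"
    proof (rule extensionalityI[of _ "carrier R1"])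
      show "comp_univ \<alpha> X0 s = D X0 s" if "s \<in> carrier R1" for s
        using that by (auto simp: R1_carrier comp_univ_X0 ag F(2))
    qed (use DXf in \<open>auto simp: comp_univ_def sheaf_comp_def compose_def PiE_def\<close>)
    then show ?thesis using False that by (simp add: openin_Spec)
  qed
  then have "comp_univ \<alpha> = D"
    using Dext by (intro extensionalityI[of _ "{U. openin (Spec A) U}"]) (auto simp: comp_univ_def sheaf_comp_def)
  then show ?thesis using hom by blast
qed

lemma comp_univ_bij: "bij_betw comp_univ Hom Der"
  unfolding bij_betw_def using comp_univ_inj comp_univ_Der comp_univ_surj by blast

end

theorem theorem3p13:
  fixes K :: "('k, 'e) ring_scheme"
    and A :: "('k, 'a, 'z) pd_alg_scheme"
    and M :: "('a set, 'm, (nat \<Rightarrow> 'a spec_section, 'm, 'y) module_scheme, 'w) presheaf_scheme"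
    and p :: nat
  assumes "field K" and "Factorial_Ring.prime p" and "has_characteristic K p"
    and "pdCom_k K A p"
    and "p_O_module p (Spec A) (O_Spec p A) M"
  shows "bij_betw (\<lambda>\<alpha>. sheaf_comp (Spec A) (O_Spec p A) \<alpha> (d_univ K p A))
           (Hom_p_O p (Spec A) (O_Spec p A) (tilde p A (Omega K p A)) M)
           (Der_p_O K p (Spec A) (O_Spec p A) M)"
proof -
  have "pd_char K A p"
    using assms(1-4) by (intro pd_char.intro) (auto simp: pdCom_k_def)
  then interpret P: pd_char K A p .
  have sc: "P.sc = (\<lambda>c. c \<odot>\<^bsub>A\<^esub> \<one>\<^bsub>A\<^esub>)" by (simp add: P.sc_def fun_eq_iff)
  interpret pd_sheaf K A p M
    using assms(5) pdCom_k.zero_part_k[OF assms(4)] pdCom_k.unit_inj[OF assms(4)]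
    by (intro pd_sheaf.intro pd_aug.intro pd_aug_axioms.intro P.pd_char_axioms) (simp_all add: sc)
  show ?thesis
    using comp_univ_bij by (simp add: comp_univ_def[abs_def])
qed

end
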